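(* For every integer $k \ge 0$ and every real $p$ with $2k < p < 2k+2$, $$\|1 + e(x) - e((k+2)x)\|_{L^p(\mathbb{T})} > \|1 + e(x) + e((k+2)x)\|_{L^p(\mathbb{T})} .$$
   Context: Here $e(x) = e^{2\pi i x}$ and $\mathbb{T} = \mathbb{R}/\mathbb{Z}$ carries normalized Lebesgue measure. For $0<p<\infty$, $\|h\|_{L^p(\mathbb{T})} := \left(\int_{\mathbb{T}} |h(x)|^p\,dx\right)^{1/p}$ (a quasi-norm when $p<1$). This assertion is Mockenhaupt's conjecture. *)

theory Defs
  imports "HOL-Analysis.Analysis"
begin

definition e :: "real \<Rightarrow> complex" where
  "e x = exp (2 * of_real pi * \<i> * of_real x)"

(* A function on the circle R/Z is represented by a 1-periodic function on the reals, and
   normalized Lebesgue measure on the circle by Lebesgue measure on the fundamental domain [0,1).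
   As usual for the Bochner integral, the value is meaningful only when |h|^p is integrable there
   (otherwise it is 0); this holds in particular for continuous h and p > 0. *)
definition Lp_norm_circle :: "real \<Rightarrow> (real \<Rightarrow> complex) \<Rightarrow> real" where
  "Lp_norm_circle p h = (LINT x:{0..<1}|lborel. cmod (h x) powr p) powr (1 / p)"

end

theory Submission
  imports Defs
begin

text \<open>
  Put n = k + 2 and s = p / 2. Up to a unimodular factor, 1 + z \<plusminus> z^n with z = e x is the
  conjugate of 1 \<plusminus> (z^(n-1) + z^n), so the two integrals differ only in the sign of the
  odd part of w \<mapsto> |1 + w|^(2s). For k = 0 the average of |1 + z + z^2|^2 over z and - z is a
  rotated copy of |1 + z - z^2|^2, and strict concavity of y^s concludes.

  For k > 0, integrating each Fourier mode by parts n - 1 times in z and n - 1 times in its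
  conjugate turns the difference of the integrals into a positive multiple of
    INT |1 + z + u|^(-2c) Re (cnj z / (1 - q^2)) (1 - |z|^2)^k (1 - |u|^2)^k
  over pairs of points z, u of the unit disc, where q = (cnj z)^n u^(n-1) and c = k + 1 - s lies
  in (0,1). For |.|^(2m) this is an identity between trinomial coefficients, and the partial sums
  of the binomial series carry it over to real exponents. Rotating (z, u) replaces the power of
  |1 + z + u| by its Fourier coefficients along the circle of radius r = |z + u|. The first one is
  negative and those of order l are smaller by a factor min(r, 1/r)^(l-1). For fixed z + u, the
  first mode contributes r/2 after symmetrizing in z and u, and outweighs the rest of the
  geometric series once averaged over the lens of all such pairs (z, u).
\<close>

section \<open>Lebesgue measure on the plane\<close>

text \<open>The range 2k < p < 2k + 2 is the condition 0 < c < 1. That c is positive makes the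
  binomial coefficients of -c alternate, which fixes the sign of the first Fourier coefficient. That
  c is below 1 makes their absolute values decrease, which orders the coefficients, and makes
  |w|^(-2c) integrable in the plane. This determines the number k + 1 of derivatives. The weight (1
  - |z|^2)^k is what inverting them leaves: its Beta moments raise the factorials of a trinomial
  coefficient by k + 1. One factor 1 - |z|^2 also absorbs the pole of 1 / (1 - q^2) at the boundary,
  so k = 0 takes its own argument. The obstacle is that the averaged integrand has no fixed sign:
  near r = 1 the modes do not decay through r, and for |z| and |u| close to 1 the tail exceeds r /
  2. For large r a pointwise bound still works. For smaller r only the mean over the lens is
  positive: the weight is largest at the centre z = u, and its mean is compared with the maximum of
  weight times tail. The two regimes overlap by a narrow margin, which dictates the rational
  constants.\<close>

lemma lborel_distr_isometry:
  fixes T :: "'a::euclidean_space \<Rightarrow> 'a"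
  assumes lin: "linear T" and norm_T: "\<And>x. norm (T x) = norm x"
  shows "distr lborel borel T = lborel"
proof -
  have meas [measurable]: "T \<in> borel_measurable borel"
    using lin by (intro borel_measurable_continuous_onI linear_continuous_on) (simp add: linear_linear)
  define M where "M = distr lborel borel T"
  have sets_M [measurable_cong, simp]: "sets M = sets borel" by (simp add: M_def)
  have space_M [simp]: "space M = UNIV" by (simp add: M_def)
  have inj: "inj T"
    using lin norm_T by (metis linear_injective_0 norm_eq_zero)
  hence surj: "surj T" using lin by (simp add: linear_injective_imp_surjective)
  have vball: "T -` ball 0 r = ball (0::'a) r" for r
    using norm_T by auto
  have Mball: "emeasure M (ball 0 r) = emeasure lborel (ball (0::'a) r)" for r
    unfolding M_def by (subst emeasure_distr) (simp_all add: vball)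
  have fin: "emeasure M (ball (0::'a) (real n)) \<noteq> \<infinity>" for n
    unfolding Mball using emeasure_lborel_ball_finite[of "0::'a" "real n"] by simp
  have un: "(\<Union>n. ball 0 (real n)) = (UNIV :: 'a set)"
    using reals_Archimedean2 by (force simp: dist_norm)
  interpret M: sigma_finite_measure M
    by (standard, rule exI[of _ "range (\<lambda>n. ball 0 (real n))"]) (use fin un in auto)
  interpret P: pair_sigma_finite lborel M ..
  have transl: "(\<integral>\<^sup>+y. f (x + y) \<partial>M) = (\<integral>\<^sup>+y. f y \<partial>M)"
    if [measurable]: "f \<in> borel_measurable borel" for f :: "'a \<Rightarrow> ennreal" and x
  proof -
    obtain x' where x': "x = T x'" using surj by blast
    have "(\<integral>\<^sup>+y. f (x + y) \<partial>M) = (\<integral>\<^sup>+y. f (T (x' + y)) \<partial>lborel)"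
      by (simp add: M_def nn_integral_distr x' linear_add[OF lin])
    also have "\<dots> = (\<integral>\<^sup>+y. f (T y) \<partial>distr lborel borel ((+) x'))"
      by (subst nn_integral_distr) auto
    also have "\<dots> = (\<integral>\<^sup>+y. f y \<partial>M)"
      by (simp add: M_def nn_integral_distr lborel_distr_plus)
    finally show ?thesis .
  qed
  have transl': "(\<integral>\<^sup>+y. f (x + y) \<partial>lborel) = (\<integral>\<^sup>+y. f y \<partial>lborel)"
    if [measurable]: "f \<in> borel_measurable borel" for f :: "'a \<Rightarrow> ennreal" and x
  proof -
    have "(\<integral>\<^sup>+y. f (x + y) \<partial>lborel) = (\<integral>\<^sup>+y. f y \<partial>distr lborel borel ((+) x))"
      by (subst nn_integral_distr) auto
    thus ?thesis by (simp add: lborel_distr_plus)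
  qed
  define U where "U = (ball 0 1 :: 'a set)"
  have [measurable]: "U \<in> sets borel" by (simp add: U_def)
  \<comment> \<open>Uniqueness of translation-invariant measures by Fubini: the double integral of
    1_U(x) 1_B(x + y) is computed in both orders, which makes \<open>M\<close> and
    \<open>lborel\<close> proportional. The constant is then read off on the unit ball, which an
    isometry preserves.\<close>
  have key: "emeasure M B * emeasure lborel U = emeasure lborel B * emeasure M U"
    if B [measurable]: "B \<in> sets borel" for B
  proof -
    have "emeasure M B * emeasure lborel U =
        (\<integral>\<^sup>+x. indicator U x * (\<integral>\<^sup>+y. indicator B (x + y) \<partial>M) \<partial>lborel)"
      by (subst transl) (auto simp: nn_integral_multc mult.commute)
    also have "\<dots> = (\<integral>\<^sup>+x. (\<integral>\<^sup>+y. indicator U x * indicator B (x + y) \<partial>M) \<partial>lborel)"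
      by (intro nn_integral_cong nn_integral_cmult[symmetric]) auto
    also have "\<dots> = (\<integral>\<^sup>+y. (\<integral>\<^sup>+x. indicator U x * indicator B (x + y) \<partial>lborel) \<partial>M)"
      by (rule P.Fubini'[symmetric]) measurable
    also have "\<dots> = (\<integral>\<^sup>+y. (\<integral>\<^sup>+x. indicator U (x - y) * indicator B x \<partial>lborel) \<partial>M)"
    proof (rule nn_integral_cong)
      fix y
      show "(\<integral>\<^sup>+x. indicator U x * indicator B (x + y) \<partial>lborel)
          = (\<integral>\<^sup>+x. indicator U (x - y) * indicator B x \<partial>lborel)"
        using transl'[of "\<lambda>x. indicator U (x - y) * indicator B x" y] by (simp add: add.commute)
    qed
    also have "\<dots> = (\<integral>\<^sup>+x. (\<integral>\<^sup>+y. indicator U (x - y) * indicator B x \<partial>M) \<partial>lborel)"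
      by (rule P.Fubini') simp
    also have "\<dots> = (\<integral>\<^sup>+x. indicator B x * (\<integral>\<^sup>+y. indicator U (- x + y) \<partial>M) \<partial>lborel)"
    proof (rule nn_integral_cong)
      fix x
      \<comment> \<open>The ball is symmetric, so x - y may be replaced by y - x, and the invariance
        of \<open>M\<close> applies in y.\<close>
      have "indicator U (x - y) * indicator B x = (indicator B x * indicator U (- x + y) :: ennreal)" for y
        by (auto simp: U_def norm_minus_commute mult.commute indicator_def)
      thus "(\<integral>\<^sup>+y. indicator U (x - y) * indicator B x \<partial>M)
          = indicator B x * (\<integral>\<^sup>+y. indicator U (- x + y) \<partial>M)"
        by (simp add: nn_integral_cmult)
    qed
    also have "\<dots> = emeasure lborel B * emeasure M U"
      by (subst transl) (auto simp: nn_integral_multc)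
    finally show ?thesis .
  qed
  have U0: "emeasure lborel U \<noteq> 0" "emeasure lborel U \<noteq> \<infinity>"
    using emeasure_lborel_ball_finite[of "0::'a" 1] content_ball_pos[of 1 "0::'a"]
    by (auto simp: U_def emeasure_eq_ennreal_measure)
  have "M = lborel"
  proof (rule measure_eqI)
    fix B assume "B \<in> sets M"
    hence "emeasure M B * emeasure lborel U = emeasure lborel B * emeasure lborel U"
      using key[of B] Mball[of 1] by (simp add: U_def)
    thus "emeasure M B = emeasure lborel B"
      using U0 by (metis ennreal_mult_cancel_left mult.commute infinity_ennreal_def)
  qed simp
  thus ?thesis by (simp add: M_def)
qed

lemma lborel_distr_rotation:
  fixes c :: complex
  assumes "cmod c = 1"
  shows "distr lborel borel ((*) c) = lborel"
  by (rule lborel_distr_isometry) (auto simp: assms norm_mult intro: bounded_linear.linear bounded_linear_mult_right)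

text \<open>The sign makes the superlevel sets discs, which have finite measure.\<close>
lemma distr_minus_cmod_sq:
  "distr lborel borel (\<lambda>z. - (cmod z)\<^sup>2) = density lborel (\<lambda>a. ennreal pi * indicator {..<0} a)"
proof -
  have eq: "(\<lambda>z. - (cmod z)\<^sup>2) -` {x<..} = ball 0 (sqrt (- x))" if "x < 0" for x :: real
  proof -
    have "(x < - (cmod z)\<^sup>2) \<longleftrightarrow> cmod z < sqrt (- x)" for z
      using that by (metis neg_less_iff_less minus_minus real_less_rsqrt real_sqrt_less_iff
        norm_ge_zero real_sqrt_abs abs_norm_cancel)
    thus ?thesis by (auto simp: dist_norm)
  qed
  have em: "emeasure (distr lborel borel (\<lambda>z. - (cmod z)\<^sup>2)) {x<..} = ennreal (pi * max 0 (- x))" for x :: real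
  proof (cases "x < 0")
    case True
    have "emeasure (distr lborel borel (\<lambda>z. - (cmod z)\<^sup>2)) {x<..} = emeasure lborel (ball (0::complex) (sqrt (- x)))"
      by (subst emeasure_distr) (auto simp: eq True)
    also have "\<dots> = ennreal (pi * (- x))"
      using True by (subst emeasure_ball) (auto simp: unit_ball_vol_2)
    finally show ?thesis using True by simp
  next
    case False
    hence "(\<lambda>z. - (cmod z)\<^sup>2) -` {x<..} = {}"
      by (auto simp: not_less) (smt (verit) zero_le_power2)
    thus ?thesis using False by (subst emeasure_distr) auto
  qed
  show ?thesis
  proof (rule measure_eqI_lessThan)
    show "emeasure (distr lborel borel (\<lambda>z. - (cmod z)\<^sup>2)) {x<..} < \<infinity>" for x :: real
      by (simp add: em)
    fix x :: real
    have "emeasure (density lborel (\<lambda>a. ennreal pi * indicator {..<0} a)) {x<..}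
        = ennreal pi * emeasure lborel {x<..<0}"
      by (subst emeasure_density) (auto simp: nn_integral_cmult[symmetric] nn_integral_cmult_indicator[symmetric]
          intro!: nn_integral_cong split: split_indicator)
    also have "\<dots> = ennreal (pi * max 0 (- x))"
      by (cases "x < 0") (auto simp: ennreal_mult[symmetric] simp del: mult_minus_right)
    finally show "emeasure (distr lborel borel (\<lambda>z. - (cmod z)\<^sup>2)) {x<..}
        = emeasure (density lborel (\<lambda>a. ennreal pi * indicator {..<0} a)) {x<..}"
      by (simp add: em)
  qed auto
qed

text \<open>Polar coordinates in the squared radius, whose Jacobian is the constant pi; this turns
  disc moments directly into Beta integrals.\<close>

lemma nn_integral_radial:
  fixes f :: "real \<Rightarrow> ennreal"
  assumes [measurable]: "f \<in> borel_measurable borel"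
  shows "(\<integral>\<^sup>+z. f ((cmod z)\<^sup>2) \<partial>lborel) = ennreal pi * (\<integral>\<^sup>+a. f a * indicator {0<..} a \<partial>lborel)"
proof -
  have "(\<integral>\<^sup>+z. f ((cmod z)\<^sup>2) \<partial>lborel) = (\<integral>\<^sup>+a. f (- a) \<partial>distr lborel borel (\<lambda>z. - (cmod z)\<^sup>2))"
    by (subst nn_integral_distr) auto
  also have "\<dots> = (\<integral>\<^sup>+a. ennreal pi * (f (- a) * indicator {0<..} (- a)) \<partial>lborel)"
    unfolding distr_minus_cmod_sq
    by (subst nn_integral_density) (auto intro!: nn_integral_cong split: split_indicator)
  also have "\<dots> = ennreal pi * (\<integral>\<^sup>+a. f (- a) * indicator {0<..} (- a) \<partial>lborel)"
    by (rule nn_integral_cmult) simp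
  also have "(\<integral>\<^sup>+a. f (- a) * indicator {0<..} (- a) \<partial>lborel)
      = (\<integral>\<^sup>+a. f a * indicator {0<..} a \<partial>distr lborel borel uminus)"
    by (subst nn_integral_distr) auto
  finally show ?thesis by (simp add: lborel_distr_uminus)
qed

section \<open>Moments of the disc weight\<close>

lemma borel_measurable_cnj [measurable]:
  "f \<in> borel_measurable M \<Longrightarrow> (\<lambda>x. cnj (f x)) \<in> borel_measurable M"
  by (erule borel_measurable_continuous_on[rotated]) (intro continuous_intros)

text \<open>The truncation by \<open>max 0\<close> extends the weight by zero, so that integrals
  over the disc become integrals over the whole plane and isometries apply without moving a domain.
  For k = 0 the power is the constant 1 and cuts nothing off; hence \<open>0 < k\<close> wherever
  the support matters.\<close>

definition weight :: "nat \<Rightarrow> complex \<Rightarrow> real" where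
  "weight k z = (max 0 (1 - (cmod z)\<^sup>2)) ^ k"

lemma weight_measurable [measurable]: "weight k \<in> borel_measurable borel"
  unfolding weight_def by measurable

lemma weight_nonneg [simp]: "0 \<le> weight k z"
  by (simp add: weight_def)

lemma weight_le_1: "weight k z \<le> 1"
  by (simp add: weight_def power_le_one)

lemma weight_inside: "cmod z < 1 \<Longrightarrow> weight k z = (1 - (cmod z)\<^sup>2) ^ k"
  by (simp add: weight_def max_def power_le_one_iff abs_square_le_1)

lemma weight_outside: "0 < k \<Longrightarrow> 1 \<le> cmod z \<Longrightarrow> weight k z = 0"
  using one_le_power[of "cmod z" 2] by (simp add: weight_def max_absorb1)

lemma weight_mult: "cmod c = 1 \<Longrightarrow> weight k (c * z) = weight k z"
  by (simp add: weight_def norm_mult)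

lemma integrable_weight:
  fixes f :: "complex \<Rightarrow> 'a::{banach, second_countable_topology}"
  assumes [measurable]: "f \<in> borel_measurable borel" and k: "0 < k"
    and B: "\<And>z. cmod z < 1 \<Longrightarrow> norm (f z) \<le> B"
  shows "integrable lborel (\<lambda>z. weight k z *\<^sub>R f z)"
proof (rule Bochner_Integration.integrable_bound)
  show "integrable lborel (\<lambda>z::complex. B * indicator (ball 0 1) z)"
    using emeasure_lborel_ball_finite[of "0::complex" 1]
    by (intro integrable_mult_right integrable_real_indicator) auto
  show "AE z in lborel. norm (weight k z *\<^sub>R f z) \<le> norm (B * indicator (ball 0 1) z)"
  proof (rule AE_I2)
    fix z
    show "norm (weight k z *\<^sub>R f z) \<le> norm (B * indicator (ball 0 1) z)"
    proof (cases "cmod z < 1")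
      case True
      have "weight k z * norm (f z) \<le> 1 * B"
        by (intro mult_mono weight_le_1 B True) auto
      thus ?thesis using True by (simp add: dist_norm)
    qed (use weight_outside[OF k] in auto)
  qed
qed measurable

lemma nn_integral_Beta_powr:
  assumes "-1 < r"
  shows "(\<integral>\<^sup>+u. ennreal (indicator {0..1} u * (u powr r * (1 - u) powr real k)) \<partial>lborel)
    = ennreal (Beta (r + 1) (real k + 1))"
  using nn_integral_has_integral_lebesgue[OF _ has_integral_Beta_real[of "r + 1" "real k + 1"]] assms
  by simp

lemma Beta_fact: "Beta (real A + 1) (real k + 1) = fact A * fact k / fact (A + k + 1)"
proof -
  have "Gamma (real A + 1 + (real k + 1)) = fact (A + k + 1)"
    using Gamma_fact[of "A + k + 1", where 'a = real] by (simp add: algebra_simps)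
  moreover have "Gamma (real m + 1) = fact m" for m
    using Gamma_fact[of m, where 'a = real] by (simp add: algebra_simps)
  ultimately show ?thesis by (simp add: Beta_def)
qed

lemma integral_weight_radial:
  assumes "0 < k"
  shows "(LINT z|lborel. weight k z * (cmod z)\<^sup>2 ^ p) = pi * Beta (real p + 1) (real k + 1)"
proof -
  have "(\<integral>\<^sup>+z. ennreal (weight k z * (cmod z)\<^sup>2 ^ p) \<partial>lborel)
      = ennreal pi * (\<integral>\<^sup>+a. ennreal ((max 0 (1 - a)) ^ k * a ^ p) * indicator {0<..} a \<partial>lborel)"
    unfolding weight_def
    by (rule nn_integral_radial[of "\<lambda>a. ennreal ((max 0 (1 - a)) ^ k * a ^ p)"]) simp
  also have "(\<integral>\<^sup>+a. ennreal ((max 0 (1 - a)) ^ k * a ^ p) * indicator {0<..} a \<partial>lborel)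
      = (\<integral>\<^sup>+a. ennreal (indicator {0..1} a * (a powr real p * (1 - a) powr real k)) \<partial>lborel)"
  proof (rule nn_integral_cong)
    fix a :: real
    consider "a \<le> 0" | "0 < a" "a < 1" | "1 \<le> a" by linarith
    thus "ennreal ((max 0 (1 - a)) ^ k * a ^ p) * indicator {0<..} a
        = ennreal (indicator {0..1} a * (a powr real p * (1 - a) powr real k))"
      using assms by cases (auto simp: powr_realpow max_def mult.commute split: split_indicator)
  qed
  also have "\<dots> = ennreal (Beta (real p + 1) (real k + 1))"
    by (rule nn_integral_Beta_powr) simp
  finally have "(\<integral>\<^sup>+z. ennreal (weight k z * (cmod z)\<^sup>2 ^ p) \<partial>lborel)
      = ennreal (pi * Beta (real p + 1) (real k + 1))"
    by (simp add: ennreal_mult'[symmetric])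
  thus ?thesis
    by (subst integral_eq_nn_integral) (auto simp: Beta_fact)
qed

lemma integral_weight_monomial:
  assumes k: "0 < k"
  shows "(LINT z|lborel. weight k z *\<^sub>R (z ^ p * cnj z ^ r))
    = (if p = r then of_real (pi * Beta (real p + 1) (real k + 1)) else 0)"
proof (cases "p = r")
  case True
  have "(LINT z|lborel. weight k z *\<^sub>R (z ^ p * cnj z ^ r))
      = (LINT z|lborel. complex_of_real (weight k z * (cmod z)\<^sup>2 ^ p))"
    by (intro Bochner_Integration.integral_cong)
      (simp_all add: True scaleR_conv_of_real complex_norm_square[symmetric] power_mult_distrib[symmetric])
  also have "\<dots> = of_real (pi * Beta (real p + 1) (real k + 1))"
    unfolding integral_complex_of_real integral_weight_radial[OF k] ..
  finally show ?thesis using True by simp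
next
  case False
  \<comment> \<open>The angle is chosen so that rotating by \<open>c\<close> multiplies the monomial
    by -1.\<close>
  define c where "c = cis (pi / (real p - real r))"
  have c1: "cmod c = 1" by (simp add: c_def)
  have "c ^ p * cnj c ^ r = cis (real p * (pi / (real p - real r)) - real r * (pi / (real p - real r)))"
    by (simp add: c_def Complex.DeMoivre cis_cnj cis_mult)
  also have "real p * (pi / (real p - real r)) - real r * (pi / (real p - real r)) = pi"
    by (subst left_diff_distrib[symmetric]) (use False in simp)
  finally have cc: "c ^ p * cnj c ^ r = -1" by simp
  let ?I = "LINT z|lborel. weight k z *\<^sub>R (z ^ p * cnj z ^ r)"
  have "?I = (LINT z|distr lborel borel ((*) c). weight k z *\<^sub>R (z ^ p * cnj z ^ r))"
    by (simp add: lborel_distr_rotation c1)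
  also have "\<dots> = (LINT z|lborel. weight k (c * z) *\<^sub>R ((c * z) ^ p * cnj (c * z) ^ r))"
    by (rule integral_distr) measurable
  also have "\<dots> = (LINT z|lborel. (c ^ p * cnj c ^ r) * (weight k z *\<^sub>R (z ^ p * cnj z ^ r)))"
    by (intro Bochner_Integration.integral_cong) (auto simp: weight_mult c1 power_mult_distrib)
  also have "\<dots> = - ?I" by (simp add: cc)
  finally show ?thesis using False by simp
qed

section \<open>Trinomial coefficients\<close>

lemma lborel_integral_mult_pair:
  fixes f :: "'a::euclidean_space \<Rightarrow> 'c::{real_normed_field, banach, second_countable_topology}"
    and g :: "'b::euclidean_space \<Rightarrow> 'c"
  assumes f: "integrable lborel f" and g: "integrable lborel g"
  shows lborel_integrable_mult_pair: "integrable lborel (\<lambda>p. f (fst p) * g (snd p))"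
    and "(LINT p|lborel. f (fst p) * g (snd p)) = (LINT x|lborel. f x) * (LINT y|lborel. g y)"
proof -
  have [measurable]: "f \<in> borel_measurable borel" "g \<in> borel_measurable borel"
    using f g by auto
  have int: "integrable (lborel \<Otimes>\<^sub>M lborel) (\<lambda>p. f (fst p) * g (snd p))"
  proof (rule lborel_pair.Fubini_integrable)
    show "integrable lborel (\<lambda>x. LINT y|lborel. norm (f (fst (x, y)) * g (snd (x, y))))"
      using f by (simp add: norm_mult)
    show "AE x in lborel. integrable lborel (\<lambda>y. f (fst (x, y)) * g (snd (x, y)))"
      using g by simp
  qed measurable
  thus "integrable lborel (\<lambda>p. f (fst p) * g (snd p))" by (simp add: lborel_prod)
  have "(LINT p|(lborel \<Otimes>\<^sub>M lborel). f (fst p) * g (snd p)) = (LINT x|lborel. LINT y|lborel. f x * g y)"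
    using lborel_pair.integral_fst'[OF int] by simp
  thus "(LINT p|lborel. f (fst p) * g (snd p)) = (LINT x|lborel. f x) * (LINT y|lborel. g y)"
    by (simp add: lborel_prod)
qed

text \<open>In this form the coefficient vanishes by itself for i + j > m, so all sums can run over
  fixed squares of indices.\<close>

definition tri :: "nat \<Rightarrow> nat \<Rightarrow> nat \<Rightarrow> nat" where
  "tri m i j = (m choose i) * ((m - i) choose j)"

lemma tri_eq_0: "m < i + j \<Longrightarrow> tri m i j = 0"
  by (cases "i \<le> m") (auto simp: tri_def)

lemma tri_fact:
  assumes "i + j \<le> m"
  shows "real (tri m i j) = fact m / (fact i * fact j * fact (m - i - j))"
  using assms by (simp add: tri_def binomial_fact)

lemma tri_commute: "tri m i j = tri m j i"
proof (cases "i + j \<le> m")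
  case True
  hence "real (tri m i j) = real (tri m j i)"
    by (simp add: tri_fact add.commute[of i j] mult.commute)
  thus ?thesis by simp
qed (simp add: tri_eq_0)

lemma trinomial:
  fixes x y :: "'a::comm_ring_1"
  shows "(1 + x + y) ^ m = (\<Sum>i\<le>m. \<Sum>j\<le>m. of_nat (tri m i j) * (x ^ i * y ^ j))"
proof -
  have "(x + (y + 1)) ^ m = (\<Sum>i\<le>m. of_nat (m choose i) * x ^ i * (y + 1) ^ (m - i))"
    by (rule binomial_ring)
  also have "\<dots> = (\<Sum>i\<le>m. \<Sum>j\<le>m. of_nat (tri m i j) * (x ^ i * y ^ j))"
  proof (rule sum.cong)
    fix i assume "i \<in> {..m}"
    have "(y + 1) ^ (m - i) = (\<Sum>j\<le>m-i. of_nat ((m - i) choose j) * y ^ j)"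
      by (simp add: binomial_ring)
    also have "\<dots> = (\<Sum>j\<le>m. of_nat ((m - i) choose j) * y ^ j)"
    proof (rule sum.mono_neutral_left)
      show "\<forall>j\<in>{..m} - {..m - i}. of_nat ((m - i) choose j) * y ^ j = 0"
        by (simp add: binomial_eq_0)
    qed auto
    finally show "of_nat (m choose i) * x ^ i * (y + 1) ^ (m - i)
        = (\<Sum>j\<le>m. of_nat (tri m i j) * (x ^ i * y ^ j))"
      by (simp add: sum_distrib_left tri_def mult_ac)
  qed simp
  finally show ?thesis by (simp add: add_ac)
qed

text \<open>This lets Beta factors raise the exponent of a trinomial coefficient by \<open>k + 1\<close>.\<close>
lemma tri_mult_Beta:
  "real (tri A p j) * Beta (real p + 1) (real k + 1)
    = Beta (real A + 1) (real k + 1) * real (tri (A + k + 1) (p + k + 1) j)"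
proof (cases "p + j \<le> A")
  case True
  have "A + k + 1 - (p + k + 1) - j = A - p - j" by simp
  with True show ?thesis
    by (subst (1 2) tri_fact) (simp_all add: Beta_fact)
qed (simp add: tri_eq_0)

text \<open>Orthogonality of the monomials leaves only i = i' + r and j' = j + s among the products
  of two trinomial terms. The two surviving moments are Beta values, and each raises one of the
  trinomial coefficients from A to A + k + 1 together with one of its lower indices.\<close>

lemma integral_weight_trinomial:
  assumes k: "0 < k"
  shows "(LINT p|lborel. (weight k (fst p) * weight k (snd p)) *\<^sub>R
       ((1 + fst p + snd p) ^ A * cnj (1 + fst p + snd p) ^ A * (cnj (fst p) ^ r * snd p ^ s)))
    = of_real (pi\<^sup>2 * Beta (real A + 1) (real k + 1) ^ 2 *
        (\<Sum>i\<le>A. \<Sum>j\<le>A. real (tri (A + k + 1) (i + r + k + 1) j * tri (A + k + 1) i (j + s + k + 1))))"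
proof -
  define mom where "mom p q = (LINT z|lborel. weight k z *\<^sub>R (z ^ p * cnj z ^ q))" for p q
  define f where "f p q = (\<lambda>z. weight k z *\<^sub>R (z ^ p * cnj z ^ q))" for p q
  have int: "integrable lborel (f p q)" for p q
    unfolding f_def
    by (rule integrable_weight[OF _ k, where B = 1])
      (auto simp: norm_mult norm_power power_le_one mult_le_one)
  have prod_int: "integrable lborel (\<lambda>pr. f p q (fst pr) * f p' q' (snd pr))" for p q p' q'
    by (rule lborel_integrable_mult_pair[OF int int])
  have prod_val: "(LINT pr|lborel. f p q (fst pr) * f p' q' (snd pr)) = mom p q * mom p' q'" for p q p' q'
    using lborel_integral_mult_pair(2)[OF int int] by (simp add: mom_def f_def)
  define c where "c i j i' j' = complex_of_real (real (tri A i j * tri A i' j'))" for i j i' j'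
  have expand: "(weight k (fst p) * weight k (snd p)) *\<^sub>R
       ((1 + fst p + snd p) ^ A * cnj (1 + fst p + snd p) ^ A * (cnj (fst p) ^ r * snd p ^ s))
     = (\<Sum>i\<le>A. \<Sum>j\<le>A. \<Sum>i'\<le>A. \<Sum>j'\<le>A. c i j i' j' * (f i (i' + r) (fst p) * f (j + s) j' (snd p)))" for p
  proof -
    define z u where "z = fst p" and "u = snd p"
    define C where "C = complex_of_real (weight k z * weight k u) * (cnj z ^ r * u ^ s)"
    have "(weight k z * weight k u) *\<^sub>R ((1 + z + u) ^ A * cnj (1 + z + u) ^ A * (cnj z ^ r * u ^ s))
        = (1 + z + u) ^ A * ((1 + cnj z + cnj u) ^ A * C)"
      by (simp add: C_def scaleR_conv_of_real mult_ac)
    also have "\<dots> = (\<Sum>i\<le>A. \<Sum>j\<le>A. of_nat (tri A i j) * (z ^ i * u ^ j) *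
        (\<Sum>i'\<le>A. \<Sum>j'\<le>A. of_nat (tri A i' j') * (cnj z ^ i' * cnj u ^ j') * C))"
      by (simp only: trinomial sum_distrib_right)
    also have "\<dots> = (\<Sum>i\<le>A. \<Sum>j\<le>A. \<Sum>i'\<le>A. \<Sum>j'\<le>A. c i j i' j' * (f i (i' + r) z * f (j + s) j' u))"
      unfolding sum_distrib_left f_def c_def C_def
      by (intro sum.cong refl) (simp add: scaleR_conv_of_real power_add mult_ac)
    finally show ?thesis by (simp only: z_def u_def)
  qed
  have "(LINT p|lborel. (weight k (fst p) * weight k (snd p)) *\<^sub>R
       ((1 + fst p + snd p) ^ A * cnj (1 + fst p + snd p) ^ A * (cnj (fst p) ^ r * snd p ^ s)))
     = (\<Sum>i\<le>A. \<Sum>j\<le>A. \<Sum>i'\<le>A. \<Sum>j'\<le>A. c i j i' j' * (mom i (i' + r) * mom (j + s) j'))"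
    unfolding expand by (simp add: prod_int prod_val)
  also have "\<dots> = (\<Sum>j\<le>A. \<Sum>i'\<le>A. \<Sum>i\<le>A. \<Sum>j'\<le>A. c i j i' j' * (mom i (i' + r) * mom (j + s) j'))"
    by (rule trans[OF sum.swap], rule sum.cong[OF refl], rule sum.swap)
  also have "\<dots> = (\<Sum>j\<le>A. \<Sum>i'\<le>A. c (i' + r) j i' (j + s) * (mom (i' + r) (i' + r) * mom (j + s) (j + s)))"
  proof (intro sum.cong refl)
    fix j i'
    have 1: "(\<Sum>j'\<le>A. c i j i' j' * (mom i (i' + r) * mom (j + s) j'))
        = c i j i' (j + s) * (mom i (i' + r) * mom (j + s) (j + s))" for i
    proof -
      have "(\<Sum>j'\<le>A. c i j i' j' * (mom i (i' + r) * mom (j + s) j'))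
          = (\<Sum>j'\<le>A. if j' = j + s then c i j i' (j + s) * (mom i (i' + r) * mom (j + s) (j + s)) else 0)"
        by (intro sum.cong refl) (auto simp: mom_def integral_weight_monomial[OF k])
      \<comment> \<open>If j + s exceeds A the sum has no matching index, but then the coefficient
        on the right vanishes as well.\<close>
      thus ?thesis by (auto simp: c_def tri_eq_0 not_le)
    qed
    have "(\<Sum>i\<le>A. c i j i' (j + s) * (mom i (i' + r) * mom (j + s) (j + s)))
        = (\<Sum>i\<le>A. if i = i' + r then c (i' + r) j i' (j + s) * (mom (i' + r) (i' + r) * mom (j + s) (j + s)) else 0)"
      by (intro sum.cong refl) (auto simp: mom_def integral_weight_monomial[OF k])
    also have "\<dots> = c (i' + r) j i' (j + s) * (mom (i' + r) (i' + r) * mom (j + s) (j + s))"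
      by (auto simp: c_def tri_eq_0 not_le)
    finally show "(\<Sum>i\<le>A. \<Sum>j'\<le>A. c i j i' j' * (mom i (i' + r) * mom (j + s) j'))
        = c (i' + r) j i' (j + s) * (mom (i' + r) (i' + r) * mom (j + s) (j + s))"
      unfolding 1 .
  qed
  also have "\<dots> = (\<Sum>j\<le>A. \<Sum>i\<le>A. of_real (pi\<^sup>2 * Beta (real A + 1) (real k + 1) ^ 2 *
      real (tri (A + k + 1) (i + r + k + 1) j * tri (A + k + 1) i (j + s + k + 1))))"
  proof (intro sum.cong refl)
    fix j i
    have "c (i + r) j i (j + s) * (mom (i + r) (i + r) * mom (j + s) (j + s))
      = of_real (pi\<^sup>2 * (real (tri A (i + r) j) * Beta (real (i + r) + 1) (real k + 1)) *
          (real (tri A (j + s) i) * Beta (real (j + s) + 1) (real k + 1)))"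
      by (simp add: c_def mom_def integral_weight_monomial[OF k] power2_eq_square tri_commute[of A i])
    also have "\<dots> = of_real (pi\<^sup>2 * Beta (real A + 1) (real k + 1) ^ 2 *
      real (tri (A + k + 1) (i + r + k + 1) j * tri (A + k + 1) i (j + s + k + 1)))"
      unfolding tri_mult_Beta tri_commute[of _ i] by (simp add: power2_eq_square)
    finally show "c (i + r) j i (j + s) * (mom (i + r) (i + r) * mom (j + s) (j + s)) = \<dots>" .
  qed
  finally show ?thesis
    by (subst sum.swap) (simp add: sum_distrib_left)
qed

section \<open>Fourier expansion on the line\<close>

lemma norm_e [simp]: "cmod (e x) = 1"
  by (simp add: e_def)

lemma e_add: "e (x + y) = e x * e y"
  by (simp add: e_def exp_add[symmetric] algebra_simps)

lemma e_0 [simp]: "e 0 = 1"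
  by (simp add: e_def)

lemma e_minus: "e (- x) = cnj (e x)"
  by (simp add: e_def exp_cnj)

lemma e_power: "e x ^ m = e (real m * x)"
  by (induction m) (auto simp: e_add[symmetric] algebra_simps)

lemma e_of_int [simp]: "e (of_int j) = 1"
  by (simp add: e_def exp_eq_1)

lemma continuous_on_e [continuous_intros]:
  "continuous_on S f \<Longrightarrow> continuous_on S (\<lambda>x. e (f x))"
  unfolding e_def by (intro continuous_intros)

lemma borel_measurable_e [measurable]: "e \<in> borel_measurable borel"
  by (intro borel_measurable_continuous_onI continuous_intros)

lemma set_integrable_Ico_continuous:
  fixes f :: "real \<Rightarrow> 'a::euclidean_space"
  assumes "continuous_on UNIV f"
  shows "set_integrable lborel {0..<1} f"
proof (rule set_integrable_subset)
  show "set_integrable lborel {0..1} f"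
    unfolding set_integrable_def
    by (intro borel_integrable_compact) (auto intro: continuous_on_subset[OF assms])
qed auto

lemma set_integral_Ico_continuous:
  fixes f :: "real \<Rightarrow> 'a::euclidean_space"
  assumes "continuous_on UNIV f"
  shows "(LINT x:{0..<1}|lborel. f x) = integral {0..1} f"
proof -
  have "(LINT x:{0..<1}|lborel. f x) = integral {0..<1} f"
    by (rule set_borel_integral_eq_integral(2)[OF set_integrable_Ico_continuous[OF assms]])
  also have "\<dots> = integral {0..1} f"
    by (rule integral_spike_set) (auto intro: negligible_subset[OF negligible_sing[of 1]])
  finally show ?thesis .
qed

lemma set_integral_e: "(LINT x:{0..<1}|lborel. e (of_int j * x)) = (if j = 0 then 1 else 0)"
proof -
  have eq: "(LINT x:{0..<1}|lborel. e (of_int j * x)) = integral {0..1} (\<lambda>x. e (of_int j * x))"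
    by (intro set_integral_Ico_continuous continuous_intros)
  show ?thesis
  proof (cases "j = 0")
    case True
    thus ?thesis unfolding eq by simp
  next
    case False
    define c where "c = 2 * of_real pi * \<i> * of_int j"
    have "((\<lambda>x. e (of_int j * x)) has_integral (e (of_int j * 1) / c - e (of_int j * 0) / c)) {0..1}"
    proof (rule fundamental_theorem_of_calculus)
      fix x :: real
      have "((\<lambda>x. exp (c * of_real x) / c) has_vector_derivative exp (c * of_real x)) (at x within {0..1})"
        using False by (auto intro!: derivative_eq_intros has_vector_derivative_real_field simp: c_def)
      thus "((\<lambda>x. e (of_int j * x) / c) has_vector_derivative e (of_int j * x)) (at x within {0..1})"
        by (simp add: e_def c_def mult_ac)
    qed simp
    hence "integral {0..1} (\<lambda>x. e (of_int j * x)) = 0"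
      using e_of_int[of j] by (simp add: integral_unique)
    thus ?thesis using False eq by simp
  qed
qed

text \<open>This is 1 + \<sigma> (z + u) on the closed curve z = e((k + 1) x), u = e((k + 2) x) of
  the torus. With \<sigma> on both oscillating terms, its change of sign affects exactly the
  monomials of odd total degree.\<close>

definition line :: "nat \<Rightarrow> real \<Rightarrow> real \<Rightarrow> complex" where
  "line k \<sigma> x = 1 + \<sigma> * e (real (k + 1) * x) + \<sigma> * e (real (k + 2) * x)"

lemma continuous_on_line [continuous_intros]: "continuous_on S (line k \<sigma>)"
  unfolding line_def by (intro continuous_intros)

lemma set_integral_line_power:
  "(LINT x:{0..<1}|lborel. complex_of_real ((cmod (line k \<sigma> x))\<^sup>2 ^ m))
    = (\<Sum>i\<le>m. \<Sum>j\<le>m. \<Sum>i'\<le>m. \<Sum>j'\<le>m. of_real (real (tri m i j * tri m i' j') * \<sigma> ^ (i + j + i' + j')) *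
       (if (k + 1) * i + (k + 2) * j = (k + 1) * i' + (k + 2) * j' then 1 else 0))"
proof -
  define c where "c i j i' j' = complex_of_real (real (tri m i j * tri m i' j') * \<sigma> ^ (i + j + i' + j'))" for i j i' j'
  define d where "d i j i' j' = int ((k + 1) * i + (k + 2) * j) - int ((k + 1) * i' + (k + 2) * j')" for i j i' j'
  have "complex_of_real ((cmod (line k \<sigma> x))\<^sup>2 ^ m)
      = (\<Sum>i\<le>m. \<Sum>j\<le>m. \<Sum>i'\<le>m. \<Sum>j'\<le>m. c i j i' j' * e (of_int (d i j i' j') * x))" for x
  proof -
    define z u where "z = \<sigma> * e (real (k + 1) * x)" and "u = \<sigma> * e (real (k + 2) * x)"
    have "complex_of_real ((cmod (line k \<sigma> x))\<^sup>2 ^ m) = (1 + z + u) ^ m * (1 + cnj z + cnj u) ^ m"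
    proof -
      have "line k \<sigma> x = 1 + z + u" by (simp only: line_def z_def u_def)
      hence "complex_of_real ((cmod (line k \<sigma> x))\<^sup>2 ^ m) = ((1 + z + u) * cnj (1 + z + u)) ^ m"
        by (simp only: of_real_power[of "(cmod (1 + z + u))\<^sup>2" m] complex_norm_square)
      also have "cnj (1 + z + u) = 1 + cnj z + cnj u" by simp
      finally show ?thesis by (simp only: power_mult_distrib)
    qed
    also have "\<dots> = (\<Sum>i\<le>m. \<Sum>j\<le>m. of_nat (tri m i j) * (z ^ i * u ^ j) *
        (\<Sum>i'\<le>m. \<Sum>j'\<le>m. of_nat (tri m i' j') * (cnj z ^ i' * cnj u ^ j')))"
      by (simp only: trinomial sum_distrib_right)
    also have "\<dots> = (\<Sum>i\<le>m. \<Sum>j\<le>m. \<Sum>i'\<le>m. \<Sum>j'\<le>m. c i j i' j' * e (of_int (d i j i' j') * x))"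
      unfolding sum_distrib_left
    proof (intro sum.cong refl)
      fix i j i' j'
      define E F where "E = e (real (k + 1) * x)" and "F = e (real (k + 2) * x)"
      have zE: "z = \<sigma> * E" "u = \<sigma> * F"
        by (simp_all only: z_def u_def E_def F_def)
      have "e (of_int (d i j i' j') * x) = E ^ i * F ^ j * (cnj E ^ i' * cnj F ^ j')"
        unfolding E_def F_def e_minus[symmetric] e_power e_add[symmetric] d_def
        by (rule arg_cong[of _ _ e]) (simp add: algebra_simps)
      thus "of_nat (tri m i j) * (z ^ i * u ^ j) * (of_nat (tri m i' j') * (cnj z ^ i' * cnj u ^ j'))
          = c i j i' j' * e (of_int (d i j i' j') * x)"
        unfolding zE by (simp add: c_def power_mult_distrib power_add mult_ac)
    qed
    finally show ?thesis .
  qed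
  hence "(LINT x:{0..<1}|lborel. complex_of_real ((cmod (line k \<sigma> x))\<^sup>2 ^ m))
      = (LINT x:{0..<1}|lborel. (\<Sum>i\<le>m. \<Sum>j\<le>m. \<Sum>i'\<le>m. \<Sum>j'\<le>m. c i j i' j' * e (of_int (d i j i' j') * x)))"
    by simp
  also have "\<dots> = (\<Sum>i\<le>m. \<Sum>j\<le>m. \<Sum>i'\<le>m. \<Sum>j'\<le>m. c i j i' j' * (LINT x:{0..<1}|lborel. e (of_int (d i j i' j') * x)))"
  proof -
    define w where "w = (indicator {0..<1} :: real \<Rightarrow> real)"
    have int: "integrable lborel (\<lambda>x. w x *\<^sub>R e (of_int l * x))" for l
      using set_integrable_Ico_continuous[of "\<lambda>x. e (of_int l * x)"]
      by (simp add: set_integrable_def continuous_intros w_def)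
    have eq: "w x *\<^sub>R (\<Sum>i\<le>m. \<Sum>j\<le>m. \<Sum>i'\<le>m. \<Sum>j'\<le>m. c i j i' j' * e (of_int (d i j i' j') * x))
        = (\<Sum>i\<le>m. \<Sum>j\<le>m. \<Sum>i'\<le>m. \<Sum>j'\<le>m. c i j i' j' * (w x *\<^sub>R e (of_int (d i j i' j') * x)))" for x
      by (simp add: scaleR_sum_right)
    show ?thesis
      unfolding set_lebesgue_integral_def w_def[symmetric] eq
      by (simp add: int del: mult_scaleR_right)
  qed
  also have "\<dots> = (\<Sum>i\<le>m. \<Sum>j\<le>m. \<Sum>i'\<le>m. \<Sum>j'\<le>m. c i j i' j' *
       (if (k + 1) * i + (k + 2) * j = (k + 1) * i' + (k + 2) * j' then 1 else 0))"
  proof (intro sum.cong refl)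
    fix i j i' j'
    have "d i j i' j' = 0 \<longleftrightarrow> (k + 1) * i + (k + 2) * j = (k + 1) * i' + (k + 2) * j'"
      unfolding d_def by (metis diff_eq_eq add_0 of_nat_eq_iff)
    thus "c i j i' j' * (LINT x:{0..<1}|lborel. e (of_int (d i j i' j') * x))
        = c i j i' j' * (if (k + 1) * i + (k + 2) * j = (k + 1) * i' + (k + 2) * j' then 1 else 0)"
      unfolding set_integral_e by simp
  qed
  finally show ?thesis by (simp only: c_def)
qed

text \<open>The difference keeps the resonant index quadruples of odd total degree. Since k + 1 and
  k + 2 are coprime, resonance means i - i' = (k + 2) l and j' - j = (k + 1) l for an integer l, and
  the total degree has the parity of l. One factor 2 comes from the sign change, the other from the
  symmetry l to -l.\<close>

lemma set_integral_line_power_diff: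
  "(LINT x:{0..<1}|lborel. (cmod (line k 1 x))\<^sup>2 ^ (A + k + 1))
     - (LINT x:{0..<1}|lborel. (cmod (line k (-1) x))\<^sup>2 ^ (A + k + 1))
    = 4 * (\<Sum>h\<le>A. \<Sum>i\<le>A. \<Sum>j\<le>A. real (tri (A + k + 1) (i + (k + 2) * (2 * h + 1)) j
        * tri (A + k + 1) i (j + (k + 1) * (2 * h + 1))))"
proof -
  define m where "m = A + k + 1"
  define B where "B = {..m} \<times> {..m} \<times> {..m} \<times> {..m}"
  define C where "C = (\<lambda>(i, j, i', j'). (k + 1) * i + (k + 2) * j = (k + 1) * i' + (k + 2) * j')"
  define P where "P = (\<lambda>(i, j, i', j'). i + j + i' + j' :: nat)"
  define g where "g = (\<lambda>(i, j, i', j'). real (tri m i j * tri m i' j'))"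
  define L where "L \<sigma> = (LINT x:{0..<1}|lborel. (cmod (line k \<sigma> x))\<^sup>2 ^ m)" for \<sigma>
  have finB: "finite B" by (simp add: B_def)
  have L: "L \<sigma> = (\<Sum>q\<in>B. g q * \<sigma> ^ P q * (if C q then 1 else 0))" for \<sigma>
  proof -
    have "complex_of_real (L \<sigma>) = (LINT x:{0..<1}|lborel. complex_of_real ((cmod (line k \<sigma> x))\<^sup>2 ^ m))"
      unfolding L_def by (rule set_integral_complex_of_real[symmetric])
    also have "\<dots> = of_real (\<Sum>q\<in>B. g q * \<sigma> ^ P q * (if C q then 1 else 0))"
      unfolding set_integral_line_power B_def
      by (simp add: sum.cartesian_product g_def P_def C_def case_prod_unfold if_distrib cong: if_cong)
    finally show ?thesis by (simp only: of_real_eq_iff)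
  qed
  define S where "S = {q \<in> B. C q \<and> odd (P q)}"
  define S1 where "S1 = {q \<in> S. fst (snd (snd q)) < fst q}"
  define S2 where "S2 = {q \<in> S. fst q < fst (snd (snd q))}"
  have fin: "finite S" "finite S1" "finite S2" using finB by (auto simp: S_def S1_def S2_def)
  have "L 1 - L (-1) = (\<Sum>q\<in>B. if C q \<and> odd (P q) then 2 * g q else 0)"
    unfolding L sum_subtractf[symmetric] by (intro sum.cong refl) auto
  also have "\<dots> = 2 * sum g S"
    by (simp add: S_def sum.inter_filter[OF finB, symmetric] sum_distrib_left)
  also have "S = S1 \<union> S2"
  proof -
    \<comment> \<open>Equal first indices mean l = 0, and then the total degree is even.\<close>
    have False if "q \<in> S" "fst q = fst (snd (snd q))" for q
    proof -
      obtain i j i' j' where q: "q = (i, j, i', j')" by (metis prod_cases4)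
      with that have "(k + 1) * i + (k + 2) * j = (k + 1) * i + (k + 2) * j'" "i' = i" "odd (i + j + i' + j')"
        by (auto simp: S_def C_def P_def)
      moreover from this(1) have "(k + 2) * j = (k + 2) * j'" by (rule add_left_imp_eq)
      hence "j = j'" by (subst (asm) mult_left_cancel) auto
      ultimately show False by auto
    qed
    thus ?thesis by (force simp: S1_def S2_def)
  qed
  also have "sum g (S1 \<union> S2) = sum g S1 + sum g S2"
    by (rule sum.union_disjoint) (use fin in \<open>auto simp: S1_def S2_def\<close>)
  \<comment> \<open>Exchanging the primed and unprimed indices is complex conjugation and reverses
    the sign of l.\<close>
  also have "sum g S2 = sum g S1"
    by (rule sum.reindex_bij_witness[where i = "\<lambda>(i, j, i', j'). (i', j', i, j)" and j = "\<lambda>(i, j, i', j'). (i', j', i, j)"])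
      (auto simp: S1_def S2_def S_def B_def C_def P_def g_def mult.commute add_ac)
  also have "sum g S1 = (\<Sum>q\<in>{..A} \<times> {..A} \<times> {..A}. case q of (h, i, j) \<Rightarrow>
      real (tri m (i + (k + 2) * (2 * h + 1)) j * tri m i (j + (k + 1) * (2 * h + 1))))"
  proof -
    define T where "T = {(h, i, j). i + (k + 2) * (2 * h + 1) \<le> m \<and> j + (k + 1) * (2 * h + 1) \<le> m \<and> i \<le> m \<and> j \<le> m}"
    define f where "f = (\<lambda>(h, i, j). (i + (k + 2) * (2 * h + 1), j, i, j + (k + 1) * (2 * h + 1)))"
    have inj: "inj_on f T"
      by (auto simp: inj_on_def f_def)
    have img: "f ` T = S1"
    proof (intro equalityI subsetI)
      fix q assume "q \<in> f ` T"
      then obtain h i j where q: "q = f (h, i, j)" and T: "(h, i, j) \<in> T" by (metis imageE prod_cases3)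
      have "(k + 1) * (i + (k + 2) * (2 * h + 1)) + (k + 2) * j = (k + 1) * i + (k + 2) * (j + (k + 1) * (2 * h + 1))"
        by (simp add: algebra_simps)
      moreover have "i + (k + 2) * (2 * h + 1) + j + i + (j + (k + 1) * (2 * h + 1))
          = 2 * (i + j + (k + 1) * (2 * h + 1) + h) + 1"
        by (simp add: algebra_simps)
      hence "odd (i + (k + 2) * (2 * h + 1) + j + i + (j + (k + 1) * (2 * h + 1)))"
        by presburger
      ultimately show "q \<in> S1"
        using T by (simp add: q f_def S1_def S_def C_def P_def B_def T_def)
    next
      fix q assume "q \<in> S1"
      obtain i j i' j' where q: "q = (i, j, i', j')" by (metis prod_cases4)
      have 1: "(k + 1) * i + (k + 2) * j = (k + 1) * i' + (k + 2) * j'" "odd (i + j + i' + j')"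
          "i' < i" "i \<le> m" "j \<le> m" "i' \<le> m" "j' \<le> m"
        using \<open>q \<in> S1\<close> by (auto simp: q S1_def S_def B_def C_def P_def)
      obtain d where d: "i = i' + d" "0 < d" using 1(3) less_imp_add_positive by blast
      have eq: "(k + 1) * d + (k + 2) * j = (k + 2) * j'"
        using 1(1) by (simp add: d algebra_simps)
      hence "(k + 2) * j \<le> (k + 2) * j'" by linarith
      hence "j \<le> j'" by (subst (asm) mult_le_cancel1) auto
      then obtain c where c: "j' = j + c" using le_Suc_ex by blast
      have eq2: "(k + 1) * d = (k + 2) * c" using eq by (simp add: c algebra_simps)
      have "coprime (k + 2) (k + 1)" by (metis coprime_Suc_left_nat Suc_1 add_Suc_right add_Suc_shift One_nat_def)
      moreover have "k + 2 dvd (k + 1) * d" by (simp only: eq2 dvd_triv_left)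
      ultimately have "k + 2 dvd d" using coprime_dvd_mult_right_iff by blast
      then obtain l where l: "d = (k + 2) * l" by (elim dvdE)
      have cl: "c = (k + 1) * l"
      proof -
        have "(k + 2) * c = (k + 2) * ((k + 1) * l)" using eq2 by (simp add: l algebra_simps)
        thus ?thesis by (subst (asm) mult_left_cancel) auto
      qed
      have "i + j + i' + j' = 2 * (i' + j + (k + 1) * l) + l"
        by (simp add: d c l cl algebra_simps)
      hence "odd l" using 1(2) by presburger
      then obtain h where h: "l = 2 * h + 1" by (elim oddE)
      have "q = f (h, i', j)" by (simp only: q f_def d c l cl h) simp
      moreover have "(h, i', j) \<in> T" using 1 by (simp add: T_def d c l cl h)
      ultimately show "q \<in> f ` T" by blast
    qed
    have "finite T" using inj img fin(2) by (metis finite_imageD)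
    have "sum g S1 = sum (g \<circ> f) T"
      unfolding img[symmetric] by (rule sum.reindex[OF inj])
    also have "\<dots> = (\<Sum>q\<in>{..A} \<times> {..A} \<times> {..A}. (g \<circ> f) q)"
    proof (rule sum.mono_neutral_cong)
      fix q assume "q \<in> T - {..A} \<times> {..A} \<times> {..A}"
      moreover obtain h i j where q: "q = (h, i, j)" by (metis prod_cases3)
      ultimately have "A < h \<or> A < i \<or> A < j" and T: "(h, i, j) \<in> T" by auto
      thus "(g \<circ> f) q = 0"
      proof (elim disjE)
        \<comment> \<open>Such a large frequency 2 h + 1 is impossible: it would force (k + 1) (2 A
          + 3) to be at most A + k + 1.\<close>
        assume "A < h"
        have "(k + 1) * (2 * A + 3) \<le> (k + 1) * (2 * h + 1)"
          by (rule mult_le_mono2) (use \<open>A < h\<close> in simp)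
        moreover have "(k + 1) * (2 * h + 1) \<le> m" using T by (simp add: T_def)
        ultimately have "(k + 1) * (2 * A + 3) \<le> m" by linarith
        thus ?thesis by (simp add: m_def algebra_simps)
      next
        assume "A < i"
        thus ?thesis by (simp add: g_def f_def q tri_eq_0 m_def algebra_simps)
      next
        assume "A < j"
        thus ?thesis by (simp add: g_def f_def q tri_eq_0 m_def algebra_simps)
      qed
    next
      fix q assume "q \<in> {..A} \<times> {..A} \<times> {..A} - T"
      moreover obtain h i j where q: "q = (h, i, j)" by (metis prod_cases3)
      ultimately have "m < i + (k + 2) * (2 * h + 1) \<or> m < j + (k + 1) * (2 * h + 1)"
        by (auto simp: T_def m_def not_le)
      thus "(g \<circ> f) q = 0" by (auto simp: g_def f_def q tri_eq_0)
    qed (use \<open>finite T\<close> in auto)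
    finally show ?thesis by (simp add: g_def f_def case_prod_unfold)
  qed
  finally show ?thesis
    by (simp add: L_def m_def sum.cartesian_product case_prod_unfold)
qed

section \<open>The identity for powers\<close>

lemma borel_measurable_fst [measurable]: "fst \<in> borel_measurable borel"
  and borel_measurable_snd [measurable]: "snd \<in> borel_measurable borel"
  by (intro borel_measurable_continuous_onI continuous_intros)+

text \<open>The sum over the odd frequencies l of \<open>cnj z ^ ((k + 2) * l - (k + 1)) * u ^ ((k + 1) * l - (k + 1))\<close>:
  each Fourier mode after taking k + 1 derivatives.\<close>
definition kern :: "nat \<Rightarrow> complex \<Rightarrow> complex \<Rightarrow> complex" where
  "kern k z u = cnj z / (1 - (cnj z ^ (k + 2) * u ^ (k + 1))\<^sup>2)"

definition ww :: "nat \<Rightarrow> complex \<times> complex \<Rightarrow> real" where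
  "ww k p = weight k (fst p) * weight k (snd p)"

lemma ww_nonneg [simp]: "0 \<le> ww k p"
  by (simp add: ww_def)

lemma ww_le_1: "ww k p \<le> 1"
  unfolding ww_def by (intro mult_le_one weight_le_1 weight_nonneg)

lemma ww_outside: "0 < k \<Longrightarrow> \<not> (cmod (fst p) < 1 \<and> cmod (snd p) < 1) \<Longrightarrow> ww k p = 0"
  by (auto simp: ww_def not_less weight_outside)

lemma ww_measurable [measurable]: "ww k \<in> borel_measurable borel"
  unfolding ww_def by measurable

lemma kern_measurable [measurable]:
  "f \<in> borel_measurable M \<Longrightarrow> g \<in> borel_measurable M \<Longrightarrow> (\<lambda>x. kern k (f x) (g x)) \<in> borel_measurable M"
  unfolding kern_def
  by (intro borel_measurable_divide borel_measurable_diff borel_measurable_power borel_measurable_times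
      borel_measurable_const borel_measurable_cnj)

lemma ratio_less_1:
  assumes "cmod z < 1" "cmod u < 1"
  shows "(cmod (cnj z ^ (k + 2) * u ^ (k + 1)))\<^sup>2 \<le> (cmod z)\<^sup>2"
    and "cmod ((cnj z ^ (k + 2) * u ^ (k + 1))\<^sup>2) < 1"
proof -
  have "cmod z ^ (k + 2) * cmod u ^ (k + 1) \<le> cmod z ^ 1 * 1"
    by (intro mult_mono power_decreasing power_le_one) (use assms in auto)
  hence le: "cmod (cnj z ^ (k + 2) * u ^ (k + 1)) \<le> cmod z"
    by (simp only: norm_mult norm_power complex_mod_cnj power_one_right mult_1_right)
  thus "(cmod (cnj z ^ (k + 2) * u ^ (k + 1)))\<^sup>2 \<le> (cmod z)\<^sup>2"
    by (intro power_mono norm_ge_zero)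
  also have "\<dots> < 1" using assms by (simp add: abs_square_less_1)
  finally show "cmod ((cnj z ^ (k + 2) * u ^ (k + 1))\<^sup>2) < 1"
    by (simp only: norm_power)
qed

text \<open>Because |q| is at most |z|, a single factor 1 - |z|^2 of the weight cancels the worst
  growth of 1 / (1 - |q|^2) at the boundary of the bidisc. This is the majorant for all later
  interchanges of limits, and it is where k > 0 enters.\<close>

lemma weight_geometric_bound:
  assumes k: "0 < k" and z: "cmod z < 1" and u: "cmod u < 1"
  shows "ww k (z, u) * (1 / (1 - (cmod (cnj z ^ (k + 2) * u ^ (k + 1)))\<^sup>2)) \<le> 1"
proof -
  define Q where "Q = (cmod (cnj z ^ (k + 2) * u ^ (k + 1)))\<^sup>2"
  have Q: "Q \<le> (cmod z)\<^sup>2" "0 \<le> Q" and z1: "(cmod z)\<^sup>2 < 1"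
    using ratio_less_1(1)[OF z u] z by (simp_all add: Q_def abs_square_less_1)
  have "weight k z \<le> (1 - (cmod z)\<^sup>2) ^ 1"
    unfolding weight_inside[OF z] by (rule power_decreasing) (use k z1 in auto)
  hence "weight k z \<le> 1 - Q" "0 \<le> 1 - Q" using Q z1 by simp_all
  hence "weight k z * weight k u \<le> (1 - Q) * 1"
    by (intro mult_mono weight_le_1) auto
  moreover have "0 < 1 - Q" using Q z1 by linarith
  ultimately show ?thesis unfolding Q_def[symmetric] ww_def by (simp add: pos_divide_le_eq)
qed

lemma ww_kern_bound:
  assumes "0 < k"
  shows "ww k p * cmod (kern k (fst p) (snd p)) \<le> indicator (ball 0 1 \<times> ball 0 1) p"
proof (cases "cmod (fst p) < 1 \<and> cmod (snd p) < 1")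
  case True
  define z u where "z = fst p" and "u = snd p"
  have z: "cmod z < 1" and u: "cmod u < 1" using True by (auto simp: z_def u_def)
  define q where "q = cnj z ^ (k + 2) * u ^ (k + 1)"
  have q: "cmod (q\<^sup>2) < 1" unfolding q_def by (rule ratio_less_1(2)[OF z u])
  have "1 - (cmod q)\<^sup>2 \<le> cmod (1 - q\<^sup>2)"
    using norm_triangle_ineq2[of 1 "q\<^sup>2"] by (simp add: norm_power)
  moreover have "0 < 1 - (cmod q)\<^sup>2" using q by (simp add: norm_power)
  ultimately have "cmod (kern k z u) \<le> 1 / (1 - (cmod q)\<^sup>2)"
    unfolding kern_def norm_divide q_def[symmetric]
    by (intro frac_le) (use z in auto)
  hence "ww k p * cmod (kern k z u) \<le> ww k p * (1 / (1 - (cmod q)\<^sup>2))"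
    by (intro mult_left_mono) auto
  also have "\<dots> \<le> 1"
    using weight_geometric_bound[OF assms z u] by (simp add: q_def z_def u_def)
  finally show ?thesis using True by (simp add: z_def u_def indicator_def mem_Times_iff)
next
  case False
  thus ?thesis using ww_outside[OF assms False] by simp
qed

lemma integrable_bidisc: "integrable lborel (indicator (ball 0 1 \<times> ball 0 1) :: complex \<times> complex \<Rightarrow> real)"
proof -
  have "integrable lborel (\<lambda>p. indicator (ball 0 1) (fst p) * indicator (ball 0 1) (snd p) :: real)"
    by (intro lborel_integrable_mult_pair integrable_real_indicator)
      (use emeasure_lborel_ball_finite in auto)
  also have "(\<lambda>p. indicator (ball 0 1) (fst p) * indicator (ball 0 1) (snd p) :: real)
      = indicator (ball (0::complex) 1 \<times> ball (0::complex) 1)"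
    by (auto simp: fun_eq_iff indicator_def)
  finally show ?thesis .
qed

lemma bidisc_sum_le_3: "p \<in> ball 0 1 \<times> ball 0 1 \<Longrightarrow> cmod (1 + fst p + snd p) \<le> 3"
  using norm_triangle_ineq[of "1 + fst p" "snd p"] norm_triangle_ineq[of 1 "fst p"] by auto

text \<open>Expanding \<open>kern\<close> as a geometric series gives trinomial moments with r = 2 h
  (k + 2) + 1 and s = 2 h (k + 1), which match the resonances l = 2 h + 1 on the circle one by
  one.\<close>

lemma integral_ww_kern_power:
  assumes k: "0 < k"
  shows "(LINT p|lborel. ww k p * (cmod (1 + fst p + snd p))\<^sup>2 ^ A * Re (kern k (fst p) (snd p)))
    = pi\<^sup>2 / 4 * Beta (real A + 1) (real k + 1) ^ 2 *
      ((LINT x:{0..<1}|lborel. (cmod (line k 1 x))\<^sup>2 ^ (A + k + 1))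
        - (LINT x:{0..<1}|lborel. (cmod (line k (-1) x))\<^sup>2 ^ (A + k + 1)))"
proof -
  define c where "c h = (\<Sum>i\<le>A. \<Sum>j\<le>A. real (tri (A + k + 1) (i + (k + 2) * (2 * h + 1)) j
        * tri (A + k + 1) i (j + (k + 1) * (2 * h + 1))))" for h
  define b where "b = pi\<^sup>2 * Beta (real A + 1) (real k + 1) ^ 2"
  define g where "g p = complex_of_real (ww k p * (cmod (1 + fst p + snd p))\<^sup>2 ^ A)" for p
  define q where "q p = cnj (fst p) ^ (k + 2) * snd p ^ (k + 1)" for p :: "complex \<times> complex"
  define s where "s H p = g p * (cnj (fst p) * (\<Sum>h<H. ((q p)\<^sup>2) ^ h))" for H p
  have [measurable]: "g \<in> borel_measurable borel" unfolding g_def by measurable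
  have [measurable]: "q \<in> borel_measurable borel"
    unfolding q_def by (intro borel_measurable_continuous_onI continuous_intros)
  have F: "g p * (cnj (fst p) * ((q p)\<^sup>2) ^ h) = (weight k (fst p) * weight k (snd p)) *\<^sub>R
       ((1 + fst p + snd p) ^ A * cnj (1 + fst p + snd p) ^ A *
         (cnj (fst p) ^ (2 * h * (k + 2) + 1) * snd p ^ (2 * h * (k + 1))))" for h p
  proof -
    have "complex_of_real ((cmod (1 + fst p + snd p))\<^sup>2 ^ A) = (1 + fst p + snd p) ^ A * cnj (1 + fst p + snd p) ^ A"
      by (simp only: of_real_power[of "(cmod (1 + fst p + snd p))\<^sup>2" A] complex_norm_square power_mult_distrib)
    moreover have "((q p)\<^sup>2) ^ h = cnj (fst p) ^ (2 * h * (k + 2)) * snd p ^ (2 * h * (k + 1))"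
      unfolding q_def power_mult_distrib power_mult[symmetric]
      by (simp only: mult_ac)
    ultimately show ?thesis
      by (simp only: g_def ww_def scaleR_conv_of_real of_real_mult power_add power_one_right mult_ac)
  qed
  have gb: "cmod (g p) * (1 / (1 - (cmod (q p))\<^sup>2)) \<le> 9 ^ A" if p: "p \<in> ball 0 1 \<times> ball 0 1" for p
  proof -
    have q1: "(cmod (q p))\<^sup>2 < 1"
      using ratio_less_1(2)[of "fst p" "snd p" k] p by (auto simp: q_def norm_power)
    have "cmod (1 + fst p + snd p) ^ 2 \<le> 3 ^ 2"
      by (intro power_mono bidisc_sum_le_3 p) auto
    hence "(cmod (1 + fst p + snd p))\<^sup>2 ^ A \<le> 9 ^ A" by (intro power_mono) auto
    moreover have "ww k p * (1 / (1 - (cmod (q p))\<^sup>2)) \<le> 1"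
      using weight_geometric_bound[OF k, of "fst p" "snd p"] p by (auto simp: q_def)
    ultimately have "(cmod (1 + fst p + snd p))\<^sup>2 ^ A * (ww k p * (1 / (1 - (cmod (q p))\<^sup>2))) \<le> 9 ^ A * 1"
      using q1 by (intro mult_mono) auto
    moreover have "cmod (g p) = ww k p * (cmod (1 + fst p + snd p))\<^sup>2 ^ A"
      unfolding g_def norm_of_real by (intro abs_of_nonneg mult_nonneg_nonneg) auto
    ultimately show ?thesis by (simp only: mult_ac mult_1_right)
  qed
  have bound: "norm (s H p) \<le> 9 ^ A * indicator (ball 0 1 \<times> ball 0 1) p" for H p
  proof (cases "p \<in> ball 0 1 \<times> ball 0 1")
    case True
    have q1: "(cmod (q p))\<^sup>2 < 1"
      using ratio_less_1(2)[of "fst p" "snd p" k] True by (auto simp: q_def norm_power)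
    have "norm (\<Sum>h<H. ((q p)\<^sup>2) ^ h) \<le> (\<Sum>h<H. ((cmod (q p))\<^sup>2) ^ h)"
      by (rule sum_norm_le) (simp add: norm_power)
    also have "\<dots> \<le> (\<Sum>h. ((cmod (q p))\<^sup>2) ^ h)"
      by (rule sum_le_suminf) (use q1 in \<open>auto intro!: summable_geometric\<close>)
    also have "\<dots> = 1 / (1 - (cmod (q p))\<^sup>2)"
      by (rule suminf_geometric) (use q1 in auto)
    finally have "norm (cnj (fst p) * (\<Sum>h<H. ((q p)\<^sup>2) ^ h)) \<le> 1 * (1 / (1 - (cmod (q p))\<^sup>2))"
      unfolding norm_mult by (intro mult_mono) (use True in auto)
    hence "norm (s H p) \<le> cmod (g p) * (1 / (1 - (cmod (q p))\<^sup>2))"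
      unfolding s_def norm_mult[of "g p"] by (intro mult_left_mono) auto
    also have "\<dots> \<le> 9 ^ A" by (rule gb[OF True])
    finally show ?thesis using True by simp
  next
    case False
    hence "ww k p = 0" by (intro ww_outside k) (auto simp: mem_Times_iff)
    thus ?thesis by (simp add: s_def g_def)
  qed
  have lim: "(\<lambda>H. s H p) \<longlonglongrightarrow> g p * kern k (fst p) (snd p)" for p
  proof (cases "p \<in> ball 0 1 \<times> ball 0 1")
    case True
    have q1: "cmod ((q p)\<^sup>2) < 1"
      using ratio_less_1(2)[of "fst p" "snd p" k] True by (auto simp: q_def)
    have "(\<lambda>h. ((q p)\<^sup>2) ^ h) sums (1 / (1 - (q p)\<^sup>2))"
      by (rule geometric_sums[OF q1])
    hence "(\<lambda>H. s H p) \<longlonglongrightarrow> g p * (cnj (fst p) * (1 / (1 - (q p)\<^sup>2)))"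
      unfolding s_def sums_def by (intro tendsto_mult tendsto_const)
    thus ?thesis by (simp add: kern_def q_def)
  next
    case False
    hence "ww k p = 0" by (intro ww_outside k) (auto simp: mem_Times_iff)
    thus ?thesis by (simp add: s_def g_def)
  qed
  have int_bound: "integrable lborel (\<lambda>p::complex \<times> complex. 9 ^ A * indicator (ball 0 1 \<times> ball 0 1) p :: real)"
    by (intro integrable_mult_right integrable_bidisc)
  have dc: "integrable lborel (\<lambda>p. g p * kern k (fst p) (snd p))"
     "(\<lambda>H. LINT p|lborel. s H p) \<longlonglongrightarrow> (LINT p|lborel. g p * kern k (fst p) (snd p))"
  proof -
    have m: "(\<lambda>p. g p * kern k (fst p) (snd p)) \<in> borel_measurable lborel" "s H \<in> borel_measurable lborel" for H
      unfolding s_def by measurable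
    show "integrable lborel (\<lambda>p. g p * kern k (fst p) (snd p))"
      by (rule integrable_dominated_convergence[where s = s, OF m int_bound AE_I2[OF lim] AE_I2[OF bound]])
    show "(\<lambda>H. LINT p|lborel. s H p) \<longlonglongrightarrow> (LINT p|lborel. g p * kern k (fst p) (snd p))"
      by (rule integral_dominated_convergence[where s = s, OF m int_bound AE_I2[OF lim] AE_I2[OF bound]])
  qed
  have I: "(LINT p|lborel. g p * (cnj (fst p) * ((q p)\<^sup>2) ^ h)) = of_real (b * c h)" for h
  proof -
    \<comment> \<open>The shift by k + 1 from the Beta moments completes the exponents of
      \<open>kern\<close> to the full resonance steps (k + 2) l and (k + 1) l.\<close>
    have eq: "i + (2 * h * (k + 2) + 1) + k + 1 = i + (k + 2) * (2 * h + 1)"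
      "j + 2 * h * (k + 1) + k + 1 = j + (k + 1) * (2 * h + 1)" for i j
      by (simp_all add: algebra_simps)
    show ?thesis
      unfolding F integral_weight_trinomial[OF k] b_def c_def eq by (rule refl)
  qed
  have intF: "integrable lborel (\<lambda>p. g p * (cnj (fst p) * ((q p)\<^sup>2) ^ h))" for h
  proof -
    have "s (Suc h) p - s h p = g p * (cnj (fst p) * ((q p)\<^sup>2) ^ h)" for p
      by (simp add: s_def algebra_simps)
    moreover have "integrable lborel (s H)" for H
    proof (rule Bochner_Integration.integrable_bound[OF int_bound])
      show "s H \<in> borel_measurable lborel" unfolding s_def by measurable
      show "AE p in lborel. norm (s H p) \<le> norm (9 ^ A * indicator (ball 0 1 \<times> ball 0 1) p :: real)"
        unfolding real_norm_def by (intro AE_I2 order_trans[OF bound abs_ge_self])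
    qed
    ultimately show ?thesis using Bochner_Integration.integrable_diff[of lborel "s (Suc h)" "s h"] by simp
  qed
  have S: "(LINT p|lborel. s H p) = of_real (b * (\<Sum>h<H. c h))" for H
    unfolding s_def sum_distrib_left by (simp add: intF I)
  \<comment> \<open>Modes beyond the degree vanish, so the limit of the partial sums is already
    reached at a finite stage.\<close>
  have c0: "c h = 0" if "A < h" for h
  proof -
    have "A + k + 1 < i + (k + 2) * (2 * h + 1) + j" for i j
    proof -
      have "(k + 2) * (2 * h + 1) = 2 * h * k + 4 * h + k + 2" by (simp add: algebra_simps)
      with that show ?thesis by linarith
    qed
    thus ?thesis by (simp add: c_def tri_eq_0)
  qed
  have "eventually (\<lambda>H. (LINT p|lborel. s H p) = of_real (b * (\<Sum>h\<le>A. c h))) sequentially"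
    using eventually_gt_at_top[of A]
  proof eventually_elim
    case (elim H)
    have "(\<Sum>h<H. c h) = (\<Sum>h\<le>A. c h)"
      by (rule sum.mono_neutral_right) (use elim c0 in auto)
    thus ?case by (simp add: S)
  qed
  hence "(\<lambda>H. LINT p|lborel. s H p) \<longlonglongrightarrow> of_real (b * (\<Sum>h\<le>A. c h))"
    by (rule tendsto_eventually)
  hence "(LINT p|lborel. g p * kern k (fst p) (snd p)) = of_real (b * (\<Sum>h\<le>A. c h))"
    using dc(2) LIMSEQ_unique by blast
  hence "Re (LINT p|lborel. g p * kern k (fst p) (snd p)) = b * (\<Sum>h\<le>A. c h)"
    by simp
  also have "Re (LINT p|lborel. g p * kern k (fst p) (snd p))
      = (LINT p|lborel. Re (g p * kern k (fst p) (snd p)))"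
    by (rule integral_Re[OF dc(1), symmetric])
  finally have "(LINT p|lborel. Re (g p * kern k (fst p) (snd p))) = b * (\<Sum>h\<le>A. c h)" .
  thus ?thesis
    unfolding set_integral_line_power_diff c_def[symmetric] b_def
    by (simp add: g_def)
qed

section \<open>Passing to real exponents\<close>

text \<open>At the singularity \<open>w = 0\<close> the value is the junk value \<open>0 powr - \<gamma> = 0\<close>; it only occurs on null sets.\<close>
definition kap :: "real \<Rightarrow> complex \<Rightarrow> real" where
  "kap \<gamma> w = (cmod w)\<^sup>2 powr (- \<gamma>)"

lemma kap_measurable [measurable]: "kap \<gamma> \<in> borel_measurable borel"
  unfolding kap_def by measurable

lemma kap_nonneg [simp]: "0 \<le> kap \<gamma> w"
  by (simp add: kap_def)

text \<open>In the squared radius the singularity is a^(-\<gamma>), integrable at 0 because \<gamma>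
  < 1. Radius 3 contains every value of 1 + z + u on the open bidisc.\<close>

lemma nn_integral_kap_ball:
  assumes "\<gamma> < 1"
  shows "(\<integral>\<^sup>+w. indicator (ball 0 3) w * ennreal (kap \<gamma> w) \<partial>lborel) < \<infinity>"
proof -
  define f where "f a = ennreal (indicator {0..9} a * a powr (- \<gamma>))" for a :: real
  have [measurable]: "f \<in> borel_measurable borel" unfolding f_def by measurable
  have "((\<lambda>x. x powr (- \<gamma>)) has_integral (9 powr (- \<gamma> + 1) / (- \<gamma> + 1))) {0..9::real}"
    by (rule has_integral_powr_from_0) (use assms in auto)
  from nn_integral_has_integral_lebesgue[OF _ this]
  have f: "(\<integral>\<^sup>+a. f a \<partial>lborel) = ennreal (9 powr (- \<gamma> + 1) / (- \<gamma> + 1))"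
    by (simp add: f_def)
  have "(\<integral>\<^sup>+w. indicator (ball 0 3) w * ennreal (kap \<gamma> w) \<partial>lborel) \<le> (\<integral>\<^sup>+w. f ((cmod w)\<^sup>2) \<partial>lborel)"
  proof (rule nn_integral_mono)
    fix w
    have "(cmod w)\<^sup>2 \<le> 3 ^ 2" if "cmod w < 3" using that by (intro power_mono) auto
    thus "indicator (ball 0 3) w * ennreal (kap \<gamma> w) \<le> f ((cmod w)\<^sup>2)"
      by (auto simp: f_def kap_def indicator_def)
  qed
  also have "\<dots> = ennreal pi * (\<integral>\<^sup>+a. f a * indicator {0<..} a \<partial>lborel)"
    by (rule nn_integral_radial) simp
  also have "\<dots> \<le> ennreal pi * (\<integral>\<^sup>+a. f a \<partial>lborel)"
    by (intro mult_left_mono nn_integral_mono) (auto simp: indicator_def)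
  also have "\<dots> < \<infinity>" by (simp add: f ennreal_mult_less_top)
  finally show ?thesis .
qed

text \<open>For fixed z a translation in u moves the singularity to the origin. The bound is uniform
  over unimodular d, as the average over rotations will require.\<close>

lemma nn_integral_kap_bidisc:
  assumes "cmod d = 1"
  shows "(\<integral>\<^sup>+p. indicator (ball 0 1 \<times> ball 0 1) p * ennreal (kap \<gamma> (d + (fst p + snd p))) \<partial>lborel)
    \<le> ennreal pi * (\<integral>\<^sup>+w. indicator (ball 0 3) w * ennreal (kap \<gamma> w) \<partial>lborel)"
proof -
  define g where "g w = indicator (ball (0::complex) 3) w * ennreal (kap \<gamma> w)" for w
  have [measurable]: "ball (0::complex) r \<in> sets borel" for r by simp
  have [measurable]: "g \<in> borel_measurable borel" unfolding g_def by measurable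
  have "(\<integral>\<^sup>+p. indicator (ball 0 1 \<times> ball 0 1) p * ennreal (kap \<gamma> (d + (fst p + snd p))) \<partial>lborel)
      \<le> (\<integral>\<^sup>+p. indicator (ball 0 1) (fst p) * g (d + (fst p + snd p)) \<partial>lborel)"
  proof (rule nn_integral_mono)
    fix p :: "complex \<times> complex"
    have "cmod (d + (fst p + snd p)) < 3" if "cmod (fst p) < 1" "cmod (snd p) < 1"
      using norm_triangle_ineq[of d "fst p + snd p"] norm_triangle_ineq[of "fst p" "snd p"] that assms
      by linarith
    thus "indicator (ball 0 1 \<times> ball 0 1) p * ennreal (kap \<gamma> (d + (fst p + snd p)))
        \<le> indicator (ball 0 1) (fst p) * g (d + (fst p + snd p))"
      by (auto simp: g_def indicator_def mem_Times_iff)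
  qed
  also have "\<dots> = (\<integral>\<^sup>+z. (\<integral>\<^sup>+u. indicator (ball 0 1) z * g (d + (z + u)) \<partial>lborel) \<partial>lborel)"
    unfolding lborel_prod[symmetric]
    by (subst lborel.nn_integral_fst[symmetric]) auto
  also have "\<dots> = (\<integral>\<^sup>+z. indicator (ball (0::complex) 1) z * (\<integral>\<^sup>+w. g w \<partial>lborel) \<partial>lborel)"
  proof (rule nn_integral_cong)
    fix z
    have "(\<integral>\<^sup>+u. g (d + (z + u)) \<partial>lborel) = (\<integral>\<^sup>+w. g w \<partial>distr lborel borel ((+) (d + z)))"
      by (subst nn_integral_distr) (auto simp: add.assoc)
    thus "(\<integral>\<^sup>+u. indicator (ball 0 1) z * g (d + (z + u)) \<partial>lborel)
        = indicator (ball 0 1) z * (\<integral>\<^sup>+w. g w \<partial>lborel)"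
      by (simp add: nn_integral_cmult lborel_distr_plus)
  qed
  also have "\<dots> = emeasure lborel (ball (0::complex) 1) * (\<integral>\<^sup>+w. g w \<partial>lborel)"
    by (simp add: nn_integral_multc)
  also have "emeasure lborel (ball (0::complex) 1) = ennreal pi"
    by (subst emeasure_ball) (auto simp: unit_ball_vol_2)
  finally show ?thesis by (simp add: g_def)
qed

lemma bidisc_measurable [measurable]: "ball a r \<times> ball b s \<in> sets (borel :: (complex \<times> complex) measure)"
  by (intro borel_open open_Times) auto

lemma integrable_kap_bidisc:
  assumes "\<gamma> < 1" "cmod d = 1"
  shows "integrable lborel (\<lambda>p. indicator (ball 0 1 \<times> ball 0 1) p * kap \<gamma> (d + (fst p + snd p)))"
proof (rule integrableI_nonneg)
  have "(\<integral>\<^sup>+p. ennreal (indicator (ball 0 1 \<times> ball 0 1) p * kap \<gamma> (d + (fst p + snd p))) \<partial>lborel)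
      = (\<integral>\<^sup>+p. indicator (ball 0 1 \<times> ball 0 1) p * ennreal (kap \<gamma> (d + (fst p + snd p))) \<partial>lborel)"
    by (intro nn_integral_cong) (simp add: indicator_def)
  also have "\<dots> < \<infinity>"
    using nn_integral_kap_ball[OF assms(1)]
    by (intro le_less_trans[OF nn_integral_kap_bidisc[OF assms(2)]]) (simp add: ennreal_mult_less_top)
  finally show "(\<integral>\<^sup>+p. ennreal (indicator (ball 0 1 \<times> ball 0 1) p * kap \<gamma> (d + (fst p + snd p))) \<partial>lborel) < \<infinity>" .
qed auto

text \<open>The density of the Beta integral. Leaving out u = 0 keeps \<open>u powr r\<close> and
  \<open>u ^ A\<close> in agreement, since \<open>0 powr 0\<close> is 0 while \<open>0 ^ 0\<close>
  is 1.\<close>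

definition bwt :: "nat \<Rightarrow> real \<Rightarrow> real" where
  "bwt k u = indicator {0<..1} u * (1 - u) ^ k"

lemma bwt_measurable [measurable]: "bwt k \<in> borel_measurable borel"
  unfolding bwt_def by measurable

lemma bwt_nonneg [simp]: "0 \<le> bwt k u"
  by (auto simp: bwt_def indicator_def)

lemma has_bochner_integral_bwt:
  assumes "-1 < r" "0 < k"
  shows "has_bochner_integral lborel (\<lambda>u. bwt k u * u powr r) (Beta (r + 1) (real k + 1))"
proof (rule has_bochner_integral_nn_integral)
  have eq: "bwt k u * u powr r = indicator {0..1} u * (u powr r * (1 - u) powr real k)" for u
  proof -
    consider "u \<le> 0" | "0 < u" "u < 1" | "1 \<le> u" by linarith
    thus ?thesis using assms(2) by cases (auto simp: bwt_def powr_realpow split: split_indicator)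
  qed
  show "(\<integral>\<^sup>+u. ennreal (bwt k u * u powr r) \<partial>lborel) = ennreal (Beta (r + 1) (real k + 1))"
    unfolding eq by (rule nn_integral_Beta_powr[OF assms(1)])
  show "0 \<le> Beta (r + 1) (real k + 1)"
    using assms by (simp add: Beta_def Gamma_real_nonneg)
qed auto

text \<open>Inverts the differential operator \<open>d^(k+1) y^(k+1) d^(k+1)\<close> in y, up to a constant factor.\<close>
definition Rop :: "nat \<Rightarrow> real poly \<Rightarrow> real \<Rightarrow> real" where
  "Rop k P y = y ^ (k + 1) * (LINT q|lborel. bwt k (fst q) * bwt k (snd q) * poly P (fst q * snd q * y))"

lemma Rop_eq:
  assumes k: "0 < k"
  shows "Rop k P y = (\<Sum>A\<le>degree P. coeff P A * Beta (real A + 1) (real k + 1) ^ 2 * y ^ (A + k + 1))"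
proof -
  have m: "has_bochner_integral lborel (\<lambda>u. bwt k u * u ^ A) (Beta (real A + 1) (real k + 1))" for A
  proof -
    have "(\<lambda>u. bwt k u * u ^ A) = (\<lambda>u. bwt k u * u powr real A)"
      by (auto simp: fun_eq_iff bwt_def powr_realpow indicator_def)
    thus ?thesis using has_bochner_integral_bwt[of "real A" k] k by (simp only:)
  qed
  have int: "integrable lborel (\<lambda>q. (bwt k (fst q) * fst q ^ A) * (bwt k (snd q) * snd q ^ A))" for A
    using m by (intro lborel_integrable_mult_pair) (auto simp: has_bochner_integral_iff)
  have val: "(LINT q|lborel. (bwt k (fst q) * fst q ^ A) * (bwt k (snd q) * snd q ^ A))
      = Beta (real A + 1) (real k + 1) ^ 2" for A
    using m by (subst lborel_integral_mult_pair) (auto simp: has_bochner_integral_iff power2_eq_square)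
  have "bwt k (fst q) * bwt k (snd q) * poly P (fst q * snd q * y)
      = (\<Sum>A\<le>degree P. (coeff P A * y ^ A) * ((bwt k (fst q) * fst q ^ A) * (bwt k (snd q) * snd q ^ A)))" for q
    by (simp add: poly_altdef sum_distrib_left power_mult_distrib mult_ac)
  hence "(LINT q|lborel. bwt k (fst q) * bwt k (snd q) * poly P (fst q * snd q * y))
      = (\<Sum>A\<le>degree P. (coeff P A * y ^ A) * Beta (real A + 1) (real k + 1) ^ 2)"
    using int val by simp
  thus ?thesis
    unfolding Rop_def by (simp add: sum_distrib_left power_add mult_ac)
qed

lemma cmod_line_le_3: "\<bar>\<sigma>\<bar> = 1 \<Longrightarrow> cmod (line k \<sigma> x) \<le> 3"
  unfolding line_def
  by (rule order_trans[OF norm_triangle_ineq], rule order_trans[OF add_right_mono[OF norm_triangle_ineq]])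
    (simp add: norm_mult)

text \<open>Linearity: \<open>Rop\<close> sends y^A to the Beta factor times y^(A + k + 1), which is
  exactly how the monomial case relates the two sides.\<close>

lemma integral_ww_kern_poly:
  assumes k: "0 < k"
  shows "(LINT p|lborel. ww k p * poly P ((cmod (1 + fst p + snd p))\<^sup>2) * Re (kern k (fst p) (snd p)))
    = pi\<^sup>2 / 4 * ((LINT x:{0..<1}|lborel. Rop k P ((cmod (line k 1 x))\<^sup>2))
        - (LINT x:{0..<1}|lborel. Rop k P ((cmod (line k (-1) x))\<^sup>2)))"
proof -
  define L where "L \<sigma> A = (LINT x:{0..<1}|lborel. (cmod (line k \<sigma> x))\<^sup>2 ^ A)" for \<sigma> A
  define B where "B A = Beta (real A + 1) (real k + 1) ^ 2" for A
  have intK: "integrable lborel (\<lambda>p. ww k p * (cmod (1 + fst p + snd p))\<^sup>2 ^ A * Re (kern k (fst p) (snd p)))" for A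
  proof (rule Bochner_Integration.integrable_bound)
    show "integrable lborel (\<lambda>p::complex \<times> complex. 9 ^ A * indicator (ball 0 1 \<times> ball 0 1) p :: real)"
      by (intro integrable_mult_right integrable_bidisc)
    show "AE p in lborel. norm (ww k p * (cmod (1 + fst p + snd p))\<^sup>2 ^ A * Re (kern k (fst p) (snd p)))
        \<le> norm (9 ^ A * indicator (ball 0 1 \<times> ball 0 1) p :: real)"
    proof (rule AE_I2)
      fix p :: "complex \<times> complex"
      show "norm (ww k p * (cmod (1 + fst p + snd p))\<^sup>2 ^ A * Re (kern k (fst p) (snd p)))
        \<le> norm (9 ^ A * indicator (ball 0 1 \<times> ball 0 1) p :: real)"
      proof (cases "p \<in> ball 0 1 \<times> ball 0 1")
        case True
        have "(cmod (1 + fst p + snd p))\<^sup>2 \<le> 3 ^ 2"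
          by (intro power_mono bidisc_sum_le_3 True) auto
        hence "(cmod (1 + fst p + snd p))\<^sup>2 ^ A \<le> 9 ^ A" by (intro power_mono) auto
        moreover have "ww k p * \<bar>Re (kern k (fst p) (snd p))\<bar> \<le> 1"
          using ww_kern_bound[OF k, of p] True
          by (intro order_trans[OF mult_left_mono[OF abs_Re_le_cmod]]) auto
        ultimately have "(cmod (1 + fst p + snd p))\<^sup>2 ^ A * (ww k p * \<bar>Re (kern k (fst p) (snd p))\<bar>) \<le> 9 ^ A * 1"
          by (intro mult_mono) auto
        thus ?thesis using True by (simp add: abs_mult mult_ac)
      next
        case False
        hence "ww k p = 0" by (intro ww_outside k) (auto simp: mem_Times_iff)
        thus ?thesis by simp
      qed
    qed
  qed measurable
  have intL: "set_integrable lborel {0..<1} (\<lambda>x. (cmod (line k \<sigma> x))\<^sup>2 ^ A)" for \<sigma> A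
    by (intro set_integrable_Ico_continuous continuous_intros)
  have R: "(LINT x:{0..<1}|lborel. Rop k P ((cmod (line k \<sigma> x))\<^sup>2))
      = (\<Sum>A\<le>degree P. coeff P A * B A * L \<sigma> (A + k + 1))" for \<sigma>
  proof -
    have "integrable lborel (\<lambda>x. coeff P A * B A * (indicator {0..<1} x *\<^sub>R (cmod (line k \<sigma> x))\<^sup>2 ^ (A + k + 1)))" for A
      using intL[of \<sigma> "A + k + 1"] unfolding set_integrable_def by (intro integrable_mult_right)
    moreover have "indicator {0..<1} x *\<^sub>R (\<Sum>A\<le>degree P. coeff P A * B A * (cmod (line k \<sigma> x))\<^sup>2 ^ (A + k + 1))
        = (\<Sum>A\<le>degree P. coeff P A * B A * (indicator {0..<1} x *\<^sub>R (cmod (line k \<sigma> x))\<^sup>2 ^ (A + k + 1)))" for x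
      by (cases "x \<in> {0..<1}") simp_all
    ultimately show ?thesis
      unfolding Rop_eq[OF k] L_def B_def[symmetric] set_lebesgue_integral_def
      by (simp only: Bochner_Integration.integral_sum integral_mult_right_zero)
  qed
  have "ww k p * poly P ((cmod (1 + fst p + snd p))\<^sup>2) * Re (kern k (fst p) (snd p))
      = (\<Sum>A\<le>degree P. coeff P A * (ww k p * (cmod (1 + fst p + snd p))\<^sup>2 ^ A * Re (kern k (fst p) (snd p))))" for p
    by (simp add: poly_altdef sum_distrib_left sum_distrib_right mult_ac)
  hence "(LINT p|lborel. ww k p * poly P ((cmod (1 + fst p + snd p))\<^sup>2) * Re (kern k (fst p) (snd p)))
      = (\<Sum>A\<le>degree P. coeff P A * (LINT p|lborel. ww k p * (cmod (1 + fst p + snd p))\<^sup>2 ^ A * Re (kern k (fst p) (snd p))))"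
    using intK by simp
  also have "\<dots> = (\<Sum>A\<le>degree P. pi\<^sup>2 / 4 * (coeff P A * B A * L 1 (A + k + 1) - coeff P A * B A * L (-1) (A + k + 1)))"
    unfolding integral_ww_kern_power[OF k] B_def[symmetric] L_def[symmetric]
    by (intro sum.cong refl) (simp add: algebra_simps)
  finally show ?thesis
    unfolding R by (simp add: sum_distrib_left sum_subtractf right_diff_distrib)
qed

section \<open>Approximation of negative powers from below by polynomials\<close>

text \<open>Polynomials increasing to \<open>y powr - \<gamma>\<close> on the range of the squared modulus, from the binomial series at 9.\<close>
definition bin_poly :: "real \<Rightarrow> nat \<Rightarrow> real poly" where
  "bin_poly \<gamma> J = smult (9 powr (- \<gamma>)) (\<Sum>i<J. smult \<bar>- \<gamma> gchoose i\<bar> ([:1, - 1 / 9:] ^ i))"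

text \<open>The alternating signs cancel against those of the powers of y / 9 - 1, so the binomial
  series at 9 has nonnegative terms. Its partial sums are then bounded by the limit, which serves as
  majorant.\<close>

lemma abs_gbinomial_minus:
  fixes \<gamma> :: real
  assumes "0 < \<gamma>"
  shows "(- \<gamma> gchoose i) = (-1) ^ i * \<bar>- \<gamma> gchoose i\<bar>"
proof -
  have "(- \<gamma> gchoose i) = (-1) ^ i * (\<gamma> + real i - 1 gchoose i)"
    using gbinomial_minus[of \<gamma> i] by simp
  moreover have "0 \<le> (\<gamma> + real i - 1 gchoose i)"
    unfolding gbinomial_pochhammer' using assms by (simp add: pochhammer_nonneg)
  ultimately show ?thesis by (simp add: abs_mult)
qed

lemma poly_bin_poly: "poly (bin_poly \<gamma> J) y = 9 powr (- \<gamma>) * (\<Sum>i<J. \<bar>- \<gamma> gchoose i\<bar> * (1 - y / 9) ^ i)"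
  by (simp add: bin_poly_def poly_sum poly_power)

lemma bin_poly_nonneg: "y \<le> 9 \<Longrightarrow> 0 \<le> poly (bin_poly \<gamma> J) y"
  unfolding poly_bin_poly by (intro mult_nonneg_nonneg sum_nonneg zero_le_power) auto

lemma bin_poly_sums:
  fixes y :: real
  assumes \<gamma>: "0 < \<gamma>" and y: "0 < y" "y \<le> 9"
  shows "(\<lambda>i. \<bar>- \<gamma> gchoose i\<bar> * (1 - y / 9) ^ i) sums ((y / 9) powr (- \<gamma>))"
proof -
  have "(\<lambda>i. (- \<gamma> gchoose i) * (y / 9 - 1) ^ i) sums ((1 + (y / 9 - 1)) powr (- \<gamma>))"
    by (rule gen_binomial_real) (use y in auto)
  moreover have "(- \<gamma> gchoose i) * (y / 9 - 1) ^ i = \<bar>- \<gamma> gchoose i\<bar> * (1 - y / 9) ^ i" for i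
  proof -
    have "(y / 9 - 1) ^ i = (-1) ^ i * (1 - y / 9) ^ i"
      by (simp add: power_mult_distrib[symmetric])
    thus ?thesis by (subst abs_gbinomial_minus[OF \<gamma>]) (simp add: power_mult_distrib[symmetric])
  qed
  ultimately show ?thesis by simp
qed

lemma powr_rescale_9: "0 < (y::real) \<Longrightarrow> 9 powr (- \<gamma>) * (y / 9) powr (- \<gamma>) = y powr (- \<gamma>)"
  by (simp add: powr_mult[symmetric])

lemma bin_poly_le:
  assumes "0 < \<gamma>" "0 < y" "y \<le> 9"
  shows "poly (bin_poly \<gamma> J) y \<le> y powr (- \<gamma>)"
proof -
  have "(\<Sum>i<J. \<bar>- \<gamma> gchoose i\<bar> * (1 - y / 9) ^ i) \<le> (y / 9) powr (- \<gamma>)"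
    using bin_poly_sums[OF assms] assms(3)
    by (subst sums_unique[OF bin_poly_sums[OF assms]])
      (auto intro!: sum_le_suminf dest: sums_summable)
  hence "poly (bin_poly \<gamma> J) y \<le> 9 powr (- \<gamma>) * (y / 9) powr (- \<gamma>)"
    unfolding poly_bin_poly by (intro mult_left_mono) auto
  thus ?thesis using powr_rescale_9[OF assms(2)] by simp
qed

lemma bin_poly_tendsto:
  assumes "0 < \<gamma>" "0 < y" "y \<le> 9"
  shows "(\<lambda>J. poly (bin_poly \<gamma> J) y) \<longlonglongrightarrow> y powr (- \<gamma>)"
proof -
  have "(\<lambda>J. poly (bin_poly \<gamma> J) y) \<longlonglongrightarrow> 9 powr (- \<gamma>) * (y / 9) powr (- \<gamma>)"
    unfolding poly_bin_poly using bin_poly_sums[OF assms]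
    by (intro tendsto_mult tendsto_const) (simp add: sums_def)
  thus ?thesis using powr_rescale_9[OF assms(2)] by simp
qed

context
  fixes \<gamma> :: real and k :: nat
  assumes \<gamma>: "0 < \<gamma>" "\<gamma> < 1" and k: "0 < k"
begin

text \<open>The limit itself dominates: the polynomials stay below y^(-\<gamma>), and its two Beta
  integrals converge because \<gamma> < 1.\<close>

lemma Rop_bin_poly:
  assumes y: "0 \<le> y" "y \<le> 9"
  shows Rop_bin_poly_tendsto: "(\<lambda>J. Rop k (bin_poly \<gamma> J) y) \<longlonglongrightarrow> y powr (real k + 1 - \<gamma>) * Beta (1 - \<gamma>) (real k + 1) ^ 2"
    and Rop_bin_poly_bound: "\<bar>Rop k (bin_poly \<gamma> J) y\<bar> \<le> y powr (real k + 1 - \<gamma>) * Beta (1 - \<gamma>) (real k + 1) ^ 2"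
proof -
  define B where "B = Beta (1 - \<gamma>) (real k + 1)"
  define f where "f q = bwt k (fst q) * bwt k (snd q)" for q
  define h where "h q = (bwt k (fst q) * fst q powr (- \<gamma>)) * (bwt k (snd q) * snd q powr (- \<gamma>))" for q
  have [measurable]: "f \<in> borel_measurable borel" unfolding f_def by measurable
  have b: "has_bochner_integral lborel (\<lambda>u. bwt k u * u powr (- \<gamma>)) B"
    using has_bochner_integral_bwt[of "- \<gamma>" k] \<gamma> k by (simp add: B_def)
  have hint: "integrable lborel h"
    unfolding h_def using b by (intro lborel_integrable_mult_pair) (auto simp: has_bochner_integral_iff)
  have hval: "(LINT q|lborel. h q) = B ^ 2"
    unfolding h_def using b by (subst lborel_integral_mult_pair) (auto simp: has_bochner_integral_iff power2_eq_square)
  have "((\<lambda>J. Rop k (bin_poly \<gamma> J) y) \<longlonglongrightarrow> y powr (real k + 1 - \<gamma>) * B ^ 2) \<and>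
      (\<forall>J. \<bar>Rop k (bin_poly \<gamma> J) y\<bar> \<le> y powr (real k + 1 - \<gamma>) * B ^ 2)"
  \<comment> \<open>At y = 0 both sides vanish, through the factor \<open>y ^ (k + 1)\<close> and
    through \<open>0 powr _ = 0\<close>; elsewhere the powers of y combine.\<close>
  proof (cases "y = 0")
    case True
    thus ?thesis by (simp add: Rop_def)
  next
    case False
    hence y0: "0 < y" using y by simp
    have pw: "y ^ (k + 1) * y powr (- \<gamma>) = y powr (real k + 1 - \<gamma>)"
      using y0 by (simp add: powr_realpow[symmetric] powr_add[symmetric] add.commute del: power_Suc)
    have prp: "(\<lambda>J. f q * poly (bin_poly \<gamma> J) (fst q * snd q * y)) \<longlonglongrightarrow> y powr (- \<gamma>) * h q \<and>
       (\<forall>J. 0 \<le> f q * poly (bin_poly \<gamma> J) (fst q * snd q * y) \<and> f q * poly (bin_poly \<gamma> J) (fst q * snd q * y) \<le> y powr (- \<gamma>) * h q)" for q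
    proof (cases "0 < fst q \<and> fst q \<le> 1 \<and> 0 < snd q \<and> snd q \<le> 1")
      case True
      define x where "x = fst q * snd q * y"
      have "x \<le> 1 * y" unfolding x_def using True y0 by (intro mult_right_mono mult_le_one) auto
      hence x: "0 < x" "x \<le> 9" using True y y0 by (simp_all add: x_def[symmetric]) (simp add: x_def)
      have "f q * x powr (- \<gamma>) = y powr (- \<gamma>) * h q"
        using True y0 by (simp add: f_def h_def x_def powr_mult)
      moreover have "0 \<le> f q" by (simp add: f_def)
      moreover have "(\<lambda>J. f q * poly (bin_poly \<gamma> J) x) \<longlonglongrightarrow> f q * x powr (- \<gamma>)"
        by (intro tendsto_mult tendsto_const bin_poly_tendsto \<gamma> x)
      ultimately show ?thesis
        using bin_poly_le[OF \<gamma>(1) x] bin_poly_nonneg[OF x(2), of \<gamma>]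
        unfolding x_def[symmetric] by (metis mult_left_mono mult_nonneg_nonneg)
    next
      case False
      hence "f q = 0" "h q = 0" by (auto simp: f_def h_def bwt_def indicator_def)
      thus ?thesis by simp
    qed
    have int': "integrable lborel (\<lambda>q. y powr (- \<gamma>) * h q)" by (intro integrable_mult_right hint)
    have m: "(\<lambda>q. y powr (- \<gamma>) * h q) \<in> borel_measurable lborel"
      "(\<lambda>q. f q * poly (bin_poly \<gamma> J) (fst q * snd q * y)) \<in> borel_measurable lborel" for J
      using int' unfolding poly_bin_poly by (auto simp: h_def)
    have bd: "norm (f q * poly (bin_poly \<gamma> J) (fst q * snd q * y)) \<le> y powr (- \<gamma>) * h q" for J q
      using prp[of q] by auto
    have lim: "(\<lambda>J. f q * poly (bin_poly \<gamma> J) (fst q * snd q * y)) \<longlonglongrightarrow> y powr (- \<gamma>) * h q" for q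
      using prp[of q] by auto
    have "(\<lambda>J. LINT q|lborel. f q * poly (bin_poly \<gamma> J) (fst q * snd q * y)) \<longlonglongrightarrow> (LINT q|lborel. y powr (- \<gamma>) * h q)"
      by (rule integral_dominated_convergence[where s = "\<lambda>J q. f q * poly (bin_poly \<gamma> J) (fst q * snd q * y)",
            OF m int' AE_I2[OF lim] AE_I2[OF bd]])
    hence "(\<lambda>J. y ^ (k + 1) * (LINT q|lborel. f q * poly (bin_poly \<gamma> J) (fst q * snd q * y)))
        \<longlonglongrightarrow> y ^ (k + 1) * (y powr (- \<gamma>) * B ^ 2)"
      by (intro tendsto_mult tendsto_const) (simp add: hval)
    also have "y ^ (k + 1) * (y powr (- \<gamma>) * B ^ 2) = y powr (real k + 1 - \<gamma>) * B ^ 2"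
      by (simp only: pw[symmetric] mult.assoc)
    finally have 1: "(\<lambda>J. Rop k (bin_poly \<gamma> J) y) \<longlonglongrightarrow> y powr (real k + 1 - \<gamma>) * B ^ 2"
      by (simp only: Rop_def f_def)
    have 2: "\<bar>Rop k (bin_poly \<gamma> J) y\<bar> \<le> y powr (real k + 1 - \<gamma>) * B ^ 2" for J
    proof -
      have "norm (f q * poly (bin_poly \<gamma> J) (fst q * snd q * y)) \<le> norm (y powr (- \<gamma>) * h q)" for q
        unfolding real_norm_def[of "y powr (- \<gamma>) * h q"] by (rule order_trans[OF bd abs_ge_self])
      hence "integrable lborel (\<lambda>q. f q * poly (bin_poly \<gamma> J) (fst q * snd q * y))"
        by (intro Bochner_Integration.integrable_bound[OF int' m(2)] AE_I2)
      hence "\<bar>LINT q|lborel. f q * poly (bin_poly \<gamma> J) (fst q * snd q * y)\<bar> \<le> (LINT q|lborel. y powr (- \<gamma>) * h q)"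
        using Bochner_Integration.integral_norm_bound_integral[OF _ int', of "\<lambda>q. f q * poly (bin_poly \<gamma> J) (fst q * snd q * y)"] bd
        by simp
      hence "y ^ (k + 1) * \<bar>LINT q|lborel. f q * poly (bin_poly \<gamma> J) (fst q * snd q * y)\<bar>
          \<le> y ^ (k + 1) * (y powr (- \<gamma>) * B ^ 2)"
        using y by (intro mult_left_mono) (auto simp: hval)
      also have "\<dots> = y powr (real k + 1 - \<gamma>) * B ^ 2"
        by (simp only: pw[symmetric] mult.assoc)
      finally show ?thesis using y by (simp add: Rop_def f_def abs_mult)
    qed
    from 1 2 show ?thesis by blast
  qed
  thus "(\<lambda>J. Rop k (bin_poly \<gamma> J) y) \<longlonglongrightarrow> y powr (real k + 1 - \<gamma>) * Beta (1 - \<gamma>) (real k + 1) ^ 2"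
    "\<bar>Rop k (bin_poly \<gamma> J) y\<bar> \<le> y powr (real k + 1 - \<gamma>) * Beta (1 - \<gamma>) (real k + 1) ^ 2"
    by (simp_all add: B_def)
qed

lemma set_integral_Rop_tendsto:
  assumes \<sigma>: "\<bar>\<sigma>\<bar> = 1"
  shows "(\<lambda>J. LINT x:{0..<1}|lborel. Rop k (bin_poly \<gamma> J) ((cmod (line k \<sigma> x))\<^sup>2))
    \<longlonglongrightarrow> Beta (1 - \<gamma>) (real k + 1) ^ 2 * (LINT x:{0..<1}|lborel. (cmod (line k \<sigma> x))\<^sup>2 powr (real k + 1 - \<gamma>))"
proof -
  define B where "B = Beta (1 - \<gamma>) (real k + 1) ^ 2"
  define Y where "Y x = (cmod (line k \<sigma> x))\<^sup>2" for x
  have Y: "0 \<le> Y x" "Y x \<le> 9" for x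
    using power_mono[OF cmod_line_le_3[OF \<sigma>], of k x 2] by (auto simp: Y_def)
  have [measurable]: "Y \<in> borel_measurable borel"
    unfolding Y_def by (intro borel_measurable_continuous_onI continuous_intros)
  have "(\<lambda>J. LINT x|lborel. indicator {0..<1} x *\<^sub>R Rop k (bin_poly \<gamma> J) (Y x))
     \<longlonglongrightarrow> (LINT x|lborel. indicator {0..<1} x *\<^sub>R (Y x powr (real k + 1 - \<gamma>) * B))"
  proof (rule integral_dominated_convergence[where w = "\<lambda>x. indicator {0..<1} x * (9 powr (real k + 1 - \<gamma>) * B)"])
    show "AE x in lborel. (\<lambda>J. indicator {0..<1} x *\<^sub>R Rop k (bin_poly \<gamma> J) (Y x))
        \<longlonglongrightarrow> indicator {0..<1} x *\<^sub>R (Y x powr (real k + 1 - \<gamma>) * B)"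
      unfolding B_def by (intro AE_I2 tendsto_scaleR tendsto_const Rop_bin_poly_tendsto Y)
    fix J
    show "AE x in lborel. norm (indicator {0..<1} x *\<^sub>R Rop k (bin_poly \<gamma> J) (Y x))
        \<le> indicator {0..<1} x * (9 powr (real k + 1 - \<gamma>) * B)"
    proof (rule AE_I2)
      fix x
      have "\<bar>Rop k (bin_poly \<gamma> J) (Y x)\<bar> \<le> Y x powr (real k + 1 - \<gamma>) * B"
        unfolding B_def by (rule Rop_bin_poly_bound[OF Y])
      also have "\<dots> \<le> 9 powr (real k + 1 - \<gamma>) * B"
        unfolding B_def using Y \<gamma> by (intro mult_right_mono powr_mono2) auto
      finally show "norm (indicator {0..<1} x *\<^sub>R Rop k (bin_poly \<gamma> J) (Y x))
        \<le> indicator {0..<1} x * (9 powr (real k + 1 - \<gamma>) * B)"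
        by (simp add: indicator_def)
    qed
    show "(\<lambda>x. indicator {0..<1} x *\<^sub>R Rop k (bin_poly \<gamma> J) (Y x)) \<in> borel_measurable lborel"
      unfolding Rop_eq[OF k] by measurable
  qed (auto intro!: integrable_mult_left integrable_real_indicator)
  thus ?thesis
    unfolding set_lebesgue_integral_def Y_def B_def[symmetric] mult.commute[of B]
    by (simp add: mult.assoc[symmetric])
qed

lemma integral_ww_kern_kap:
  "(LINT p|lborel. ww k p * kap \<gamma> (1 + (fst p + snd p)) * Re (kern k (fst p) (snd p)))
    = pi\<^sup>2 / 4 * Beta (1 - \<gamma>) (real k + 1) ^ 2 *
      ((LINT x:{0..<1}|lborel. (cmod (line k 1 x))\<^sup>2 powr (real k + 1 - \<gamma>))
        - (LINT x:{0..<1}|lborel. (cmod (line k (-1) x))\<^sup>2 powr (real k + 1 - \<gamma>)))"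
proof -
  define Y where "Y p = (cmod (1 + fst p + snd p))\<^sup>2" for p :: "complex \<times> complex"
  define K where "K p = ww k p * Re (kern k (fst p) (snd p))" for p
  have [measurable]: "K \<in> borel_measurable borel" "Y \<in> borel_measurable borel"
    unfolding K_def Y_def by measurable
  have Kb: "\<bar>K p\<bar> \<le> indicator (ball 0 1 \<times> ball 0 1) p" for p
    unfolding K_def abs_mult abs_of_nonneg[OF ww_nonneg]
    by (rule order_trans[OF mult_left_mono[OF abs_Re_le_cmod] ww_kern_bound[OF k]]) simp
  have int: "integrable lborel (\<lambda>p. indicator (ball 0 1 \<times> ball 0 1) p * kap \<gamma> (1 + (fst p + snd p)))"
    by (rule integrable_kap_bidisc[OF \<gamma>(2)]) simp
  \<comment> \<open>At w = 0 the polynomials tend to infinity whereas the \<open>powr\<close> value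
    is 0, so convergence can only be claimed off this null set.\<close>
  have null: "AE p in lborel. Y p \<noteq> 0"
  proof -
    have "AE z in lborel. AE u in lborel. Y (z, u) \<noteq> 0"
    proof (rule AE_I2)
      fix z :: complex
      show "AE u in lborel. Y (z, u) \<noteq> 0"
        using AE_lborel_singleton[of "- 1 - z"]
        by eventually_elim (auto simp: Y_def algebra_simps add_eq_0_iff2)
    qed
    hence "AE p in (lborel \<Otimes>\<^sub>M lborel). Y p \<noteq> 0"
    proof (rule lborel_pair.AE_pair_measure[rotated])
      show "{p \<in> space (lborel \<Otimes>\<^sub>M lborel). Y p \<noteq> 0} \<in> sets (lborel \<Otimes>\<^sub>M lborel)"
        unfolding lborel_prod by measurable
    qed
    thus ?thesis unfolding lborel_prod .
  qed
  have 1: "(\<lambda>J. LINT p|lborel. K p * poly (bin_poly \<gamma> J) (Y p)) \<longlonglongrightarrow> (LINT p|lborel. K p * (Y p powr (- \<gamma>)))"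
  proof (rule integral_dominated_convergence[OF _ _ int])
    have conv: "(\<lambda>J. K p * poly (bin_poly \<gamma> J) (Y p)) \<longlonglongrightarrow> K p * (Y p powr (- \<gamma>)) \<and>
        (\<forall>J. norm (K p * poly (bin_poly \<gamma> J) (Y p)) \<le> indicator (ball 0 1 \<times> ball 0 1) p * kap \<gamma> (1 + (fst p + snd p)))"
      if "Y p \<noteq> 0" for p
    proof (cases "p \<in> ball 0 1 \<times> ball 0 1")
      case True
      have "Y p \<le> 3 ^ 2" unfolding Y_def by (intro power_mono bidisc_sum_le_3 True) auto
      hence y: "0 < Y p" "Y p \<le> 9" using that by (auto simp: Y_def)
      have "norm (K p * poly (bin_poly \<gamma> J) (Y p)) \<le> 1 * kap \<gamma> (1 + (fst p + snd p))" for J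
        unfolding norm_mult using bin_poly_le[OF \<gamma>(1) y, of J] bin_poly_nonneg[OF y(2), of \<gamma> J] Kb[of p] True
        by (intro mult_mono) (auto simp: kap_def Y_def add.assoc)
      moreover have "(\<lambda>J. K p * poly (bin_poly \<gamma> J) (Y p)) \<longlonglongrightarrow> K p * (Y p powr (- \<gamma>))"
        by (intro tendsto_mult tendsto_const bin_poly_tendsto \<gamma> y)
      ultimately show ?thesis using True by simp
    next
      case False
      hence "K p = 0" using Kb[of p] by simp
      thus ?thesis by simp
    qed
    show "AE p in lborel. (\<lambda>J. K p * poly (bin_poly \<gamma> J) (Y p)) \<longlonglongrightarrow> K p * (Y p powr (- \<gamma>))"
      using null by eventually_elim (use conv in blast)
    show "AE p in lborel. norm (K p * poly (bin_poly \<gamma> J) (Y p)) \<le> indicator (ball 0 1 \<times> ball 0 1) p * kap \<gamma> (1 + (fst p + snd p))" for J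
      using null by eventually_elim (use conv in blast)
    show "(\<lambda>p. K p * poly (bin_poly \<gamma> J) (Y p)) \<in> borel_measurable lborel" for J
      unfolding poly_bin_poly by measurable
  qed measurable
  have 2: "(LINT p|lborel. K p * poly (bin_poly \<gamma> J) (Y p))
      = pi\<^sup>2 / 4 * ((LINT x:{0..<1}|lborel. Rop k (bin_poly \<gamma> J) ((cmod (line k 1 x))\<^sup>2))
        - (LINT x:{0..<1}|lborel. Rop k (bin_poly \<gamma> J) ((cmod (line k (-1) x))\<^sup>2)))" for J
    using integral_ww_kern_poly[OF k, of "bin_poly \<gamma> J"] by (simp add: K_def Y_def mult_ac)
  have 3: "(\<lambda>J. pi\<^sup>2 / 4 * ((LINT x:{0..<1}|lborel. Rop k (bin_poly \<gamma> J) ((cmod (line k 1 x))\<^sup>2))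
        - (LINT x:{0..<1}|lborel. Rop k (bin_poly \<gamma> J) ((cmod (line k (-1) x))\<^sup>2))))
      \<longlonglongrightarrow> pi\<^sup>2 / 4 * (Beta (1 - \<gamma>) (real k + 1) ^ 2 * (LINT x:{0..<1}|lborel. (cmod (line k 1 x))\<^sup>2 powr (real k + 1 - \<gamma>))
       - Beta (1 - \<gamma>) (real k + 1) ^ 2 * (LINT x:{0..<1}|lborel. (cmod (line k (-1) x))\<^sup>2 powr (real k + 1 - \<gamma>)))"
    by (intro tendsto_mult tendsto_const tendsto_diff set_integral_Rop_tendsto) auto
  have "(LINT p|lborel. K p * (Y p powr (- \<gamma>)))
     = pi\<^sup>2 / 4 * (Beta (1 - \<gamma>) (real k + 1) ^ 2 * (LINT x:{0..<1}|lborel. (cmod (line k 1 x))\<^sup>2 powr (real k + 1 - \<gamma>))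
       - Beta (1 - \<gamma>) (real k + 1) ^ 2 * (LINT x:{0..<1}|lborel. (cmod (line k (-1) x))\<^sup>2 powr (real k + 1 - \<gamma>)))"
    by (rule LIMSEQ_unique[OF 1[unfolded 2] 3])
  thus ?thesis
    by (simp add: K_def Y_def kap_def add.assoc algebra_simps)
qed

end

section \<open>Fourier coefficients of the Riesz kernel\<close>

text \<open>Serves both the powers of 1 + w and the kernel. The frequencies are arbitrary integers
  because conjugate factors bring negative ones.\<close>

lemma set_integral_fourier_sums:
  fixes f :: "real \<Rightarrow> complex" and d :: "nat \<Rightarrow> complex" and m :: "nat \<Rightarrow> int"
  assumes cont: "continuous_on UNIV f" and sd: "summable (\<lambda>h. norm (d h))"
  shows "(\<lambda>h. d h * (LINT t:{0..<1}|lborel. f t * e (of_int (m h) * t)))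
    sums (LINT t:{0..<1}|lborel. f t * (\<Sum>h. d h * e (of_int (m h) * t)))"
proof -
  define w where "w = (indicator {0..<1} :: real \<Rightarrow> real)"
  define g where "g h t = d h * (w t *\<^sub>R (f t * e (of_int (m h) * t)))" for h t
  have "compact (f ` {0..1})"
    using cont by (intro compact_continuous_image) (auto intro: continuous_on_subset)
  then obtain B where B: "\<And>t. t \<in> {0..1} \<Longrightarrow> norm (f t) \<le> B"
    using compact_imp_bounded bounded_iff by (metis imageI)
  have B0: "0 \<le> B" by (rule order_trans[OF norm_ge_zero B[of 0]]) simp
  have wi: "integrable lborel w"
    unfolding w_def by (intro integrable_real_indicator) auto
  have int: "integrable lborel (\<lambda>t. w t *\<^sub>R (f t * e (of_int (m h) * t)))" for h
    using set_integrable_Ico_continuous[of "\<lambda>t. f t * e (of_int (m h) * t)"] cont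
    by (simp add: set_integrable_def w_def continuous_intros)
  have gb: "norm (g h t) \<le> norm (d h) * (B * w t)" for h t
  proof (cases "t \<in> {0..<1}")
    case True
    thus ?thesis using B[of t] by (auto simp: g_def w_def norm_mult intro: mult_left_mono)
  qed (simp add: g_def w_def)
  have "(\<lambda>h. LINT t|lborel. g h t) sums (LINT t|lborel. (\<Sum>h. g h t))"
  proof (rule sums_integral)
    show "integrable lborel (g h)" for h
      unfolding g_def by (intro integrable_mult_right int)
    show "AE t in lborel. summable (\<lambda>h. norm (g h t))"
    proof (rule AE_I2)
      fix t
      show "summable (\<lambda>h. norm (g h t))"
        by (rule summable_comparison_test'[OF summable_mult2[OF sd, of "B * w t"]]) (use gb in auto)
    qed
    show "summable (\<lambda>h. LINT t|lborel. norm (g h t))"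
    proof (rule summable_comparison_test'[OF summable_mult2[OF sd, of "B"]])
      fix h
      have "(LINT t|lborel. norm (g h t)) \<le> (LINT t|lborel. norm (d h) * (B * w t))"
        using gb wi int unfolding g_def
        by (intro Bochner_Integration.integral_mono integrable_norm integrable_mult_right) auto
      also have "\<dots> = norm (d h) * B" by (simp add: w_def)
      finally show "norm (LINT t|lborel. norm (g h t)) \<le> norm (d h) * B" by simp
    qed
  qed
  moreover have "(LINT t|lborel. g h t) = d h * (LINT t:{0..<1}|lborel. f t * e (of_int (m h) * t))" for h
    unfolding g_def set_lebesgue_integral_def w_def[symmetric] by (rule integral_mult_right_zero)
  moreover have "(\<Sum>h. g h t) = w t *\<^sub>R (f t * (\<Sum>h. d h * e (of_int (m h) * t)))" for t
  proof -
    have s: "summable (\<lambda>h. d h * e (of_int (m h) * t))"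
      by (rule summable_norm_cancel) (simp add: norm_mult sd)
    have "(\<Sum>h. g h t) = (\<Sum>h. (w t *\<^sub>R f t) * (d h * e (of_int (m h) * t)))"
      by (simp add: g_def mult_ac)
    also have "\<dots> = (w t *\<^sub>R f t) * (\<Sum>h. d h * e (of_int (m h) * t))"
      by (rule suminf_mult[OF s])
    finally show ?thesis by simp
  qed
  ultimately show ?thesis
    by (simp add: set_lebesgue_integral_def w_def[symmetric])
qed

text \<open>An integral rather than a power series, so that one formula covers radii below and above
  1.\<close>

definition khat :: "real \<Rightarrow> nat \<Rightarrow> complex \<Rightarrow> complex" where
  "khat \<gamma> l \<sigma> = (LINT t:{0..<1}|lborel. of_real (kap \<gamma> (1 + e t * \<sigma>)) * e (- (real l * t)))"

text \<open>Consecutive absolute values have the ratio (\<gamma> + n) / (n + 1), at most 1 because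
  \<gamma> < 1. This monotonicity is what orders the Fourier coefficients.\<close>

lemma abs_gbinomial_Suc:
  fixes \<gamma> :: real
  assumes "0 < \<gamma>" "\<gamma> < 1"
  shows "\<bar>- \<gamma> gchoose Suc n\<bar> \<le> \<bar>- \<gamma> gchoose n\<bar>"
proof -
  have "(- \<gamma> gchoose Suc n) = (- \<gamma> gchoose n) * ((- \<gamma> - real n) / (real n + 1))"
    by (simp add: gbinomial_prod_rev field_simps)
  hence "\<bar>- \<gamma> gchoose Suc n\<bar> = \<bar>- \<gamma> gchoose n\<bar> * ((\<gamma> + real n) / (real n + 1))"
    using assms by (simp add: abs_mult)
  also have "\<dots> \<le> \<bar>- \<gamma> gchoose n\<bar> * 1"
    using assms by (intro mult_left_mono) auto
  finally show ?thesis by simp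
qed

text \<open>|1 + w|^(-2\<gamma>) is P times its conjugate with P = (1 + w)^(-\<gamma>). Writing g j
  for the absolute binomial coefficients, multiplying the two series gives S l = \<Sum> g j * g (j +
  l) * r^(2j). All terms are nonnegative, and they decrease in l because g does.\<close>

lemma khat_inside:
  assumes \<gamma>: "0 < \<gamma>" "\<gamma> < 1" and \<sigma>: "cmod \<sigma> < 1"
  obtains S where "\<And>l. khat \<gamma> l \<sigma> = (-1) ^ l * \<sigma> ^ l * of_real (S l)" "0 < S 1"
    "\<And>l. 1 \<le> l \<Longrightarrow> 0 \<le> S l \<and> S l \<le> S 1"
proof -
  define r where "r = cmod \<sigma>"
  have r: "0 \<le> r" "r < 1" using \<sigma> by (auto simp: r_def)
  define a where "a j = (- \<gamma> gchoose j)" for j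
  define g where "g j = \<bar>a j\<bar>" for j
  have ag: "a j = (-1) ^ j * g j" for j
    unfolding a_def g_def by (rule abs_gbinomial_minus[OF \<gamma>(1)])
  have g_anti: "antimono g"
    unfolding g_def a_def by (intro decseq_SucI abs_gbinomial_Suc \<gamma>)
  have "(\<lambda>j. (- \<gamma> gchoose j) * (- r) ^ j) sums (1 + - r) powr (- \<gamma>)"
    by (rule gen_binomial_real) (use r in auto)
  moreover have "(- \<gamma> gchoose j) * (- r) ^ j = g j * r ^ j" for j
  proof -
    have "(- \<gamma> gchoose j) * (- r) ^ j = ((-1) ^ j * (-1) ^ j) * (g j * r ^ j)"
      unfolding a_def[symmetric] ag power_minus[of r] by (simp only: mult_ac)
    thus ?thesis by (simp add: power_mult_distrib[symmetric])
  qed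
  ultimately have sg: "summable (\<lambda>j. g j * r ^ j)" by (simp add: sums_iff)
  define c where "c j = complex_of_real (a j) * \<sigma> ^ j" for j
  have nc: "norm (c j) = g j * r ^ j" for j
    by (simp add: c_def norm_mult norm_power g_def r_def)
  have sc: "summable (\<lambda>j. norm (c j))" "summable (\<lambda>j. norm (cnj (c j)))" using sg by (simp_all add: nc)
  define P where "P t = (1 + e t * \<sigma>) powr (- of_real \<gamma>)" for t
  have pos: "0 < Re (1 + e t * \<sigma>)" for t
    using abs_Re_le_cmod[of "e t * \<sigma>"] \<sigma> by (simp add: norm_mult)
  have nz: "1 + e t * \<sigma> \<noteq> 0" for t
    using pos[of t] by (metis less_irrefl zero_complex.sel(1))
  have contP: "continuous_on UNIV P"
  proof -
    have "1 + e t * \<sigma> \<notin> \<real>\<^sub>\<le>\<^sub>0" for t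
      using pos[of t] unfolding complex_nonpos_Reals_iff by (simp only: not_le[symmetric] simp_thms)
    moreover from nz have "P = (\<lambda>t. exp (- of_real \<gamma> * Ln (1 + e t * \<sigma>)))"
      by (simp add: fun_eq_iff P_def powr_def)
    ultimately show ?thesis by (auto intro!: continuous_intros)
  qed
  have P_sums: "(\<lambda>j. c j * e (of_int (int j) * t)) sums P t" for t
  proof -
    have "(\<lambda>j. (- of_real \<gamma> gchoose j) * (e t * \<sigma>) ^ j) sums (1 + e t * \<sigma>) powr (- of_real \<gamma>)"
      by (rule gen_binomial_complex) (simp add: norm_mult \<sigma>)
    moreover have "((- of_real \<gamma> :: complex) gchoose j) = of_real (a j)" for j
      by (simp add: a_def gbinomial_prod_rev)
    ultimately show ?thesis by (simp add: P_def c_def power_mult_distrib e_power mult_ac)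
  qed
  have cP_sums: "(\<lambda>j. cnj (c j) * e (of_int (- int j) * t)) sums cnj (P t)" for t
    using sums_cnj[THEN iffD2, OF P_sums[of t]] by (simp add: e_minus)
  have kapP: "complex_of_real (kap \<gamma> (1 + e t * \<sigma>)) = P t * cnj (P t)" for t
  proof -
    have nz: "1 + e t * \<sigma> \<noteq> 0" by (rule nz)
    have "cmod (P t) = cmod (1 + e t * \<sigma>) powr (- \<gamma>)"
      unfolding P_def using norm_powr_real_powr'[of "- of_real \<gamma>" "1 + e t * \<sigma>"] by simp
    hence "kap \<gamma> (1 + e t * \<sigma>) = (cmod (P t))\<^sup>2"
      using nz by (simp add: kap_def power2_eq_square powr_mult)
    thus ?thesis by (simp only: complex_norm_square)
  qed
  have coef: "(LINT t:{0..<1}|lborel. P t * e (- (real n * t))) = c n" for n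
  proof -
    have 1: "(\<lambda>j. c j * (LINT t:{0..<1}|lborel. e (- (real n * t)) * e (of_int (int j) * t)))
        sums (LINT t:{0..<1}|lborel. e (- (real n * t)) * (\<Sum>j. c j * e (of_int (int j) * t)))"
      by (intro set_integral_fourier_sums continuous_intros sc)
    have 2: "c j * (LINT t:{0..<1}|lborel. e (- (real n * t)) * e (of_int (int j) * t)) = (if j = n then c j else 0)" for j
    proof -
      have eq: "e (- (real n * t)) * e (of_int (int j) * t) = e (of_int (int j - int n) * t)" for t
        by (simp add: e_add[symmetric] algebra_simps)
      show ?thesis unfolding eq set_integral_e by simp
    qed
    have 3: "(\<Sum>j. c j * e (of_int (int j) * t)) = P t" for t
      using P_sums[of t] by (simp only: sums_iff)
    have "(LINT t:{0..<1}|lborel. e (- (real n * t)) * P t) = c n"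
      by (rule sums_unique2[OF 1[unfolded 2 3] sums_single])
    thus ?thesis by (simp only: mult.commute)
  qed
  \<comment> \<open>Only the conjugate factor is expanded; each remaining integral is then a Fourier
    coefficient of \<open>P\<close>, known from \<open>coef\<close>.\<close>
  have kh: "(\<lambda>j. cnj (c j) * c (j + l)) sums khat \<gamma> l \<sigma>" for l
  proof -
    have "(\<lambda>j. cnj (c j) * (LINT t:{0..<1}|lborel. (P t * e (- (real l * t))) * e (of_int (- int j) * t)))
        sums (LINT t:{0..<1}|lborel. (P t * e (- (real l * t))) * (\<Sum>j. cnj (c j) * e (of_int (- int j) * t)))"
      by (intro set_integral_fourier_sums continuous_intros contP sc)
    moreover have "(LINT t:{0..<1}|lborel. (P t * e (- (real l * t))) * e (of_int (- int j) * t)) = c (j + l)" for j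
    proof -
      have "(P t * e (- (real l * t))) * e (of_int (- int j) * t) = P t * e (- (real (j + l) * t))" for t
        by (simp add: mult.assoc e_add[symmetric] algebra_simps)
      thus ?thesis by (simp only: coef)
    qed
    moreover have "(P t * e (- (real l * t))) * (\<Sum>j. cnj (c j) * e (of_int (- int j) * t))
        = of_real (kap \<gamma> (1 + e t * \<sigma>)) * e (- (real l * t))" for t
    proof -
      have "(\<Sum>j. cnj (c j) * e (of_int (- int j) * t)) = cnj (P t)"
        using cP_sums[of t] by (simp only: sums_iff)
      thus ?thesis unfolding kapP by (simp only: mult_ac)
    qed
    ultimately show ?thesis by (simp only: khat_def)
  qed
  define s where "s l j = g j * g (j + l) * (r ^ 2) ^ j" for l j
  have g0: "0 \<le> g j" "g j \<le> 1" for j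
  proof -
    show "0 \<le> g j" by (simp add: g_def)
    have "g j \<le> g 0" using g_anti by (simp add: antimono_def)
    thus "g j \<le> 1" by (simp add: g_def a_def)
  qed
  have ss: "summable (s l)" for l
  proof (rule summable_comparison_test'[of "\<lambda>j. (r ^ 2) ^ j"])
    show "summable (\<lambda>j. (r ^ 2) ^ j)" using r by (intro summable_geometric) (simp add: abs_square_less_1)
    show "norm (s l j) \<le> (r ^ 2) ^ j" for j
    proof -
      have "g j * g (j + l) \<le> 1" using g0 by (intro mult_le_one) auto
      hence "g j * g (j + l) * (r ^ 2) ^ j \<le> 1 * (r ^ 2) ^ j" by (intro mult_right_mono) auto
      thus ?thesis using g0 by (simp add: s_def abs_mult)
    qed
  qed
  have cc: "cnj (c j) * c (j + l) = (-1) ^ l * \<sigma> ^ l * of_real (s l j)" for j l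
  proof -
    have "complex_of_real ((r ^ 2) ^ j) = \<sigma> ^ j * cnj \<sigma> ^ j"
      by (simp only: r_def of_real_power[of _ j] complex_norm_square power_mult_distrib)
    moreover have "a j * a (j + l) = (-1) ^ l * (g j * g (j + l))"
    proof -
      have "a j * a (j + l) = ((-1) ^ j * (-1) ^ j) * ((-1) ^ l * (g j * g (j + l)))"
        by (subst (1 2) ag) (simp add: power_add mult_ac)
      thus ?thesis by (simp add: power_mult_distrib[symmetric])
    qed
    moreover have "cnj (c j) * c (j + l) = of_real (a j * a (j + l)) * (\<sigma> ^ j * cnj \<sigma> ^ j) * \<sigma> ^ l"
      by (simp add: c_def power_add mult_ac)
    ultimately have "cnj (c j) * c (j + l) = of_real ((-1) ^ l * (g j * g (j + l))) * of_real ((r ^ 2) ^ j) * \<sigma> ^ l"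
      by (simp only:)
    thus ?thesis by (simp add: s_def mult_ac)
  qed
  show thesis
  proof (rule that[of "\<lambda>l. suminf (s l)"])
    fix l
    have "(\<lambda>j. (-1) ^ l * \<sigma> ^ l * complex_of_real (s l j)) sums ((-1) ^ l * \<sigma> ^ l * of_real (suminf (s l)))"
      using ss[of l] by (intro sums_mult sums_of_real summable_sums)
    thus "khat \<gamma> l \<sigma> = (-1) ^ l * \<sigma> ^ l * of_real (suminf (s l))"
      using kh[of l] unfolding cc by (rule sums_unique2[symmetric])
  next
    \<comment> \<open>The leading term g 0 * g 1 alone makes the sum strictly positive.\<close>
    have "s 1 0 = \<gamma>" using \<gamma> by (simp add: s_def g_def a_def)
    hence "0 < s 1 0" using \<gamma> by simp
    thus "0 < suminf (s 1)"
      using ss[of 1] g0 r by (intro suminf_pos2[of _ 0]) (auto simp: s_def)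
  next
    fix l :: nat assume l: "1 \<le> l"
    have "s l j \<le> s 1 j" for j
    proof -
      have "g (j + l) \<le> g (j + 1)" using g_anti l by (auto simp: antimono_def)
      thus ?thesis unfolding s_def using g0 by (intro mult_right_mono mult_left_mono) auto
    qed
    thus "0 \<le> suminf (s l) \<and> suminf (s l) \<le> suminf (s 1)"
      using ss g0 by (auto intro!: suminf_nonneg suminf_le simp: s_def)
  qed
qed

text \<open>Inversion in the unit circle: with \<sigma>' = 1 / cnj \<sigma>, the moduli |1 + e(t)
  \<sigma>| and |\<sigma>| |1 + e(t) \<sigma>'| agree for every t, so radii above 1 reduce to radii
  below 1.\<close>

lemma khat_outside:
  assumes "\<sigma> \<noteq> 0"
  shows "khat \<gamma> l \<sigma> = of_real (kap \<gamma> \<sigma>) * khat \<gamma> l (\<sigma> / of_real ((cmod \<sigma>)\<^sup>2))"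
proof -
  have "kap \<gamma> (1 + e t * \<sigma>) = kap \<gamma> \<sigma> * kap \<gamma> (1 + e t * (\<sigma> / of_real ((cmod \<sigma>)\<^sup>2)))" for t
  proof -
    have et: "e t * cnj (e t) = 1" using complex_norm_square[of "e t"] by simp
    have "\<sigma> / of_real ((cmod \<sigma>)\<^sup>2) = 1 / cnj \<sigma>"
      unfolding complex_norm_square using assms by simp
    hence "cmod (1 + e t * (\<sigma> / of_real ((cmod \<sigma>)\<^sup>2))) = cmod (1 + e t / cnj \<sigma>)"
      by simp
    also have "\<dots> = cmod (cnj (1 + e t / cnj \<sigma>))" by (simp only: complex_mod_cnj)
    also have "cnj (1 + e t / cnj \<sigma>) = 1 + cnj (e t) / \<sigma>" by simp
    finally have 1: "cmod (1 + e t * (\<sigma> / of_real ((cmod \<sigma>)\<^sup>2))) = cmod (1 + cnj (e t) / \<sigma>)" .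
    have "1 + e t * \<sigma> = (e t * \<sigma>) * (1 + cnj (e t) / \<sigma>)"
      using assms et by (simp add: field_simps)
    hence "cmod (1 + e t * \<sigma>) = cmod \<sigma> * cmod (1 + cnj (e t) / \<sigma>)"
      by (simp add: norm_mult)
    thus ?thesis unfolding kap_def 1 by (simp only: power_mult_distrib) (simp add: powr_mult)
  qed
  thus ?thesis by (simp add: khat_def mult.assoc)
qed

text \<open>Inside the circle \<open>khat\<close> of order l is (-\<sigma>)^l times a positive sum
  that is largest at l = 1: order 1 points opposite to \<sigma>, and order l loses |\<sigma>|^(l -
  1) against it. Inversion replaces |\<sigma>| by its reciprocal when it exceeds 1.\<close>

lemma khat_props:
  assumes \<gamma>: "0 < \<gamma>" "\<gamma> < 1" and \<sigma>: "\<sigma> \<noteq> 0" "cmod \<sigma> \<noteq> 1"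
  shows khat_neq_0: "khat \<gamma> 1 \<sigma> \<noteq> 0"
    and Re_khat: "Re (cnj \<sigma> * khat \<gamma> 1 \<sigma>) = - (cmod \<sigma> * cmod (khat \<gamma> 1 \<sigma>))"
    and khat_le: "1 \<le> l \<Longrightarrow> cmod (khat \<gamma> l \<sigma>) \<le> (min (cmod \<sigma>) (1 / cmod \<sigma>)) ^ (l - 1) * cmod (khat \<gamma> 1 \<sigma>)"
proof -
  have *: "khat \<gamma> 1 \<sigma> \<noteq> 0 \<and> Re (cnj \<sigma> * khat \<gamma> 1 \<sigma>) = - (cmod \<sigma> * cmod (khat \<gamma> 1 \<sigma>)) \<and>
     (\<forall>l\<ge>1. cmod (khat \<gamma> l \<sigma>) \<le> cmod \<sigma> ^ (l - 1) * cmod (khat \<gamma> 1 \<sigma>))"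
    if \<sigma>: "\<sigma> \<noteq> 0" "cmod \<sigma> < 1" for \<sigma>
  proof -
    obtain S where S: "\<And>l. khat \<gamma> l \<sigma> = (-1) ^ l * \<sigma> ^ l * of_real (S l)" "0 < S 1"
      "\<And>l. 1 \<le> l \<Longrightarrow> 0 \<le> S l \<and> S l \<le> S 1"
      using khat_inside[OF \<gamma> \<sigma>(2)] by blast
    have n: "cmod (khat \<gamma> l \<sigma>) = cmod \<sigma> ^ l * S l" if "1 \<le> l" for l
      using S(3)[OF that] by (simp add: S(1) norm_mult norm_power)
    have "cnj \<sigma> * khat \<gamma> 1 \<sigma> = - of_real ((cmod \<sigma>)\<^sup>2 * S 1)"
      unfolding S(1) of_real_mult complex_norm_square by (simp add: mult_ac)
    hence "Re (cnj \<sigma> * khat \<gamma> 1 \<sigma>) = - ((cmod \<sigma>)\<^sup>2 * S 1)" by simp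
    hence "Re (cnj \<sigma> * khat \<gamma> 1 \<sigma>) = - (cmod \<sigma> * cmod (khat \<gamma> 1 \<sigma>))"
      using n[of 1] by (simp add: power2_eq_square)
    moreover have "cmod (khat \<gamma> l \<sigma>) \<le> cmod \<sigma> ^ (l - 1) * cmod (khat \<gamma> 1 \<sigma>)" if "1 \<le> l" for l
    proof -
      have "cmod \<sigma> ^ l * S l \<le> cmod \<sigma> ^ l * S 1" using S(3)[OF that] by (intro mult_left_mono) auto
      moreover have "cmod \<sigma> ^ l = cmod \<sigma> ^ (l - 1) * cmod \<sigma>" using that by (simp add: power_eq_if)
      ultimately show ?thesis using n[OF that] n[of 1] by (simp add: mult.assoc)
    qed
    moreover have n1: "cmod (khat \<gamma> 1 \<sigma>) = cmod \<sigma> * S 1" using n[of 1] by simp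
    have "0 < cmod (khat \<gamma> 1 \<sigma>)" unfolding n1 using S(2) \<sigma> by simp
    hence "khat \<gamma> 1 \<sigma> \<noteq> 0" by (simp only: zero_less_norm_iff not_False_eq_True)
    ultimately show ?thesis by blast
  qed
  have "khat \<gamma> 1 \<sigma> \<noteq> 0 \<and> Re (cnj \<sigma> * khat \<gamma> 1 \<sigma>) = - (cmod \<sigma> * cmod (khat \<gamma> 1 \<sigma>)) \<and>
     (\<forall>l\<ge>1. cmod (khat \<gamma> l \<sigma>) \<le> (min (cmod \<sigma>) (1 / cmod \<sigma>)) ^ (l - 1) * cmod (khat \<gamma> 1 \<sigma>))"
  proof (cases "cmod \<sigma> < 1")
    case True
    have "cmod \<sigma> * cmod \<sigma> \<le> 1" using True by (intro mult_le_one) auto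
    hence "min (cmod \<sigma>) (1 / cmod \<sigma>) = cmod \<sigma>" using \<sigma>(1) by (simp add: min_def pos_le_divide_eq)
    thus ?thesis using *[OF \<sigma>(1) True] by simp
  next
    case False
    hence gt: "1 < cmod \<sigma>" using \<sigma> by simp
    define \<sigma>' where "\<sigma>' = \<sigma> / of_real ((cmod \<sigma>)\<^sup>2)"
    have n': "cmod \<sigma>' = 1 / cmod \<sigma>" using \<sigma>(1)
      unfolding \<sigma>'_def norm_divide norm_of_real by (simp add: power2_eq_square)
    have \<sigma>': "\<sigma>' \<noteq> 0" "cmod \<sigma>' < 1" using \<sigma>(1) gt by (auto simp: n') (simp add: \<sigma>'_def)
    have K: "0 < kap \<gamma> \<sigma>" using \<sigma>(1) by (simp add: kap_def)
    have kk: "khat \<gamma> l \<sigma> = of_real (kap \<gamma> \<sigma>) * khat \<gamma> l \<sigma>'" for l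
      unfolding \<sigma>'_def by (rule khat_outside[OF \<sigma>(1)])
    have mn: "min (cmod \<sigma>) (1 / cmod \<sigma>) = cmod \<sigma>'"
    proof -
      have "1 / cmod \<sigma> \<le> 1" using gt unfolding divide_le_eq_1 by linarith
      hence "1 / cmod \<sigma> \<le> cmod \<sigma>" using gt by linarith
      thus ?thesis by (simp add: n' min_absorb2)
    qed
    have "cnj \<sigma> = of_real ((cmod \<sigma>)\<^sup>2) * cnj \<sigma>'" using \<sigma>(1) by (simp add: \<sigma>'_def)
    hence "cnj \<sigma> * khat \<gamma> 1 \<sigma> = of_real ((cmod \<sigma>)\<^sup>2 * kap \<gamma> \<sigma>) * (cnj \<sigma>' * khat \<gamma> 1 \<sigma>')"
      by (simp only: kk[of 1] of_real_mult mult_ac)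
    hence "Re (cnj \<sigma> * khat \<gamma> 1 \<sigma>) = Re (of_real ((cmod \<sigma>)\<^sup>2 * kap \<gamma> \<sigma>) * (cnj \<sigma>' * khat \<gamma> 1 \<sigma>'))"
      by (rule arg_cong)
    also have "\<dots> = (cmod \<sigma>)\<^sup>2 * kap \<gamma> \<sigma> * Re (cnj \<sigma>' * khat \<gamma> 1 \<sigma>')"
      by (simp only: scaleR_conv_of_real[symmetric] scaleR_complex.sel)
    also have "\<dots> = - ((cmod \<sigma>)\<^sup>2 * kap \<gamma> \<sigma> * (cmod \<sigma>' * cmod (khat \<gamma> 1 \<sigma>')))"
      using *[OF \<sigma>'] by simp
    also have "\<dots> = - (cmod \<sigma> * cmod (khat \<gamma> 1 \<sigma>))"
      using \<sigma>(1) K by (simp add: kk[of 1, simplified] n' norm_mult power2_eq_square)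
    finally have 2: "Re (cnj \<sigma> * khat \<gamma> 1 \<sigma>) = - (cmod \<sigma> * cmod (khat \<gamma> 1 \<sigma>))" .
    have 3: "cmod (khat \<gamma> l \<sigma>) \<le> cmod \<sigma>' ^ (l - 1) * cmod (khat \<gamma> 1 \<sigma>)" if "1 \<le> l" for l
    proof -
      have "kap \<gamma> \<sigma> * cmod (khat \<gamma> l \<sigma>') \<le> kap \<gamma> \<sigma> * (cmod \<sigma>' ^ (l - 1) * cmod (khat \<gamma> 1 \<sigma>'))"
        using *[OF \<sigma>'] that K by (intro mult_left_mono) auto
      thus ?thesis using K by (simp add: kk[of l] kk[of 1, simplified] norm_mult mult_ac)
    qed
    show ?thesis using 2 3 *[OF \<sigma>'] K by (simp add: mn kk[of 1, simplified])
  qed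
  thus "khat \<gamma> 1 \<sigma> \<noteq> 0" "Re (cnj \<sigma> * khat \<gamma> 1 \<sigma>) = - (cmod \<sigma> * cmod (khat \<gamma> 1 \<sigma>))"
    "1 \<le> l \<Longrightarrow> cmod (khat \<gamma> l \<sigma>) \<le> (min (cmod \<sigma>) (1 / cmod \<sigma>)) ^ (l - 1) * cmod (khat \<gamma> 1 \<sigma>)"
    by auto
qed

text \<open>The exponents k + 2 of cnj z and k + 1 of u leave a net phase e(-t) in q, hence e(-2t)
  in its square.\<close>

lemma kern_rotate: "kern k (e t * z) (e t * u) = e (- t) * cnj z / (1 - e (- (2 * t)) * (cnj z ^ (k + 2) * u ^ (k + 1))\<^sup>2)"
proof -
  have c: "cnj (e t) * e t = 1" using complex_norm_square[of "e t"] by (simp add: mult.commute)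
  have "cnj (e t * z) ^ (k + 2) * (e t * u) ^ (k + 1)
      = (cnj (e t) * e t) ^ (k + 1) * cnj (e t) * (cnj z ^ (k + 2) * u ^ (k + 1))"
    by (simp add: power_mult_distrib mult_ac)
  also have "\<dots> = e (- t) * (cnj z ^ (k + 2) * u ^ (k + 1))" by (simp only: c power_one mult_1 e_minus)
  finally have "(cnj (e t * z) ^ (k + 2) * (e t * u) ^ (k + 1))\<^sup>2
      = e (- (2 * t)) * (cnj z ^ (k + 2) * u ^ (k + 1))\<^sup>2"
    by (simp only: power_mult_distrib e_power) simp
  thus ?thesis unfolding kern_def by (simp add: e_minus)
qed

lemma continuous_on_kap_circle:
  assumes "cmod \<sigma> \<noteq> 1"
  shows "continuous_on UNIV (\<lambda>t. complex_of_real (kap \<gamma> (1 + e t * \<sigma>)))"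
proof -
  have "1 + e t * \<sigma> \<noteq> 0" for t
  proof
    assume "1 + e t * \<sigma> = 0"
    hence "e t * \<sigma> = - 1" by (simp add: add_eq_0_iff)
    hence "cmod (e t * \<sigma>) = 1" by simp
    thus False using assms by (simp add: norm_mult)
  qed
  thus ?thesis unfolding kap_def by (intro continuous_intros) auto
qed

text \<open>Under rotation the h-th term of the geometric series has the single frequency -(2 h +
  1), so averaging pairs it with the Fourier coefficient of that order.\<close>

lemma integral_rotated_kern:
  assumes z: "cmod z < 1" and u: "cmod u < 1" and \<sigma>: "cmod \<sigma> \<noteq> 1"
  shows "(\<lambda>h. (cnj z * ((cnj z ^ (k + 2) * u ^ (k + 1))\<^sup>2) ^ h) * khat \<gamma> (2 * h + 1) \<sigma>)
    sums (LINT t:{0..<1}|lborel. of_real (kap \<gamma> (1 + e t * \<sigma>)) * kern k (e t * z) (e t * u))"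
proof -
  define q where "q = (cnj z ^ (k + 2) * u ^ (k + 1))\<^sup>2"
  have q: "cmod q < 1" unfolding q_def by (rule ratio_less_1(2)[OF z u])
  define m where "m h = - int (2 * h + 1)" for h
  have "(\<lambda>h. (cnj z * q ^ h) * (LINT t:{0..<1}|lborel. of_real (kap \<gamma> (1 + e t * \<sigma>)) * e (of_int (m h) * t)))
    sums (LINT t:{0..<1}|lborel. of_real (kap \<gamma> (1 + e t * \<sigma>)) * (\<Sum>h. (cnj z * q ^ h) * e (of_int (m h) * t)))"
    by (rule set_integral_fourier_sums[OF continuous_on_kap_circle[OF \<sigma>]])
      (use q in \<open>simp add: norm_mult norm_power summable_mult summable_geometric\<close>)
  moreover have "(\<Sum>h. (cnj z * q ^ h) * e (of_int (m h) * t)) = kern k (e t * z) (e t * u)" for t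
  proof -
    have "(\<lambda>h. (e (- (2 * t)) * q) ^ h) sums (1 / (1 - e (- (2 * t)) * q))"
      by (rule geometric_sums) (simp add: norm_mult q)
    hence "(\<lambda>h. (e (- t) * cnj z) * (e (- (2 * t)) * q) ^ h) sums ((e (- t) * cnj z) * (1 / (1 - e (- (2 * t)) * q)))"
      by (rule sums_mult)
    moreover have "(e (- t) * cnj z) * (e (- (2 * t)) * q) ^ h = (cnj z * q ^ h) * e (of_int (m h) * t)" for h
    proof -
      have "e (of_int (m h) * t) = e (- t) * e (- (2 * t)) ^ h"
        unfolding e_power e_add[symmetric] m_def by (rule arg_cong[of _ _ e]) (simp add: algebra_simps)
      thus ?thesis by (simp add: power_mult_distrib mult_ac)
    qed
    ultimately show ?thesis
      unfolding kern_rotate q_def[symmetric] by (simp add: sums_iff)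
  qed
  moreover have "(LINT t:{0..<1}|lborel. of_real (kap \<gamma> (1 + e t * \<sigma>)) * e (of_int (m h) * t)) = khat \<gamma> (2 * h + 1) \<sigma>" for h
  proof -
    have "of_int (m h) * t = - (real (2 * h + 1) * t)" for t by (simp add: m_def algebra_simps)
    thus ?thesis by (simp only: khat_def)
  qed
  ultimately show ?thesis by (simp only: q_def)
qed

text \<open>The decay factor per order is squared because consecutive odd orders differ by
  two.\<close>

definition shrink :: "complex \<Rightarrow> real" where
  "shrink \<sigma> = (min (cmod \<sigma>) (1 / cmod \<sigma>))\<^sup>2"

lemma shrink_bounds: "0 \<le> shrink \<sigma>" "shrink \<sigma> \<le> 1"
proof -
  have "0 \<le> min (cmod \<sigma>) (1 / cmod \<sigma>)" by simp
  moreover have "min (cmod \<sigma>) (1 / cmod \<sigma>) \<le> 1"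
    by (cases "cmod \<sigma> \<le> 1") (auto simp: min_le_iff_disj divide_le_eq_1)
  ultimately show "0 \<le> shrink \<sigma>" "shrink \<sigma> \<le> 1"
    by (auto simp: shrink_def power_le_one)
qed

text \<open>The common ratio of the geometric series that majorizes all modes after the first: decay
  of the Fourier coefficients times |q|^2.\<close>

definition ratio :: "nat \<Rightarrow> complex \<times> complex \<Rightarrow> real" where
  "ratio k p = shrink (fst p + snd p) * (cmod (cnj (fst p) ^ (k + 2) * snd p ^ (k + 1)))\<^sup>2"

lemma ratio_bounds:
  assumes "cmod (fst p) < 1" "cmod (snd p) < 1"
  shows "0 \<le> ratio k p" "ratio k p \<le> (cmod (cnj (fst p) ^ (k + 2) * snd p ^ (k + 1)))\<^sup>2" "ratio k p < 1"
proof -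
  show "0 \<le> ratio k p" using shrink_bounds by (simp add: ratio_def)
  have "shrink (fst p + snd p) * (cmod (cnj (fst p) ^ (k + 2) * snd p ^ (k + 1)))\<^sup>2
      \<le> 1 * (cmod (cnj (fst p) ^ (k + 2) * snd p ^ (k + 1)))\<^sup>2"
    using shrink_bounds by (intro mult_right_mono) auto
  thus 1: "ratio k p \<le> (cmod (cnj (fst p) ^ (k + 2) * snd p ^ (k + 1)))\<^sup>2"
    unfolding ratio_def by simp
  have "(cmod (fst p))\<^sup>2 < 1" using assms by (simp add: abs_square_less_1)
  thus "ratio k p < 1" using 1 ratio_less_1(1)[OF assms, of k] by linarith
qed

lemma Re_rotated_kern_le:
  assumes \<gamma>: "0 < \<gamma>" "\<gamma> < 1" and z: "cmod z < 1" and u: "cmod u < 1"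
    and \<sigma>: "z + u \<noteq> 0" "cmod (z + u) \<noteq> 1"
  shows "Re (LINT t:{0..<1}|lborel. of_real (kap \<gamma> (1 + e t * (z + u))) * kern k (e t * z) (e t * u))
    \<le> Re (cnj z * khat \<gamma> 1 (z + u)) + cmod z * cmod (khat \<gamma> 1 (z + u)) * (ratio k (z, u) / (1 - ratio k (z, u)))"
proof -
  define q where "q = (cnj z ^ (k + 2) * u ^ (k + 1))\<^sup>2"
  define K where "K l = khat \<gamma> l (z + u)" for l
  define Y where "Y = ratio k (z, u)"
  have Y: "0 \<le> Y" "Y < 1" using ratio_bounds[of "(z, u)" k] z u by (auto simp: Y_def)
  define f where "f h = (cnj z * q ^ h) * K (2 * h + 1)" for h
  have sf: "f sums (LINT t:{0..<1}|lborel. of_real (kap \<gamma> (1 + e t * (z + u))) * kern k (e t * z) (e t * u))"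
    unfolding f_def K_def q_def by (rule integral_rotated_kern[OF z u \<sigma>(2)])
  have Yq: "Y = shrink (z + u) * cmod q"
    by (simp add: Y_def ratio_def q_def norm_power)
  have fb: "norm (f (Suc h)) \<le> cmod z * cmod (K 1) * (Y * Y ^ h)" for h
  proof -
    have "cmod (K (2 * Suc h + 1)) \<le> (min (cmod (z + u)) (1 / cmod (z + u))) ^ (2 * Suc h + 1 - 1) * cmod (K 1)"
      unfolding K_def by (rule khat_le[OF \<gamma> \<sigma>]) simp
    also have "(min (cmod (z + u)) (1 / cmod (z + u))) ^ (2 * Suc h + 1 - 1) = shrink (z + u) ^ Suc h"
      by (simp only: shrink_def power_mult[symmetric] diff_add_inverse2)
    finally have "cmod (K (2 * Suc h + 1)) \<le> shrink (z + u) ^ Suc h * cmod (K 1)" .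
    hence "cmod z * cmod q ^ Suc h * cmod (K (2 * Suc h + 1))
        \<le> cmod z * cmod q ^ Suc h * (shrink (z + u) ^ Suc h * cmod (K 1))"
      by (rule mult_left_mono) simp
    also have "\<dots> = cmod z * cmod (K 1) * Y ^ Suc h"
      by (simp only: Yq power_mult_distrib mult_ac)
    finally show ?thesis by (simp only: f_def norm_mult norm_power power_Suc complex_mod_cnj)
  qed
  have gs: "(\<lambda>h. cmod z * cmod (K 1) * (Y * Y ^ h)) sums (cmod z * cmod (K 1) * (Y * (1 / (1 - Y))))"
    using Y by (intro sums_mult geometric_sums) simp
  have sm: "summable (\<lambda>h. norm (f (Suc h)))"
    by (rule summable_comparison_test'[OF sums_summable[OF gs]]) (use fb in simp)
  have "suminf f = f 0 + (\<Sum>h. f (Suc h))"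
    using suminf_split_head[OF sums_summable[OF sf]] by simp
  hence "Re (suminf f) = Re (f 0) + Re (\<Sum>h. f (Suc h))" by simp
  also have "Re (\<Sum>h. f (Suc h)) \<le> cmod (\<Sum>h. f (Suc h))" by (rule complex_Re_le_cmod)
  also have "\<dots> \<le> (\<Sum>h. norm (f (Suc h)))" by (rule summable_norm[OF sm])
  also have "\<dots> \<le> (\<Sum>h. cmod z * cmod (K 1) * (Y * Y ^ h))"
    by (rule suminf_le[OF fb sm sums_summable[OF gs]])
  also have "\<dots> = cmod z * cmod (K 1) * (Y / (1 - Y))"
    using gs by (simp add: sums_iff)
  finally have "Re (suminf f) \<le> Re (f 0) + cmod z * cmod (K 1) * (Y / (1 - Y))" by simp
  moreover have "f 0 = cnj z * K 1" by (simp add: f_def)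
  ultimately show ?thesis
    unfolding sums_unique[OF sf, symmetric] by (simp only: K_def Y_def)
qed

section \<open>Averaging over rotations\<close>

lemma null_sets_sphere: "sphere (a :: 'a::euclidean_space) r \<in> null_sets lborel"
proof -
  have "sphere a r \<in> null_sets lebesgue"
    using negligible_sphere by (simp add: negligible_iff_null_sets)
  thus ?thesis by (subst (asm) null_sets_completion_iff) auto
qed

text \<open>The exceptional sets are those where the Fourier information fails: for |z + u| = 1 the
  circle passes through the singularity, and for z + u = 0 the first coefficient is zero.\<close>

lemma AE_sum_generic: "AE p in lborel. fst p + snd p \<noteq> 0 \<and> cmod (fst p + snd p) \<noteq> 1"
proof -
  have "AE p in (lborel \<Otimes>\<^sub>M lborel). fst p + snd p \<noteq> 0 \<and> cmod (fst p + snd p) \<noteq> 1"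
  proof (rule lborel_pair.AE_pair_measure)
    show "{p \<in> space (lborel \<Otimes>\<^sub>M lborel). fst p + snd p \<noteq> 0 \<and> cmod (fst p + snd p) \<noteq> 1} \<in> sets (lborel \<Otimes>\<^sub>M lborel)"
      unfolding lborel_prod by measurable
    show "AE z in lborel. AE u in lborel. fst (z, u) + snd (z, u) \<noteq> 0 \<and> cmod (fst (z, u) + snd (z, u)) \<noteq> 1"
    proof (rule AE_I2)
      fix z :: complex
      have "AE u in lborel. u \<notin> sphere (- z) 0" "AE u in lborel. u \<notin> sphere (- z) 1"
        by (rule AE_not_in[OF null_sets_sphere])+
      thus "AE u in lborel. fst (z, u) + snd (z, u) \<noteq> 0 \<and> cmod (fst (z, u) + snd (z, u)) \<noteq> 1"
      proof eventually_elim
        case (elim u)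
        have "dist (- z) u = cmod (z + u)" by (metis dist_norm minus_add_distrib norm_minus_cancel uminus_add_conv_diff add.commute diff_conv_add_uminus)
        thus ?case using elim by auto
      qed
    qed
  qed
  thus ?thesis unfolding lborel_prod .
qed

lemma integral_isometry_pair:
  fixes f :: "complex \<times> complex \<Rightarrow> 'a::{banach, second_countable_topology}"
    and T :: "complex \<times> complex \<Rightarrow> complex \<times> complex"
  assumes T: "linear T" "\<And>p. norm (T p) = norm p" and [measurable]: "f \<in> borel_measurable borel"
  shows "(LINT p|lborel. f (T p)) = (LINT p|lborel. f p)"
proof -
  have "T \<in> borel_measurable borel"
    using T(1) by (intro borel_measurable_continuous_onI linear_continuous_on) (simp add: linear_linear)
  hence "(LINT p|lborel. f (T p)) = (LINT p|distr lborel borel T. f p)"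
    by (subst integral_distr) auto
  thus ?thesis by (simp only: lborel_distr_isometry[OF T])
qed

lemma integrable_isometry_pair:
  fixes f :: "complex \<times> complex \<Rightarrow> 'a::{banach, second_countable_topology}"
    and T :: "complex \<times> complex \<Rightarrow> complex \<times> complex"
  assumes T: "linear T" "\<And>p. norm (T p) = norm p" and [measurable]: "f \<in> borel_measurable borel"
  shows "integrable lborel (\<lambda>p. f (T p)) \<longleftrightarrow> integrable lborel f"
proof -
  have "T \<in> borel_measurable borel"
    using T(1) by (intro borel_measurable_continuous_onI linear_continuous_on) (simp add: linear_linear)
  hence "integrable lborel (\<lambda>p. f (T p)) \<longleftrightarrow> integrable (distr lborel borel T) f"
    by (subst integrable_distr_eq) auto
  thus ?thesis by (simp only: lborel_distr_isometry[OF T])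
qed

lemma rotate_pair:
  assumes "cmod c = 1"
  shows "linear (\<lambda>p :: complex \<times> complex. (c * fst p, c * snd p))" "norm (c * fst p, c * snd p) = norm (p :: complex \<times> complex)"
  using assms by (auto intro!: linearI simp: algebra_simps norm_Pair norm_mult norm_prod_def)

lemma swap_pair:
  shows "linear (\<lambda>p :: complex \<times> complex. (snd p, fst p))" "norm (snd p, fst p) = norm (p :: complex \<times> complex)"
  by (auto intro!: linearI simp: norm_Pair norm_prod_def add.commute)

lemma rotate45_pair:
  shows "linear (\<lambda>p :: complex \<times> complex. ((fst p + snd p) / of_real (sqrt 2), (fst p - snd p) / of_real (sqrt 2)))"
    and "norm ((fst p + snd p) / of_real (sqrt 2), (fst p - snd p) / of_real (sqrt 2)) = norm (p :: complex \<times> complex)"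
proof -
  show "linear (\<lambda>p :: complex \<times> complex. ((fst p + snd p) / of_real (sqrt 2), (fst p - snd p) / of_real (sqrt 2)))"
    by (intro linearI) (auto simp: field_simps scaleR_conv_of_real)
  have "(cmod (fst p + snd p))\<^sup>2 + (cmod (fst p - snd p))\<^sup>2 = 2 * ((cmod (fst p))\<^sup>2 + (cmod (snd p))\<^sup>2)"
    by (simp only: cmod_power2) (simp add: power2_eq_square algebra_simps)
  thus "norm ((fst p + snd p) / of_real (sqrt 2), (fst p - snd p) / of_real (sqrt 2)) = norm p"
    by (simp add: norm_prod_def norm_divide power_divide add_divide_distrib[symmetric])
qed

text \<open>What is left of minus the averaged integrand after factoring out the modulus of the
  first Fourier coefficient: the gain of the symmetrized first mode less the bound for the tail. The
  common factor depends on z + u only, so positivity can be studied for fixed z + u.\<close>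

definition jfun :: "nat \<Rightarrow> complex \<times> complex \<Rightarrow> real" where
  "jfun k p = ww k p * (cmod (fst p + snd p) / 2 - cmod (fst p) * (ratio k p / (1 - ratio k p)))"

lemma ratio_measurable [measurable]: "ratio k \<in> borel_measurable borel"
proof -
  have [measurable]: "shrink \<in> borel_measurable borel"
    unfolding shrink_def by measurable
  have [measurable]: "(\<lambda>p. (cmod (cnj (fst p) ^ (k + 2) * snd p ^ (k + 1)))\<^sup>2) \<in> borel_measurable borel"
    by (intro borel_measurable_continuous_onI continuous_intros)
  show ?thesis unfolding ratio_def by measurable
qed

lemma jfun_measurable [measurable]: "jfun k \<in> borel_measurable borel"
  unfolding jfun_def by measurable

lemma ww_ratio_bound:
  assumes k: "0 < k"
  shows "ww k p * (ratio k p / (1 - ratio k p)) \<le> indicator (ball 0 1 \<times> ball 0 1) p \<and> 0 \<le> ww k p * (ratio k p / (1 - ratio k p))"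
proof (cases "cmod (fst p) < 1 \<and> cmod (snd p) < 1")
  case True
  define Q where "Q = (cmod (cnj (fst p) ^ (k + 2) * snd p ^ (k + 1)))\<^sup>2"
  have Q: "0 \<le> ratio k p" "ratio k p \<le> Q" "Q < 1"
    using True ratio_bounds[of p k] ratio_less_1(2)[of "fst p" "snd p" k] by (auto simp: Q_def norm_power)
  have "ratio k p / (1 - ratio k p) \<le> 1 / (1 - Q)"
    using Q by (intro frac_le) auto
  hence "ww k p * (ratio k p / (1 - ratio k p)) \<le> ww k p * (1 / (1 - Q))"
    by (intro mult_left_mono) auto
  also have "\<dots> \<le> 1" using weight_geometric_bound[OF k, of "fst p" "snd p"] True by (simp add: Q_def)
  finally show ?thesis using True Q by (simp add: indicator_def mem_Times_iff)
next
  case False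
  thus ?thesis using ww_outside[OF k False] by simp
qed

context
  fixes \<gamma> :: real and k :: nat
  assumes \<gamma>: "0 < \<gamma>" "\<gamma> < 1" and k: "0 < k"
begin

text \<open>Justifies exchanging the rotation average with the integral over the bidisc. Pulling out
  the phase turns 1 + e(t) \<sigma> into cnj (e(t)) + \<sigma>, to which the bound uniform in
  unimodular shifts applies.\<close>

lemma integrable_kap_triple:
  "integrable (lborel \<Otimes>\<^sub>M lborel) (\<lambda>(t, p). indicator {0..<1::real} t * (indicator (ball 0 1 \<times> ball 0 1) p * kap \<gamma> (1 + e t * (fst p + snd p))))"
    (is "integrable _ (\<lambda>(t, p). ?f t p)")
proof (rule integrableI_nonneg)
  have f_le: "ennreal (?f t p) \<le> indicator {0..<1} t * (indicator (ball 0 1 \<times> ball 0 1) p * ennreal (kap \<gamma> (cnj (e t) + (fst p + snd p))))" for t p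
  proof -
    have c: "cnj (e t) * e t = 1" using complex_norm_square[of "e t"] by (simp add: mult.commute)
    have "cnj (e t) * (1 + e t * (fst p + snd p)) = cnj (e t) + (cnj (e t) * e t) * (fst p + snd p)"
      by (simp only: distrib_left[of "cnj (e t)"] mult_1_right mult.assoc)
    hence "cnj (e t) + (fst p + snd p) = cnj (e t) * (1 + e t * (fst p + snd p))"
      by (simp only: c mult_1)
    hence "cmod (cnj (e t) + (fst p + snd p)) = cmod (1 + e t * (fst p + snd p))"
      by (simp add: norm_mult)
    thus ?thesis by (simp add: kap_def indicator_def)
  qed
  define M where "M = ennreal pi * (\<integral>\<^sup>+w. indicator (ball 0 3) w * ennreal (kap \<gamma> w) \<partial>lborel)"
  have M: "M < \<infinity>" unfolding M_def using nn_integral_kap_ball[OF \<gamma>(2)] by (simp add: ennreal_mult_less_top)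
  have "(\<integral>\<^sup>+x. ennreal (case x of (t, p) \<Rightarrow> ?f t p) \<partial>(lborel \<Otimes>\<^sub>M lborel)) = (\<integral>\<^sup>+t. \<integral>\<^sup>+p. ennreal (?f t p) \<partial>lborel \<partial>lborel)"
    by (subst lborel.nn_integral_fst[symmetric]) (auto simp: lborel_prod)
  also have "\<dots> \<le> (\<integral>\<^sup>+t. indicator {0..<1::real} t * M \<partial>lborel)"
  proof (rule nn_integral_mono)
    fix t :: real
    have "(\<integral>\<^sup>+p. ennreal (?f t p) \<partial>lborel)
        \<le> (\<integral>\<^sup>+p. indicator {0..<1} t * (indicator (ball 0 1 \<times> ball 0 1) p * ennreal (kap \<gamma> (cnj (e t) + (fst p + snd p)))) \<partial>lborel)"
      by (rule nn_integral_mono) (rule f_le)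
    also have "\<dots> = indicator {0..<1} t * (\<integral>\<^sup>+p. indicator (ball 0 1 \<times> ball 0 1) p * ennreal (kap \<gamma> (cnj (e t) + (fst p + snd p))) \<partial>lborel)"
      by (rule nn_integral_cmult) simp
    also have "\<dots> \<le> indicator {0..<1} t * M"
      unfolding M_def by (intro mult_left_mono nn_integral_kap_bidisc) auto
    finally show "(\<integral>\<^sup>+p. ennreal (?f t p) \<partial>lborel) \<le> indicator {0..<1} t * M" .
  qed
  also have "\<dots> = M" by (simp add: nn_integral_multc)
  finally show "(\<integral>\<^sup>+x. ennreal (case x of (t, p) \<Rightarrow> ?f t p) \<partial>(lborel \<Otimes>\<^sub>M lborel)) < \<infinity>"
    using M by (rule le_less_trans)
qed (auto simp: lborel_prod split: prod.splits intro!: AE_I2)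

lemma khat_measurable [measurable]: "khat \<gamma> l \<in> borel_measurable borel"
proof -
  have [measurable]: "kap \<gamma> \<in> borel_measurable borel" by (rule kap_measurable)
  show ?thesis unfolding khat_def set_lebesgue_integral_def by measurable
qed

text \<open>The modulus of a Fourier coefficient is at most the circle average of the kernel, and
  that average is integrable by Fubini.\<close>

lemma integrable_khat_bidisc:
  "integrable lborel (\<lambda>p. indicator (ball 0 1 \<times> ball 0 1) p * cmod (khat \<gamma> 1 (fst p + snd p)))"
proof (rule Bochner_Integration.integrable_bound)
  let ?F = "\<lambda>p. (LINT t|lborel. indicator {0..<1::real} t * (indicator (ball 0 1 \<times> ball 0 1) p * kap \<gamma> (1 + e t * (fst p + snd p))))"
  show "integrable lborel ?F"
    using lborel_pair.integrable_snd[OF integrable_kap_triple] .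
  show "AE p in lborel. norm (indicator (ball 0 1 \<times> ball 0 1) p * cmod (khat \<gamma> 1 (fst p + snd p))) \<le> norm (?F p)"
  proof (rule AE_I2)
    fix p :: "complex \<times> complex"
    show "norm (indicator (ball 0 1 \<times> ball 0 1) p * cmod (khat \<gamma> 1 (fst p + snd p))) \<le> norm (?F p)"
    proof (cases "p \<in> ball 0 1 \<times> ball 0 1")
      case True
      have "cmod (khat \<gamma> 1 (fst p + snd p)) \<le> (LINT t|lborel. norm (indicator {0..<1} t *\<^sub>R (of_real (kap \<gamma> (1 + e t * (fst p + snd p))) * e (- (real 1 * t)))))"
        unfolding khat_def set_lebesgue_integral_def by (rule integral_norm_bound)
      also have "\<dots> = (LINT t|lborel. indicator {0..<1::real} t * kap \<gamma> (1 + e t * (fst p + snd p)))"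
        by (simp add: norm_mult)
      finally show ?thesis using True by simp
    qed simp
  qed
qed measurable

text \<open>Simultaneous rotation of z and u changes neither the measure nor the weight, so the
  integral equals its mean over rotations and Fubini brings the mean inside. Only the tail is
  estimated; the first mode is evaluated exactly after symmetrizing.\<close>

lemma integral_ww_kern_kap_le:
  "(LINT p|lborel. ww k p * kap \<gamma> (1 + (fst p + snd p)) * Re (kern k (fst p) (snd p)))
    \<le> - (LINT p|lborel. cmod (khat \<gamma> 1 (fst p + snd p)) * jfun k p)"
  and integrable_khat_jfun: "integrable lborel (\<lambda>p. cmod (khat \<gamma> 1 (fst p + snd p)) * jfun k p)"
proof -
  let ?D = "indicator (ball 0 1 \<times> ball 0 1) :: complex \<times> complex \<Rightarrow> real"
  define G where "G t p = ww k p * kap \<gamma> (1 + e t * (fst p + snd p)) * Re (kern k (e t * fst p) (e t * snd p))" for t p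
  define T where "T = (LINT p|lborel. ww k p * kap \<gamma> (1 + (fst p + snd p)) * Re (kern k (fst p) (snd p)))"
  define A where "A p = cmod (khat \<gamma> 1 (fst p + snd p))" for p
  have [measurable]: "A \<in> borel_measurable borel" unfolding A_def by measurable
  have G_T: "(LINT p|lborel. G t p) = T" for t
  proof -
    have "(LINT p|lborel. G t p) = (LINT p|lborel. (\<lambda>p. ww k p * kap \<gamma> (1 + (fst p + snd p)) * Re (kern k (fst p) (snd p))) (e t * fst p, e t * snd p))"
      by (simp add: G_def ww_def weight_mult distrib_left)
    also have "\<dots> = T" unfolding T_def
      by (rule integral_isometry_pair[OF rotate_pair]) auto
    finally show ?thesis .
  qed
  have G_bound: "\<bar>G t p\<bar> \<le> ?D p * kap \<gamma> (1 + e t * (fst p + snd p))" for t p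
  proof -
    have ww: "ww k p = ww k (e t * fst p, e t * snd p)" by (simp add: ww_def weight_mult)
    have "ww k p * \<bar>Re (kern k (e t * fst p) (e t * snd p))\<bar> \<le> ww k p * cmod (kern k (e t * fst p) (e t * snd p))"
      by (intro mult_left_mono abs_Re_le_cmod) simp
    also have "\<dots> \<le> ?D (e t * fst p, e t * snd p)"
      using ww_kern_bound[OF k, of "(e t * fst p, e t * snd p)"] by (simp add: ww)
    also have "\<dots> = ?D p" by (simp add: indicator_def mem_Times_iff norm_mult)
    finally have "kap \<gamma> (1 + e t * (fst p + snd p)) * (ww k p * \<bar>Re (kern k (e t * fst p) (e t * snd p))\<bar>)
        \<le> kap \<gamma> (1 + e t * (fst p + snd p)) * ?D p"
      by (intro mult_left_mono) auto
    thus ?thesis by (simp add: G_def abs_mult mult_ac)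
  qed
  have intG: "integrable (lborel \<Otimes>\<^sub>M lborel) (\<lambda>(t, p). indicator {0..<1} t * G t p)"
  proof (rule Bochner_Integration.integrable_bound[OF integrable_kap_triple])
    show "(\<lambda>(t, p). indicator {0..<1} t * G t p) \<in> borel_measurable (lborel \<Otimes>\<^sub>M lborel)"
      unfolding G_def lborel_prod case_prod_unfold by measurable
    show "AE x in lborel \<Otimes>\<^sub>M lborel. norm (case x of (t, p) \<Rightarrow> indicator {0..<1} t * G t p)
        \<le> norm (case x of (t, p) \<Rightarrow> indicator {0..<1} t * (?D p * kap \<gamma> (1 + e t * (fst p + snd p))))"
    proof (rule AE_I2)
      fix x :: "real \<times> (complex \<times> complex)"
      obtain t p where x: "x = (t, p)" by (cases x)
      have "indicator {0..<1} t * \<bar>G t p\<bar> \<le> indicator {0..<1} t * (?D p * kap \<gamma> (1 + e t * (fst p + snd p)))"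
        by (intro mult_left_mono G_bound) simp
      thus "norm (case x of (t, p) \<Rightarrow> indicator {0..<1} t * G t p)
        \<le> norm (case x of (t, p) \<Rightarrow> indicator {0..<1} t * (?D p * kap \<gamma> (1 + e t * (fst p + snd p))))"
        by (simp add: x abs_mult)
    qed
  qed
  define I where "I p = (LINT t|lborel. indicator {0..<1} t * G t p)" for p
  have intI: "integrable lborel I" unfolding I_def
    using lborel_pair.integrable_snd[OF intG] .
  have T_I: "T = (LINT p|lborel. I p)"
  proof -
    have "(LINT p|lborel. I p) = (LINT t|lborel. LINT p|lborel. indicator {0..<1::real} t * G t p)"
      unfolding I_def using lborel_pair.Fubini_integral[OF intG] .
    also have "\<dots> = (LINT t|lborel. indicator {0..<1::real} t * T)" by (simp add: G_T)
    also have "\<dots> = T" by simp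
    finally show ?thesis ..
  qed
  note rb = ww_ratio_bound[OF k]
  have intA: "integrable lborel (\<lambda>p. ?D p * A p)" unfolding A_def by (rule integrable_khat_bidisc)
  have dom: "integrable lborel f" if [measurable]: "f \<in> borel_measurable borel" and "\<And>p. \<bar>f p\<bar> \<le> ?D p * A p" for f
    by (rule Bochner_Integration.integrable_bound[OF intA]) (use that in \<open>auto intro!: AE_I2 simp: A_def indicator_def\<close>)
  have z1: "ww k p * (cmod (fst p) * A p) \<le> ?D p * A p" "ww k p * (cmod (snd p) * A p) \<le> ?D p * A p" for p
  proof -
    have "A p * (ww k p * c) \<le> A p * ?D p" if "0 \<le> c" "c \<le> 1 \<or> p \<notin> ball 0 1 \<times> ball 0 1" for c
    proof (rule mult_left_mono)
      show "ww k p * c \<le> ?D p"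
        using that mult_mono[OF ww_le_1[of k p], of c 1] ww_outside[OF k, of p]
        by (cases "p \<in> ball 0 1 \<times> ball 0 1") (auto simp: mem_Times_iff)
    qed (simp add: A_def)
    note le = this
    have c: "cmod (fst p) \<le> 1 \<or> p \<notin> ball 0 1 \<times> ball 0 1" "cmod (snd p) \<le> 1 \<or> p \<notin> ball 0 1 \<times> ball 0 1"
      by (auto simp: mem_Times_iff)
    show "ww k p * (cmod (fst p) * A p) \<le> ?D p * A p" "ww k p * (cmod (snd p) * A p) \<le> ?D p * A p"
      using le[OF norm_ge_zero c(1)] le[OF norm_ge_zero c(2)] by (simp_all only: mult_ac)
  qed
  define f1 where "f1 p = ww k p * Re (cnj (fst p) * khat \<gamma> 1 (fst p + snd p))" for p
  define f2 where "f2 p = ww k p * Re (cnj (snd p) * khat \<gamma> 1 (fst p + snd p))" for p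
  define f3 where "f3 p = A p * (cmod (fst p) * (ww k p * (ratio k p / (1 - ratio k p))))" for p
  have [measurable]: "f1 \<in> borel_measurable borel" "f2 \<in> borel_measurable borel" "f3 \<in> borel_measurable borel"
    unfolding f1_def f2_def f3_def by measurable
  have i1: "integrable lborel f1"
  proof (rule dom)
    fix p
    have "\<bar>f1 p\<bar> \<le> ww k p * (cmod (fst p) * A p)"
      unfolding f1_def abs_mult abs_of_nonneg[OF ww_nonneg]
      by (intro mult_left_mono order_trans[OF abs_Re_le_cmod]) (auto simp: norm_mult A_def)
    thus "\<bar>f1 p\<bar> \<le> ?D p * A p" using z1(1)[of p] by linarith
  qed simp
  have i2: "integrable lborel f2"
  proof (rule dom)
    fix p
    have "\<bar>f2 p\<bar> \<le> ww k p * (cmod (snd p) * A p)"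
      unfolding f2_def abs_mult abs_of_nonneg[OF ww_nonneg]
      by (intro mult_left_mono order_trans[OF abs_Re_le_cmod]) (auto simp: norm_mult A_def)
    thus "\<bar>f2 p\<bar> \<le> ?D p * A p" using z1(2)[of p] by linarith
  qed simp
  have i3: "integrable lborel f3"
  proof (rule dom)
    fix p
    have "cmod (fst p) * (ww k p * (ratio k p / (1 - ratio k p))) \<le> ?D p"
    proof (cases "p \<in> ball 0 1 \<times> ball 0 1")
      case True
      thus ?thesis using rb[of p] mult_mono[of "cmod (fst p)" 1 "ww k p * (ratio k p / (1 - ratio k p))" 1]
        by (auto simp: mem_Times_iff)
    next
      case False
      hence "ww k p = 0" by (intro ww_outside k) (auto simp: mem_Times_iff)
      thus ?thesis by simp
    qed
    moreover have "0 \<le> cmod (fst p) * (ww k p * (ratio k p / (1 - ratio k p)))"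
      by (rule mult_nonneg_nonneg[OF norm_ge_zero conjunct2[OF rb]])
    moreover have A0: "0 \<le> A p" by (simp add: A_def)
    ultimately show "\<bar>f3 p\<bar> \<le> ?D p * A p"
      unfolding f3_def abs_of_nonneg[OF mult_nonneg_nonneg[OF A0 \<open>0 \<le> cmod (fst p) * _\<close>]] mult.commute[of "?D p"]
      by (intro mult_left_mono)
  qed simp
  \<comment> \<open>The weight and z + u are symmetric in z and u, so cnj z in the first mode may be
    traded for (cnj z + cnj u) / 2.\<close>
  have swap: "(LINT p|lborel. f2 p) = (LINT p|lborel. f1 p)"
    using integral_isometry_pair[OF swap_pair, of f1] by (simp add: f1_def f2_def ww_def add.commute mult.commute)
  have ae: "AE p in lborel. I p \<le> f1 p + f3 p"
    using AE_sum_generic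
  proof eventually_elim
    case (elim p)
    show ?case
    proof (cases "cmod (fst p) < 1 \<and> cmod (snd p) < 1")
      case True
      define g where "g t = of_real (kap \<gamma> (1 + e t * (fst p + snd p))) * kern k (e t * fst p) (e t * snd p)" for t
      have cont: "continuous_on UNIV g"
      proof -
        have "1 - e (- (2 * t)) * (cnj (fst p) ^ (k + 2) * snd p ^ (k + 1))\<^sup>2 \<noteq> 0" for t
        proof
          assume "1 - e (- (2 * t)) * (cnj (fst p) ^ (k + 2) * snd p ^ (k + 1))\<^sup>2 = 0"
          hence "cmod (e (- (2 * t)) * (cnj (fst p) ^ (k + 2) * snd p ^ (k + 1))\<^sup>2) = 1"
            by (metis eq_iff_diff_eq_0 norm_one)
          thus False using ratio_less_1(2)[of "fst p" "snd p" k] True by (simp add: norm_mult)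
        qed
        thus ?thesis unfolding g_def kern_rotate
          using elim by (intro continuous_on_mult continuous_on_kap_circle continuous_on_divide continuous_intros) auto
      qed
      have "I p = (LINT t|lborel. ww k p * Re (indicator {0..<1} t *\<^sub>R g t))"
        unfolding I_def by (intro Bochner_Integration.integral_cong) (auto simp: G_def g_def)
      also have "\<dots> = ww k p * Re (LINT t:{0..<1}|lborel. g t)"
        using integral_Re[of lborel "\<lambda>t. indicator {0..<1} t *\<^sub>R g t"] set_integrable_Ico_continuous[OF cont]
        by (simp add: set_lebesgue_integral_def set_integrable_def)
      also have "\<dots> \<le> ww k p * (Re (cnj (fst p) * khat \<gamma> 1 (fst p + snd p)) + cmod (fst p) * cmod (khat \<gamma> 1 (fst p + snd p)) * (ratio k (fst p, snd p) / (1 - ratio k (fst p, snd p))))"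
        unfolding g_def using True elim by (intro mult_left_mono Re_rotated_kern_le \<gamma>) auto
      also have "\<dots> = f1 p + f3 p" by (simp add: f1_def f3_def A_def distrib_left mult_ac)
      finally show ?thesis .
    next
      case False
      hence "ww k p = 0" by (rule ww_outside[OF k])
      thus ?thesis by (simp add: I_def G_def f1_def f3_def)
    qed
  qed
  have i4: "integrable lborel (\<lambda>p. (f1 p + f2 p) / 2 + f3 p)" using i1 i2 i3 by simp
  \<comment> \<open>The symmetrized first mode contains cnj \<sigma> for \<sigma> = z + u, and
    \<open>Re_khat\<close> is an equality, so nothing is lost in the main term.\<close>
  have ae2: "AE p in lborel. (f1 p + f2 p) / 2 + f3 p = - (A p * jfun k p)"
    using AE_sum_generic
  proof eventually_elim
    case (elim p)
    have "f1 p + f2 p = ww k p * Re (cnj (fst p + snd p) * khat \<gamma> 1 (fst p + snd p))"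
      by (simp add: f1_def f2_def algebra_simps)
    also have "\<dots> = - (ww k p * (cmod (fst p + snd p) * A p))"
      using elim by (subst Re_khat[OF \<gamma>]) (auto simp: A_def)
    finally show ?case by (simp add: f3_def jfun_def algebra_simps)
  qed
  have i5: "integrable lborel (\<lambda>p. - (A p * jfun k p))"
    using i4 ae2 by (subst integrable_cong_AE[of _ _ "\<lambda>p. (f1 p + f2 p) / 2 + f3 p"]) (auto elim: AE_mp)
  thus "integrable lborel (\<lambda>p. cmod (khat \<gamma> 1 (fst p + snd p)) * jfun k p)"
    by (simp add: A_def)
  have "T \<le> (LINT p|lborel. f1 p + f3 p)"
    unfolding T_I using intI i1 i3 ae by (intro integral_mono_AE) auto
  also have "\<dots> = (LINT p|lborel. (f1 p + f2 p) / 2 + f3 p)"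
    using i1 i2 i3 swap by simp
  also have "\<dots> = (LINT p|lborel. - (A p * jfun k p))"
    using ae2 by (intro integral_cong_AE) auto
  finally show "(LINT p|lborel. ww k p * kap \<gamma> (1 + (fst p + snd p)) * Re (kern k (fst p) (snd p)))
    \<le> - (LINT p|lborel. cmod (khat \<gamma> 1 (fst p + snd p)) * jfun k p)"
    by (simp add: T_def A_def)
qed

end

section \<open>Positivity of the lens integral\<close>

text \<open>34 lies just below the minimum of (1 - r^4) / ((1 - r)^2 r^4), which is about 34.5 and
  attained near r = 0.74. After cancelling 1 - r, the remaining quintic is a square vanishing at
  37/50 times a positive cubic, plus a linear term that is positive on [0, 1].\<close>

lemma quintic_bound:
  fixes r :: real
  assumes "0 \<le> r" "r \<le> 1"
  shows "34 * (1 - r)\<^sup>2 * r ^ 4 \<le> 1 - r ^ 4"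
proof -
  have "0 \<le> (r - 37 / 50)\<^sup>2 * (34 * r ^ 3 + 408 / 25 * r\<^sup>2 + 8169 / 1250 * r + 54227 / 31250)"
    using assms by (intro mult_nonneg_nonneg add_nonneg_nonneg) auto
  also have "\<dots> = 1 + r + r\<^sup>2 + r ^ 3 - 34 * r ^ 4 * (1 - r) - (3888237 / 78125000 - 6553 / 625000 * r)"
    by (simp add: power2_eq_square power3_eq_cube power4_eq_xxxx algebra_simps)
  also have "\<dots> \<le> 1 + r + r\<^sup>2 + r ^ 3 - 34 * r ^ 4 * (1 - r)"
    using assms by simp
  finally have "0 \<le> (1 - r) * (1 + r + r\<^sup>2 + r ^ 3 - 34 * r ^ 4 * (1 - r))"
    using assms by (intro mult_nonneg_nonneg) auto
  also have "\<dots> = 1 - r ^ 4 - 34 * (1 - r)\<^sup>2 * r ^ 4"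
    by (simp add: power2_eq_square power3_eq_cube power4_eq_xxxx algebra_simps)
  finally show ?thesis by simp
qed

text \<open>If f at t b is at least (1 - t^2)^(2k) for all b in L, the superlevel set at height (1 -
  t^2)^(2k) contains t L, of area t^2 m. Integrating 1 - y^(1/(2k)) over the heights y gives 1 / (2k
  + 1). This bounds the mean weight without knowing the shape of the lens.\<close>

lemma layer_cake_scaling:
  fixes f :: "complex \<Rightarrow> real"
  assumes k: "0 < k" and [measurable]: "f \<in> borel_measurable borel" "L \<in> sets borel"
    and fin: "emeasure lborel L = ennreal m" "0 \<le> m"
    and f: "\<And>b. b \<in> L \<Longrightarrow> 0 \<le> f b \<and> f b \<le> 1"
    and scale: "\<And>t b. 0 < t \<Longrightarrow> t < 1 \<Longrightarrow> b \<in> L \<Longrightarrow> t *\<^sub>R b \<in> L \<and> (1 - t\<^sup>2) ^ (2 * k) \<le> f (t *\<^sub>R b)"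
  shows "ennreal (m / (2 * real k + 1)) \<le> (\<integral>\<^sup>+b. indicator L b * ennreal (f b) \<partial>lborel)"
proof -
  define r where "r y = y powr (1 / (2 * real k))" for y :: real
  have [measurable]: "r \<in> borel_measurable borel" unfolding r_def by measurable
  have r: "0 < r y" "r y < 1" "r y ^ (2 * k) = y" if "0 < y" "y < 1" for y
  proof -
    show "0 < r y" using that by (simp add: r_def)
    show "r y < 1" using that k powr_less_mono2[of "1 / (2 * real k)" y 1] by (simp add: r_def)
    show "r y ^ (2 * k) = y"
      using that k by (subst powr_realpow[symmetric]) (auto simp: r_def powr_powr)
  qed
  have "(\<integral>\<^sup>+y. ennreal (indicator {0..1} y * (1 - r y)) \<partial>lborel) = ennreal (1 / (2 * real k + 1))"
  proof -
    have "((\<lambda>y. y powr (1 / (2 * real k))) has_integral (1 powr (1 / (2 * real k) + 1) / (1 / (2 * real k) + 1))) {0..1}"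
      by (rule has_integral_powr_from_0) (use k in \<open>auto intro: less_le_trans[of _ 0]\<close>)
    hence "((\<lambda>y. 1 - r y) has_integral (1 - 1 / (1 / (2 * real k) + 1))) {0..1}"
      unfolding r_def using has_integral_diff[OF has_integral_const_real[of "1::real" 0 1]] by simp
    moreover have "1 - 1 / (1 / (2 * real k) + 1) = 1 / (2 * real k + 1)" using k by (simp add: field_simps)
    ultimately have hi: "((\<lambda>y. 1 - r y) has_integral (1 / (2 * real k + 1))) {0..1}" by simp
    have "0 \<le> 1 - r y" if "y \<in> {0..1}" for y
      using that powr_mono2[of "1 / (2 * real k)" y 1] by (auto simp: r_def)
    from nn_integral_has_integral_lebesgue[OF this hi] show ?thesis by simp
  qed
  hence "ennreal (m / (2 * real k + 1)) = (\<integral>\<^sup>+y. ennreal (indicator {0..1} y * (1 - r y)) \<partial>lborel) * ennreal m"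
    using fin(2) by (simp add: ennreal_mult[symmetric])
  also have "\<dots> = (\<integral>\<^sup>+y. ennreal (indicator {0..1} y * (1 - r y)) * ennreal m \<partial>lborel)"
    by (simp add: nn_integral_multc)
  also have "\<dots> \<le> (\<integral>\<^sup>+y. (\<integral>\<^sup>+b. indicator L b * (indicator {0<..f b} y) \<partial>lborel) \<partial>lborel)"
  proof (rule nn_integral_mono_AE)
    have "AE y in lborel. y \<noteq> (0::real)" "AE y in lborel. y \<noteq> (1::real)" by (rule AE_lborel_singleton)+
    thus "AE y in lborel. ennreal (indicator {0..1} y * (1 - r y)) * ennreal m
        \<le> (\<integral>\<^sup>+b. indicator L b * (indicator {0<..f b} y) \<partial>lborel)"
    proof eventually_elim
      case (elim y)
      show ?case
      proof (cases "0 < y \<and> y < 1")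
        case True
        \<comment> \<open>The scale at which (1 - t^2)^(2k) equals the height y.\<close>
        define t where "t = sqrt (1 - r y)"
        have t: "0 < t" "t < 1" "t\<^sup>2 = 1 - r y" using True r[of y] by (auto simp: t_def)
        define S where "S = {b \<in> L. y \<le> f b}"
        have [measurable]: "S \<in> sets borel" unfolding S_def by measurable
        have "L \<subseteq> (\<lambda>b. 0 + t *\<^sub>R b) -` S"
          using scale[OF t(1,2)] t(3) r(3)[of y] True by (auto simp: S_def)
        hence "emeasure lborel L \<le> emeasure lborel ((\<lambda>b. 0 + t *\<^sub>R b) -` S \<inter> space lborel)"
          by (intro emeasure_mono measurable_sets[of _ lborel borel]) auto
        also have "\<dots> = emeasure (distr lborel borel (\<lambda>b. 0 + t *\<^sub>R b)) S"
          by (rule emeasure_distr[symmetric]) auto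
        finally have "emeasure lborel L \<le> emeasure (distr lborel borel (\<lambda>b. 0 + t *\<^sub>R b)) S" .
        hence "ennreal (t\<^sup>2) * emeasure lborel L \<le> ennreal (t\<^sup>2) * emeasure (distr lborel borel (\<lambda>b. 0 + t *\<^sub>R b)) S"
          by (rule mult_left_mono) simp
        also have "\<dots> = emeasure (density (distr lborel borel (\<lambda>b::complex. 0 + t *\<^sub>R b)) (\<lambda>_. ennreal (\<bar>t\<bar> ^ DIM(complex)))) S"
          by (subst emeasure_density) (auto simp: nn_integral_cmult_indicator)
        also have "\<dots> = emeasure lborel S"
          using lborel_affine[of t "0::complex"] t by simp
        also have "\<dots> = (\<integral>\<^sup>+b. indicator S b \<partial>lborel)" by simp
        also have "\<dots> = (\<integral>\<^sup>+b. indicator L b * (indicator {0<..f b} y) \<partial>lborel)"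
          using True by (intro nn_integral_cong) (auto simp: S_def indicator_def)
        finally show ?thesis using True t fin by (simp add: ennreal_mult[symmetric])
      next
        case False
        thus ?thesis using elim by auto
      qed
    qed
  qed
  also have "\<dots> = (\<integral>\<^sup>+b. (\<integral>\<^sup>+y. indicator L b * (indicator {0<..f b} y) \<partial>lborel) \<partial>lborel)"
    by (rule lborel_pair.Fubini') (simp add: indicator_def[abs_def] lborel_prod)
  also have "\<dots> = (\<integral>\<^sup>+b. indicator L b * ennreal (f b) \<partial>lborel)"
  proof (rule nn_integral_cong)
    fix b
    show "(\<integral>\<^sup>+y. indicator L b * (indicator {0<..f b} y) \<partial>lborel) = indicator L b * ennreal (f b)"
      using f[of b] by (cases "b \<in> L") (auto simp: nn_integral_cmult)
  qed
  finally show ?thesis .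
qed

text \<open>With r^2 = A B, AM-GM gives (1 - A)(1 - B) <= (1 - r)^2. One factor of the weight is
  spent on the quintic estimate, giving 1/34. Each of the other k - 1 factors is paired with one A B
  and is at most 1/16, since x (1 - x) <= 1/4.\<close>

lemma weight_ratio_small:
  fixes A B :: real
  assumes "0 \<le> A" "A < 1" "0 \<le> B" "B < 1" and k: "0 < k"
  shows "((1 - A) * (1 - B)) ^ k * (A ^ (k + 2) * B ^ (k + 1) / (1 - A ^ (k + 2) * B ^ (k + 1))) \<le> (1 / 16) ^ (k - 1) / 34"
proof -
  obtain m where m: "k = Suc m" using k not0_implies_Suc by auto
  define X where "X = A ^ (k + 2) * B ^ (k + 1)"
  define s where "s = A * B"
  define r where "r = sqrt s"
  have s: "0 \<le> s" "s < 1" using assms mult_strict_mono[of A 1 B 1] by (auto simp: s_def)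
  have r: "0 \<le> r" "r \<le> 1" "r\<^sup>2 = s" using s by (auto simp: r_def real_sqrt_le_1_iff)
  have "r ^ 4 = (r\<^sup>2)\<^sup>2" by (simp flip: power_mult)
  hence r4: "r ^ 4 = s\<^sup>2" by (simp only: r(3))
  have Xs: "X = s ^ m * (A ^ 3 * B\<^sup>2)" by (simp add: X_def s_def m power_mult_distrib power2_eq_square power3_eq_cube algebra_simps)
  have AB: "A ^ 3 * B\<^sup>2 \<le> s\<^sup>2"
  proof -
    have "A ^ 3 \<le> A\<^sup>2" using assms by (intro power_decreasing) auto
    thus ?thesis using assms by (simp add: s_def power_mult_distrib mult_right_mono)
  qed
  have "s ^ m * (A ^ 3 * B\<^sup>2) \<le> 1 * s\<^sup>2"
    using s AB assms by (intro mult_mono power_le_one) auto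
  hence Xs2: "X \<le> s\<^sup>2" by (simp add: Xs)
  have s2: "s\<^sup>2 < 1" using s by (simp add: abs_square_less_1)
  define v where "v = (1 - A) * (1 - B)"
  have v0: "0 \<le> v" using assms by (simp add: v_def)
  have vr: "v \<le> (1 - r)\<^sup>2"
  proof -
    have "0 \<le> (sqrt A - sqrt B)\<^sup>2" by simp
    also have "\<dots> = A + B - 2 * r" using assms by (simp add: power2_eq_square algebra_simps r_def s_def real_sqrt_mult)
    finally show ?thesis using r(3) by (simp add: v_def s_def power2_eq_square algebra_simps)
  qed
  have quarter: "x * (1 - x) \<le> 1 / 4" for x :: real
    using zero_le_power2[of "x - 1 / 2"] by (simp add: power2_eq_square algebra_simps)
  have "v * s = (A * (1 - A)) * (B * (1 - B))" by (simp add: v_def s_def)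
  also have "\<dots> \<le> (1 / 4) * (1 / 4)" using assms by (intro mult_mono quarter) auto
  finally have vs: "(v * s) ^ m \<le> (1 / 16) ^ m" using v0 s by (intro power_mono) auto
  have "v * s\<^sup>2 * 34 \<le> (1 - r)\<^sup>2 * s\<^sup>2 * 34" using vr by (intro mult_right_mono) auto
  also have "\<dots> \<le> 1 - s\<^sup>2" using quintic_bound[OF r(1,2)] by (simp add: r4 mult_ac)
  finally have v34: "v * s\<^sup>2 / (1 - s\<^sup>2) \<le> 1 / 34" using s2 by (simp add: field_simps)
  have "v ^ k * (X / (1 - X)) = (v * s) ^ m * (v * (A ^ 3 * B\<^sup>2) / (1 - X))"
    by (simp add: Xs[symmetric] m power_mult_distrib)
  also have "\<dots> \<le> (1 / 16) ^ m * (v * s\<^sup>2 / (1 - s\<^sup>2))"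
    using vs v0 s AB Xs2 s2 assms by (intro mult_mono frac_le mult_left_mono) (auto intro!: divide_nonneg_nonneg)
  also have "\<dots> \<le> (1 / 16) ^ m * (1 / 34)" using v34 by (intro mult_left_mono) auto
  finally show ?thesis by (simp add: v_def X_def m)
qed

text \<open>This makes the bound for the mean weight beat twice the maximum of weight times tail;
  \<open>c\<close> will be the square of the lens parameter. In the form 16 (2k + 1) < 17 (16 c)^k
  the critical case is k = 1, where 16 c must exceed 48/17, about 2.8235; hence 2.83.\<close>

lemma lens_constant_bound:
  assumes "2.83 \<le> 16 * (c::real)" "0 < k"
  shows "2 * (2 * real k + 1) * ((1 / 16) ^ (k - 1) / 34) < c ^ k"
proof -
  obtain m where m: "k = Suc m" using assms not0_implies_Suc by auto
  have "16 * (2 * real (Suc m) + 1) < 17 * 2.83 ^ Suc m"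
  proof (induction m)
    case (Suc m)
    have "16 * (2 * real (Suc (Suc m)) + 1) \<le> 2.83 * (16 * (2 * real (Suc m) + 1))" by simp
    also have "\<dots> < 2.83 * (17 * 2.83 ^ Suc m)" by (intro mult_strict_left_mono Suc) simp
    finally show ?case by simp
  qed simp
  also have "17 * 2.83 ^ Suc m \<le> 17 * (16 * c) ^ Suc m"
    using assms by (intro mult_left_mono power_mono) auto
  also have "\<dots> = 17 * 16 * 16 ^ m * c ^ Suc m" by (simp add: power_mult_distrib)
  finally have "2 * real (Suc m) + 1 < 17 * 16 ^ m * c ^ Suc m" by simp
  hence "(2 * real k + 1) / (17 * 16 ^ m) < c ^ k"
    unfolding m by (subst pos_divide_less_eq) (auto simp: mult_ac)
  thus ?thesis by (simp add: m power_one_over field_simps)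
qed

lemma measure_open_pos:
  fixes L :: "complex set"
  assumes "open L" "x \<in> L" "L \<subseteq> ball 0 r"
  shows "0 < measure lborel L" "emeasure lborel L = ennreal (measure lborel L)"
proof -
  have "emeasure lborel L \<le> emeasure lborel (ball (0::complex) r)"
    using assms by (intro emeasure_mono) auto
  hence fin: "emeasure lborel L < \<infinity>"
    using emeasure_lborel_ball_finite[of "0::complex" r] by (rule le_less_trans)
  thus eq: "emeasure lborel L = ennreal (measure lborel L)"
    by (intro emeasure_eq_ennreal_measure) auto
  obtain d where d: "0 < d" "ball x d \<subseteq> L" using assms(1,2) openE by blast
  have "0 < measure lborel (ball x d)" using content_ball_pos[OF d(1)] by simp
  also have "\<dots> \<le> measure lborel L"
    using d fin assms(1) by (intro measure_mono_fmeasurable) (auto simp: fmeasurable_def)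
  finally show "0 < measure lborel L" .
qed

text \<open>An orthogonal involution: in the coordinates (a, b) the pair is z = (a + b) / sqrt 2, u
  = (a - b) / sqrt 2, so fixing a fixes z + u, and Fubini separates the Fourier coefficient from the
  lens integral over b.\<close>

definition rot45 :: "complex \<times> complex \<Rightarrow> complex \<times> complex" where
  "rot45 p = ((fst p + snd p) / of_real (sqrt 2), (fst p - snd p) / of_real (sqrt 2))"

lemma rot45_measurable [measurable]: "rot45 \<in> borel_measurable borel"
  unfolding rot45_def by (intro borel_measurable_continuous_onI continuous_intros) auto

lemma fst_add_snd_rot45: "fst (rot45 p) + snd (rot45 p) = of_real (sqrt 2) * fst p"
proof -
  have "fst (rot45 p) + snd (rot45 p) = (2 / of_real (sqrt 2)) * fst p"
    by (simp add: rot45_def add_divide_distrib[symmetric])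
  also have "(2 / of_real (sqrt 2)) = complex_of_real (2 / sqrt 2)" by simp
  also have "2 / sqrt 2 = sqrt 2" by (simp add: real_div_sqrt)
  finally show ?thesis .
qed

lemma cmod_rot45:
  "(cmod (fst (rot45 (a, b))))\<^sup>2 = (cmod a)\<^sup>2 / 2 + (cmod b)\<^sup>2 / 2 + Re (cnj a * b)"
  "(cmod (snd (rot45 (a, b))))\<^sup>2 = (cmod a)\<^sup>2 / 2 + (cmod b)\<^sup>2 / 2 - Re (cnj a * b)"
  unfolding rot45_def fst_conv snd_conv norm_divide power_divide
  by (simp_all only: cmod_power2) (simp_all add: power2_eq_square algebra_simps add_divide_distrib diff_divide_distrib)

text \<open>Two regimes in \<rho> = |z + u|. If \<rho> is large, inversion makes the modes decay
  fast enough for a pointwise bound. Otherwise the lens is wide, and the mean of the weight, at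
  least c^(2k) / (2k + 1), outweighs the uniform bound for weight times tail.\<close>

lemma lens_integral_pos:
  assumes k: "0 < k" and a: "0 < cmod a" "cmod a < sqrt 2"
  shows "0 < (LINT b|lborel. jfun k (rot45 (a, b)))"
proof -
  define z u where "z b = fst (rot45 (a, b))" and "u b = snd (rot45 (a, b))" for b
  define A B where "A b = (cmod (z b))\<^sup>2" and "B b = (cmod (u b))\<^sup>2" for b
  define L where "L = {b. cmod (z b) < 1 \<and> cmod (u b) < 1}"
  define h where "h = (cmod a)\<^sup>2 / 2"
  define c where "c = 1 - h"
  define \<rho> where "\<rho> = sqrt 2 * cmod a"
  have "(cmod a)\<^sup>2 < (sqrt 2)\<^sup>2" using a by (intro power_strict_mono) auto
  hence c: "0 < c" by (simp add: c_def h_def)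
  have \<rho>0: "0 < \<rho>" using a by (simp add: \<rho>_def)
  define \<eta> \<beta> where "\<eta> b = (cmod b)\<^sup>2 / 2" and "\<beta> b = Re (cnj a * b)" for b
  have AB: "A b = h + \<eta> b + \<beta> b" "B b = h + \<eta> b - \<beta> b" for b
    unfolding A_def B_def z_def u_def cmod_rot45 h_def \<eta>_def \<beta>_def by simp_all
  have L_iff: "b \<in> L \<longleftrightarrow> A b < 1 \<and> B b < 1" for b
    by (simp add: L_def A_def B_def abs_square_less_1)
  \<comment> \<open>The larger of |z|^2 and |u|^2 is h + \<eta> + |\<beta>|.\<close>
  have L_iff2: "b \<in> L \<longleftrightarrow> \<eta> b + \<bar>\<beta> b\<bar> < c" for b
    unfolding L_iff AB c_def by (auto simp: abs_if)
  have \<eta>0: "0 \<le> \<eta> b" for b by (simp add: \<eta>_def)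
  have cont: "continuous_on UNIV z" "continuous_on UNIV u"
    unfolding z_def u_def rot45_def by (auto intro!: continuous_intros)
  have [measurable]: "z \<in> borel_measurable borel" "u \<in> borel_measurable borel"
    using cont by (auto intro: borel_measurable_continuous_onI)
  have "L = {b. cmod (z b) < 1} \<inter> {b. cmod (u b) < 1}" by (auto simp: L_def)
  moreover have "open {b. cmod (z b) < 1}" "open {b. cmod (u b) < 1}"
    using cont by (auto intro!: open_Collect_less continuous_intros)
  ultimately have opL: "open L" by auto
  have L0: "0 \<in> L" using c by (simp add: L_iff2 \<eta>_def \<beta>_def)
  have "L \<subseteq> ball 0 2"
  proof
    fix b assume "b \<in> L"
    hence "\<eta> b + \<bar>\<beta> b\<bar> < 1 - (cmod a)\<^sup>2 / 2" by (simp only: L_iff2 c_def h_def)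
    moreover have "0 \<le> (cmod a)\<^sup>2" by simp
    ultimately have "\<eta> b < 1" by linarith
    hence "(cmod b)\<^sup>2 < 2\<^sup>2" by (simp add: \<eta>_def)
    thus "b \<in> ball 0 2" using power_less_imp_less_base[of "cmod b" 2 2] by simp
  qed
  define m where "m = measure lborel L"
  have m: "0 < m" "emeasure lborel L = ennreal m"
    using measure_open_pos[OF opL L0 \<open>L \<subseteq> ball 0 2\<close>] by (auto simp: m_def)
  have [measurable]: "L \<in> sets borel" using opL by simp
  have indL: "integrable lborel (indicator L :: complex \<Rightarrow> real)"
    using m by (intro integrable_real_indicator) auto
  define v where "v b = (1 - A b) * (1 - B b)" for b
  have v: "v b = (c - \<eta> b)\<^sup>2 - (\<beta> b)\<^sup>2" for b
    by (simp add: v_def AB c_def power2_eq_square algebra_simps)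
  define W where "W b = ww k (rot45 (a, b))" for b
  have W_in: "W b = v b ^ k" if "b \<in> L" for b
    using that by (simp add: W_def ww_def L_def z_def[symmetric] u_def[symmetric] weight_inside v_def A_def B_def power_mult_distrib)
  have W_out: "W b = 0" if "b \<notin> L" for b
    using that unfolding W_def by (intro ww_outside k) (auto simp: L_def z_def u_def)
  have W0: "0 \<le> W b" and W1: "W b \<le> indicator L b" for b
    using ww_le_1[of k "rot45 (a, b)"] W_out[of b] by (auto simp: W_def indicator_def)
  have [measurable]: "W \<in> borel_measurable borel"
    unfolding W_def ww_def z_def[symmetric] u_def[symmetric] by measurable
  have intW: "integrable lborel W"
    by (rule Bochner_Integration.integrable_bound[OF indL]) (use W0 W1 in \<open>auto intro!: AE_I2\<close>)
  \<comment> \<open>\<open>c ^ (2 * k)\<close> is the value of the weight at the centre b = 0, its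
    maximum over the lens. Normalized by it, the weight satisfies the scaling condition of the
    layer-cake bound.\<close>
  have W_ge: "c ^ (2 * k) * m / (2 * real k + 1) \<le> (LINT b|lborel. W b)"
  proof -
    have "ennreal (m / (2 * real k + 1)) \<le> (\<integral>\<^sup>+b. indicator L b * ennreal (W b / c ^ (2 * k)) \<partial>lborel)"
    proof (rule layer_cake_scaling[OF k _ _ m(2)])
      show "0 \<le> W b / c ^ (2 * k) \<and> W b / c ^ (2 * k) \<le> 1" if "b \<in> L" for b
      proof -
        have "(c - \<eta> b)\<^sup>2 \<le> c\<^sup>2" using that \<eta>0[of b] by (intro power_mono) (auto simp: L_iff2)
        hence "v b \<le> c\<^sup>2" using zero_le_power2[of "\<beta> b"] unfolding v by linarith
        moreover have "0 \<le> v b" using that by (simp add: v_def L_iff)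
        ultimately have "v b ^ k \<le> (c\<^sup>2) ^ k" by (intro power_mono)
        thus ?thesis using c W0[of b] by (simp add: W_in[OF that] power_mult)
      qed
      show "t *\<^sub>R b \<in> L \<and> (1 - t\<^sup>2) ^ (2 * k) \<le> W (t *\<^sub>R b) / c ^ (2 * k)"
        if t: "0 < t" "t < 1" and b: "b \<in> L" for t b
      proof -
        have s: "\<eta> (t *\<^sub>R b) = t\<^sup>2 * \<eta> b" "\<beta> (t *\<^sub>R b) = t * \<beta> b"
          by (simp_all add: \<eta>_def \<beta>_def power_mult_distrib algebra_simps)
        have t2: "t\<^sup>2 < 1" "0 \<le> t\<^sup>2" using t by (auto simp: abs_square_less_1)
        have "t\<^sup>2 * \<eta> b + t * \<bar>\<beta> b\<bar> \<le> 1 * \<eta> b + 1 * \<bar>\<beta> b\<bar>"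
          using t t2 \<eta>0[of b] by (intro add_mono mult_right_mono) auto
        hence tb: "t *\<^sub>R b \<in> L" using b t by (simp add: L_iff2 s abs_mult)
        have \<beta>c: "(\<beta> b)\<^sup>2 \<le> (c - \<eta> b)\<^sup>2"
          using b by (intro abs_le_square_iff[THEN iffD1]) (auto simp: L_iff2)
        have \<eta>c: "(\<eta> b)\<^sup>2 \<le> c\<^sup>2" using b \<eta>0[of b] by (intro power_mono) (auto simp: L_iff2)
        \<comment> \<open>The two inequalities of the chain use \<eta> <= c and |\<beta>| <= c -
          \<eta>, both valid on the lens; the rest is algebra.\<close>
        have "((1 - t\<^sup>2) * c)\<^sup>2 = (1 - t\<^sup>2) * (c\<^sup>2 - t\<^sup>2 * c\<^sup>2)"
          by (simp add: power2_eq_square algebra_simps)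
        also have "\<dots> \<le> (1 - t\<^sup>2) * (c\<^sup>2 - t\<^sup>2 * (\<eta> b)\<^sup>2)"
          using t2 \<eta>c by (intro mult_left_mono diff_left_mono) auto
        also have "\<dots> = (c - t\<^sup>2 * \<eta> b)\<^sup>2 - t\<^sup>2 * (c - \<eta> b)\<^sup>2"
          by (simp add: power2_eq_square algebra_simps)
        also have "\<dots> \<le> (c - t\<^sup>2 * \<eta> b)\<^sup>2 - t\<^sup>2 * (\<beta> b)\<^sup>2"
          using t2 \<beta>c by (intro diff_left_mono mult_left_mono) auto
        also have "\<dots> = v (t *\<^sub>R b)" by (simp add: v s power_mult_distrib)
        finally have "(((1 - t\<^sup>2) * c)\<^sup>2) ^ k \<le> v (t *\<^sub>R b) ^ k" by (intro power_mono) auto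
        hence "(1 - t\<^sup>2) ^ (2 * k) * c ^ (2 * k) \<le> W (t *\<^sub>R b)"
          by (simp add: W_in[OF tb] power_mult[symmetric] power_mult_distrib)
        thus ?thesis using tb c by (simp add: pos_le_divide_eq)
      qed
    qed (use m in auto)
    also have "(\<integral>\<^sup>+b. indicator L b * ennreal (W b / c ^ (2 * k)) \<partial>lborel) = (\<integral>\<^sup>+b. ennreal (W b / c ^ (2 * k)) \<partial>lborel)"
      by (intro nn_integral_cong) (auto simp: indicator_def W_out)
    also have "\<dots> = ennreal (LINT b|lborel. W b / c ^ (2 * k))"
      using intW W0 c by (intro nn_integral_eq_integral) auto
    finally have "m / (2 * real k + 1) \<le> (LINT b|lborel. W b / c ^ (2 * k))"
      using W0 c by (subst (asm) ennreal_le_iff) (auto intro!: integral_nonneg_AE AE_I2)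
    thus ?thesis using c by (simp add: pos_le_divide_eq mult_ac)
  qed
  have W_pos: "0 < (LINT b|lborel. W b)"
    using m(1) c by (intro less_le_trans[OF _ W_ge]) auto
  define R where "R b = ratio k (rot45 (a, b))" for b
  define Q where "Q b = A b ^ (k + 2) * B b ^ (k + 1)" for b
  define \<tau> where "\<tau> = shrink (of_real (sqrt 2) * a)"
  have \<tau>: "0 \<le> \<tau>" "\<tau> \<le> 1" unfolding \<tau>_def by (rule shrink_bounds)+
  have R: "R b = \<tau> * Q b" for b
    unfolding R_def ratio_def fst_add_snd_rot45 fst_conv \<tau>_def[symmetric] Q_def A_def B_def z_def u_def
    by (simp add: norm_mult norm_power power_mult_distrib power_mult[symmetric] mult.commute)
  have Q: "0 \<le> Q b" "Q b < 1" if "b \<in> L" for b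
  proof -
    have AB1: "0 \<le> A b" "A b < 1" "0 \<le> B b" "B b < 1" using that by (auto simp: L_iff) (auto simp: A_def B_def)
    show "0 \<le> Q b" using AB1 by (simp add: Q_def)
    have "Q b \<le> A b ^ 1 * 1" unfolding Q_def using AB1
      by (intro mult_mono power_decreasing power_le_one) auto
    thus "Q b < 1" using AB1 by simp
  qed
  have jf: "jfun k (rot45 (a, b)) = W b * (\<rho> / 2 - cmod (z b) * (R b / (1 - R b)))" for b
    unfolding jfun_def fst_add_snd_rot45 W_def R_def z_def \<rho>_def by (simp add: norm_mult)
  have jm [measurable]: "(\<lambda>b. jfun k (rot45 (a, b))) \<in> borel_measurable borel" by measurable
  have j_out: "jfun k (rot45 (a, b)) = 0" if "b \<notin> L" for b by (simp add: jf W_out[OF that])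
  have intj: "integrable lborel (\<lambda>b. jfun k (rot45 (a, b)))"
  proof (rule Bochner_Integration.integrable_bound)
    show "integrable lborel (\<lambda>b. (\<rho> / 2 + 1) * indicator L b :: real)" by (intro integrable_mult_right indL)
    show "AE b in lborel. norm (jfun k (rot45 (a, b))) \<le> norm ((\<rho> / 2 + 1) * indicator L b :: real)"
    proof (rule AE_I2)
      fix b
      show "norm (jfun k (rot45 (a, b))) \<le> norm ((\<rho> / 2 + 1) * indicator L b :: real)"
      proof (cases "b \<in> L")
        case True
        have "W b * (R b / (1 - R b)) \<le> 1 \<and> 0 \<le> W b * (R b / (1 - R b))"
        proof -
          have "indicator (ball 0 1 \<times> ball 0 1) (rot45 (a, b)) \<le> (1 :: real)" by (simp add: indicator_def)
          with ww_ratio_bound[OF k, of "rot45 (a, b)"] show ?thesis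
            unfolding W_def R_def by (auto intro: order_trans simp del: times_divide_eq_right)
        qed
        hence "cmod (z b) * (W b * (R b / (1 - R b))) \<le> 1 \<and> 0 \<le> cmod (z b) * (W b * (R b / (1 - R b)))"
          using True by (auto simp: L_def intro!: mult_le_one simp del: times_divide_eq_right)
        moreover have "W b * (\<rho> / 2) \<le> 1 * (\<rho> / 2)" "0 \<le> W b * (\<rho> / 2)"
          using W1[of b] W0[of b] \<rho>0 True by (auto intro!: mult_right_mono)
        moreover have "jfun k (rot45 (a, b)) = W b * (\<rho> / 2) - cmod (z b) * (W b * (R b / (1 - R b)))"
          by (simp add: jf algebra_simps)
        moreover have "\<bar>x - y\<bar> \<le> \<rho> / 2 + 1" if "y \<le> 1 \<and> 0 \<le> y" "x \<le> 1 * (\<rho> / 2)" "0 \<le> x" for x y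
          using that \<rho>0 by linarith
        ultimately have "\<bar>jfun k (rot45 (a, b))\<bar> \<le> \<rho> / 2 + 1" by simp
        thus ?thesis using True \<rho>0 by simp
      qed (simp add: j_out)
    qed
  qed measurable
  show ?thesis
  proof (cases "(761 / 500) \<le> \<rho>")
    \<comment> \<open>The threshold satisfies \<open>\<rho>^3 - \<rho> > 2\<close>, which makes the integrand nonnegative for larger \<open>\<rho>\<close>;
      below it the lens is large enough for the averaged estimate.\<close>
    case True
    have n: "cmod (of_real (sqrt 2) * a) = \<rho>" by (simp add: norm_mult \<rho>_def)
    have \<rho>2: "1 < \<rho>\<^sup>2" "(761 / 500)\<^sup>2 \<le> \<rho>\<^sup>2" using True power_mono[of "761 / 500" \<rho> 2] by (auto simp: power2_eq_square)
    have "1 / \<rho> \<le> 1" using True unfolding divide_le_eq_1 by linarith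
    hence "1 / \<rho> \<le> \<rho>" using True by linarith
    hence \<tau>\<rho>: "\<tau> = 1 / \<rho>\<^sup>2" by (simp add: \<tau>_def shrink_def n min_absorb2 power_divide)
    have "0 < \<rho>\<^sup>2" using \<rho>2 by linarith
    hence \<tau>1: "\<tau> < 1" unfolding \<tau>\<rho> by (simp only: pos_divide_less_eq mult_1 \<rho>2(1))
    \<comment> \<open>The integrand per unit weight in the worst case |z| = 1, Q = 1: then the tail
      is \<tau> / (1 - \<tau>) with \<tau> = 1 / \<rho>^2.\<close>
    define \<delta> where "\<delta> = \<rho> / 2 - 1 / (\<rho>\<^sup>2 - 1)"
    have "2 < (761 / 500) * ((761 / 500)\<^sup>2 - (1::real))" by (simp add: power2_eq_square)
    also have "\<dots> \<le> \<rho> * (\<rho>\<^sup>2 - 1)" using True \<rho>2 by (intro mult_mono) (auto simp: power2_eq_square)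
    finally have \<delta>: "0 < \<delta>" using \<rho>2 by (simp add: \<delta>_def field_simps)
    have "\<delta> * W b \<le> jfun k (rot45 (a, b))" for b
    proof (cases "b \<in> L")
      case True
      have "R b \<le> \<tau> * 1" unfolding R using Q[OF True] \<tau> by (intro mult_left_mono) auto
      hence R\<tau>: "0 \<le> R b" "R b \<le> \<tau>" using Q[OF True] \<tau> by (auto simp: R)
      have "R b / (1 - R b) \<le> \<tau> / (1 - \<tau>)" using R\<tau> \<tau>1 by (intro frac_le) auto
      also have "\<dots> = 1 / (\<rho>\<^sup>2 - 1)" using \<rho>2 \<rho>0 by (simp add: \<tau>\<rho> field_simps)
      finally have "cmod (z b) * (R b / (1 - R b)) \<le> 1 * (1 / (\<rho>\<^sup>2 - 1))"
        using True R\<tau> \<tau>1 by (intro mult_mono) (auto simp: L_def)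
      hence "\<delta> \<le> \<rho> / 2 - cmod (z b) * (R b / (1 - R b))" by (simp add: \<delta>_def)
      thus ?thesis unfolding jf using W0[of b] by (subst mult.commute) (rule mult_left_mono)
    qed (simp add: j_out W_out)
    hence "(LINT b|lborel. \<delta> * W b) \<le> (LINT b|lborel. jfun k (rot45 (a, b)))"
      by (intro integral_mono intj integrable_mult_right intW)
    moreover have "0 < (LINT b|lborel. \<delta> * W b)" using W_pos \<delta> by simp
    ultimately show ?thesis by linarith
  next
    case False
    define \<beta>k where "\<beta>k = (1 / 16) ^ (k - 1) / (34 :: real)"
    \<comment> \<open>A linear bound lets \<rho> be factored out of both gain and tail, so the
      comparison is uniform down to \<rho> = 0.\<close>
    have \<tau>\<rho>: "\<tau> \<le> \<rho>"
    proof (cases "\<rho> \<le> 1")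
      case True
      have "min \<rho> (1 / \<rho>) \<le> \<rho>" "0 \<le> min \<rho> (1 / \<rho>)" using \<rho>0 by auto
      hence "(min \<rho> (1 / \<rho>))\<^sup>2 \<le> \<rho>\<^sup>2" by (intro power_mono)
      also have "\<dots> \<le> \<rho>" using True \<rho>0 by (simp add: power2_eq_square mult_left_le_one_le)
      finally show ?thesis by (simp add: \<tau>_def shrink_def norm_mult \<rho>_def)
    qed (use \<tau> in linarith)
    have h2: "h = \<rho>\<^sup>2 / 4" by (simp add: h_def \<rho>_def power_mult_distrib)
    have "\<rho>\<^sup>2 < (761 / 500)\<^sup>2" using False \<rho>0 by (intro power_strict_mono) auto
    \<comment> \<open>263/625 = 0.4208 lies just below 1 - 1.522^2 / 4, and 16 * 0.4208^2 is still
      above 2.83.\<close>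
    hence c_ge: "263 / 625 \<le> c" by (simp add: c_def h2 power2_eq_square)
    have "2.83 \<le> 16 * c\<^sup>2"
      using power_mono[OF c_ge, of 2] by (simp add: power2_eq_square)
    hence num: "2 * (2 * real k + 1) * \<beta>k < (c\<^sup>2) ^ k"
      unfolding \<beta>k_def by (rule lens_constant_bound[OF _ k])
    \<comment> \<open>The left side may be negative near the rim of the lens, where the weight is
      small; only its integral is shown to be positive.\<close>
    have "\<rho> * (W b / 2 - \<beta>k * indicator L b) \<le> jfun k (rot45 (a, b))" for b
    proof (cases "b \<in> L")
      case True
      have AB1: "0 \<le> A b" "A b < 1" "0 \<le> B b" "B b < 1" using True by (auto simp: L_iff) (auto simp: A_def B_def)
      have "R b \<le> 1 * Q b" unfolding R using Q[OF True] \<tau> by (intro mult_right_mono) auto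
      hence RQ: "0 \<le> R b" "R b \<le> Q b" using Q[OF True] \<tau> by (auto simp: R)
      have "R b \<le> \<rho> * Q b" unfolding R using Q[OF True] \<tau>\<rho> by (intro mult_right_mono) auto
      hence "R b / (1 - R b) \<le> \<rho> * Q b / (1 - Q b)"
        using RQ Q[OF True] \<rho>0 by (intro frac_le) auto
      hence "cmod (z b) * (R b / (1 - R b)) \<le> 1 * (\<rho> * Q b / (1 - Q b))"
        using True RQ Q[OF True] by (intro mult_mono) (auto simp: L_def)
      hence "W b * (cmod (z b) * (R b / (1 - R b))) \<le> W b * (\<rho> * Q b / (1 - Q b))"
        using W0[of b] by (intro mult_left_mono) auto
      also have "\<dots> = \<rho> * (v b ^ k * (Q b / (1 - Q b)))" by (simp add: W_in[OF True])
      also have "\<dots> \<le> \<rho> * \<beta>k"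
        unfolding \<beta>k_def v_def Q_def using \<rho>0 by (intro mult_left_mono weight_ratio_small AB1 k) auto
      finally have "W b * (\<rho> / 2) - \<rho> * \<beta>k \<le> W b * (\<rho> / 2) - W b * (cmod (z b) * (R b / (1 - R b)))"
        by (rule diff_left_mono)
      moreover have "\<rho> * (W b / 2 - \<beta>k * indicator L b) = W b * (\<rho> / 2) - \<rho> * \<beta>k"
        using True by (simp add: algebra_simps)
      ultimately show ?thesis by (simp only: jf right_diff_distrib)
    qed (simp add: j_out W_out)
    hence "(LINT b|lborel. \<rho> * (W b / 2 - \<beta>k * indicator L b)) \<le> (LINT b|lborel. jfun k (rot45 (a, b)))"
      by (intro integral_mono intj integrable_mult_right Bochner_Integration.integrable_diff intW indL) (auto intro: intW)
    moreover have "(LINT b|lborel. \<rho> * (W b / 2 - \<beta>k * indicator L b)) = \<rho> * ((LINT b|lborel. W b) / 2 - \<beta>k * m)"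
    proof -
      have "integrable lborel (\<lambda>b. W b / 2)" "integrable lborel (\<lambda>b. \<beta>k * indicator L b)"
        using intW indL by auto
      thus ?thesis by (simp add: Bochner_Integration.integral_diff m_def)
    qed
    moreover have "\<beta>k * m < (LINT b|lborel. W b) / 2"
    proof -
      have "2 * (2 * real k + 1) * \<beta>k * m < (c\<^sup>2) ^ k * m" using num m(1) by (rule mult_strict_right_mono)
      hence "\<beta>k * m < c ^ (2 * k) * m / (2 * real k + 1) / 2"
        by (simp add: power_mult[symmetric] field_simps)
      also have "\<dots> \<le> (LINT b|lborel. W b) / 2" using W_ge by (rule divide_right_mono) simp
      finally show ?thesis .
    qed
    hence "0 < \<rho> * ((LINT b|lborel. W b) / 2 - \<beta>k * m)" using \<rho>0 by (intro mult_pos_pos) auto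
    ultimately show ?thesis by (metis less_le_trans)
  qed
qed

section \<open>The inequality\<close>

text \<open>After the orthogonal change of variables the bound is an integral over a of a
  nonnegative product, strictly positive almost everywhere in the disc |a| < sqrt 2, so it cannot
  vanish.\<close>

lemma integral_ww_kern_kap_neg:
  assumes \<gamma>: "0 < \<gamma>" "\<gamma> < 1" and k: "0 < k"
  shows "(LINT p|lborel. ww k p * kap \<gamma> (1 + (fst p + snd p)) * Re (kern k (fst p) (snd p))) < 0"
proof -
  define F where "F p = cmod (khat \<gamma> 1 (fst p + snd p)) * jfun k p" for p
  have [measurable]: "khat \<gamma> 1 \<in> borel_measurable borel" by (rule khat_measurable[OF \<gamma> k])
  have [measurable]: "F \<in> borel_measurable borel" unfolding F_def by measurable
  have rot: "linear rot45" "norm (rot45 p) = norm p" for p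
    unfolding rot45_def[abs_def] by (rule rotate45_pair)+
  have intF: "integrable lborel F" unfolding F_def by (rule integrable_khat_jfun[OF \<gamma> k])
  hence intFr: "integrable (lborel \<Otimes>\<^sub>M lborel) (\<lambda>p. F (rot45 p))"
    unfolding lborel_prod by (subst integrable_isometry_pair[OF rot]) auto
  define K where "K a = cmod (khat \<gamma> 1 (of_real (sqrt 2) * a))" for a
  define J where "J a = (LINT b|lborel. jfun k (rot45 (a, b)))" for a
  have inner: "(LINT b|lborel. F (rot45 (a, b))) = K a * J a" for a
    unfolding F_def fst_add_snd_rot45 fst_conv K_def J_def by simp
  have intg: "integrable lborel (\<lambda>a. K a * J a)"
    using lborel_pair.integrable_fst'[OF intFr] by (simp only: inner)
  have "(LINT p|lborel. F p) = (LINT p|lborel. F (rot45 p))"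
    by (rule integral_isometry_pair[OF rot, symmetric]) simp
  also have "\<dots> = (LINT p|(lborel \<Otimes>\<^sub>M lborel). F (rot45 p))" by (simp only: lborel_prod)
  also have "\<dots> = (LINT a|lborel. K a * J a)"
    using lborel_pair.integral_fst'[OF intFr] by (simp only: inner)
  finally have F_eq: "(LINT p|lborel. F p) = (LINT a|lborel. K a * J a)" .
  \<comment> \<open>Here |z + u| is at least 2, which no pair in the open bidisc attains.\<close>
  have J0: "J a = 0" if "sqrt 2 \<le> cmod a" for a
  proof -
    have "ww k (rot45 (a, b)) = 0" for b
    proof (rule ww_outside[OF k], rule notI)
      assume "cmod (fst (rot45 (a, b))) < 1 \<and> cmod (snd (rot45 (a, b))) < 1"
      hence "cmod (fst (rot45 (a, b)) + snd (rot45 (a, b))) < 2"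
        using norm_triangle_ineq[of "fst (rot45 (a, b))" "snd (rot45 (a, b))"] by linarith
      hence "sqrt 2 * cmod a < 2" unfolding fst_add_snd_rot45 by (simp add: norm_mult)
      moreover have "sqrt 2 * sqrt 2 \<le> sqrt 2 * cmod a" using that by (intro mult_left_mono) auto
      ultimately show False by simp
    qed
    thus ?thesis by (simp add: J_def jfun_def)
  qed
  have Jpos: "0 < J a" if "a \<noteq> 0" "cmod a < sqrt 2" for a
    unfolding J_def by (rule lens_integral_pos[OF k]) (use that in auto)
  have ae_pos: "AE a in lborel. 0 \<le> K a * J a \<and> (cmod a < sqrt 2 \<longrightarrow> 0 < K a * J a)"
    \<comment> \<open>The two discarded spheres are z + u = 0 and |z + u| = 1, where the first
      Fourier coefficient is not known to be nonzero.\<close>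
    using AE_not_in[OF null_sets_sphere[of "0::complex" 0]] AE_not_in[OF null_sets_sphere[of "0::complex" "1 / sqrt 2"]]
  proof eventually_elim
    case (elim a)
    hence a: "a \<noteq> 0" "cmod (of_real (sqrt 2) * a) \<noteq> 1" by (auto simp: norm_mult field_simps)
    have "0 < K a" unfolding K_def using khat_neq_0[OF \<gamma> _ a(2)] a(1) by simp
    thus ?case using J0[of a] Jpos[OF a(1)] by (cases "cmod a < sqrt 2") auto
  qed
  have "0 \<le> (LINT a|lborel. K a * J a)"
    using ae_pos by (intro integral_nonneg_AE) (auto elim: AE_mp)
  moreover have "(LINT a|lborel. K a * J a) \<noteq> 0"
  proof
    assume "(LINT a|lborel. K a * J a) = 0"
    hence "AE a in lborel. K a * J a = 0"
      using ae_pos by (subst (asm) integral_nonneg_eq_0_iff_AE[OF intg]) (auto elim: AE_mp)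
    hence "AE a in lborel. a \<notin> ball (0::complex) 1"
      using ae_pos
    proof eventually_elim
      case (elim a)
      have "1 < sqrt 2" by simp
      thus ?case using elim by (auto simp del: real_sqrt_gt_1_iff)
    qed
    hence "ball (0::complex) 1 \<in> null_sets lborel"
      by (subst (asm) AE_iff_null_sets[symmetric]) auto
    thus False using content_ball_pos[of 1 "0::complex"] by (simp add: null_sets_def measure_def)
  qed
  ultimately have "0 < (LINT p|lborel. F p)" unfolding F_eq by linarith
  thus ?thesis using integral_ww_kern_kap_le[OF \<gamma> k] unfolding F_def by linarith
qed

lemma cmod_line:
  assumes "\<sigma> = 1 \<or> \<sigma> = (-1 :: real)"
  shows "cmod (line k \<sigma> x) = cmod (1 + e x + of_real \<sigma> * e (real (k + 2) * x))"
proof -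
  define E where "E = e (real (k + 2) * x)"
  have E: "E * cnj E = 1" using complex_norm_square[of E] by (simp add: E_def)
  have "e (real (k + 1) * x) = E * cnj (e x)"
    unfolding E_def e_minus[symmetric] e_add[symmetric] by (simp add: algebra_simps)
  hence "line k \<sigma> x = 1 + \<sigma> * (E * cnj (e x)) + \<sigma> * E" by (simp only: line_def E_def)
  also have "\<dots> = \<sigma> * E * cnj (1 + e x + of_real \<sigma> * E)"
    using assms E by (auto simp: algebra_simps)
  finally have "cmod (line k \<sigma> x) = \<bar>\<sigma>\<bar> * cmod E * cmod (1 + e x + of_real \<sigma> * E)"
    by (simp only: norm_mult norm_of_real complex_mod_cnj)
  thus ?thesis using assms by (auto simp: E_def)
qed

section \<open>The case k = 0\<close>

lemma integral_shift_periodic: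
  fixes f :: "real \<Rightarrow> real"
  assumes cont: "continuous_on UNIV f" and per: "\<And>x. f (x + 1) = f x" and c: "0 \<le> c" "c \<le> 1"
  shows "integral {0..1} (\<lambda>x. f (c + x)) = integral {0..1} f"
proof -
  have int: "f integrable_on {a..b}" for a b
    by (intro integrable_continuous_real continuous_on_subset[OF cont]) auto
  have "integral {0..1} (\<lambda>x. f (c + x)) = integral {0 + c..1 + c} f"
    unfolding integral_shift_Icc_real[symmetric] by (simp add: o_def)
  also have "\<dots> = integral {c..1} f + integral {1..1 + c} f"
    using Henstock_Kurzweil_Integration.integral_combine[of c 1 "1 + c" f] c int by simp
  also have "integral {1..1 + c} f = integral {0..c} (f \<circ> (+) 1)"
    unfolding integral_shift_Icc_real by (simp add: add.commute)
  also have "f \<circ> (+) 1 = f" using per by (auto simp: add.commute)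
  also have "integral {c..1} f + integral {0..c} f = integral {0..1} f"
    using Henstock_Kurzweil_Integration.integral_combine[of 0 c 1 f] c int by simp
  finally show ?thesis .
qed

text \<open>Weighted AM-GM for u and 1 with weights s and 1 - s. With M their weighted mean, ln x <=
  x - 1 is applied at u / M and 1 / M; equality in both would force u = 1.\<close>

lemma powr_less_tangent:
  fixes u s :: real
  assumes "0 < s" "s < 1" "0 \<le> u" "u \<noteq> 1"
  shows "u powr s < 1 + s * (u - 1)"
proof (cases "u = 0")
  case False
  define M where "M = 1 + s * (u - 1)"
  have u: "0 < u" using False assms by simp
  have "M = (1 - s) + s * u" by (simp add: M_def algebra_simps)
  hence M: "0 < M" using assms u by (simp add: add_pos_pos)
  have "ln (u / M) \<le> u / M - 1" "ln (1 / M) \<le> 1 / M - 1"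
    using u M by (intro ln_le_minus_one divide_pos_pos; simp)+
  moreover have "ln (1 / M) < 1 / M - 1 \<or> ln (u / M) < u / M - 1"
    using ln_eq_minus_one[of "1 / M"] ln_eq_minus_one[of "u / M"] assms u M
      ln_le_minus_one[of "1 / M"] ln_le_minus_one[of "u / M"] by (force simp: less_le)
  ultimately have "s * ln (u / M) + (1 - s) * ln (1 / M) < s * (u / M - 1) + (1 - s) * (1 / M - 1)"
    using assms by (smt (verit) mult_left_mono mult_strict_left_mono)
  also have "\<dots> = ((1 - s) + s * u) / M - 1" by (simp add: add_divide_distrib algebra_simps diff_divide_distrib)
  also have "\<dots> = 0" using \<open>M = (1 - s) + s * u\<close> M by simp
  finally have "s * ln u < ln M" using u M by (simp add: ln_div algebra_simps)
  hence "exp (s * ln u) < exp (ln M)" by (simp only: exp_less_cancel_iff)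
  also have "\<dots> = M" by (rule exp_ln[OF M])
  finally show ?thesis using u by (simp add: powr_def M_def)
qed (use assms in auto)

lemma powr_midpoint:
  fixes A B s :: real
  assumes s: "0 < s" "s < 1" and AB: "0 \<le> A" "0 \<le> B"
  shows "A powr s + B powr s \<le> 2 * ((A + B) / 2) powr s"
    and "A \<noteq> B \<Longrightarrow> A powr s + B powr s < 2 * ((A + B) / 2) powr s"
proof -
  have strict: "A powr s + B powr s < 2 * ((A + B) / 2) powr s" if "A \<noteq> B"
  proof -
    define M where "M = (A + B) / 2"
    have M: "0 < M" using AB that by (auto simp: M_def)
    have "A / M \<noteq> 1" "B / M \<noteq> 1" using M that by (auto simp: M_def)
    hence "(A / M) powr s < 1 + s * (A / M - 1)" "(B / M) powr s < 1 + s * (B / M - 1)"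
      using s AB M by (auto intro!: powr_less_tangent)
    hence "(A / M) powr s + (B / M) powr s < 2 + s * ((A + B) / M - 2)"
      by (simp add: algebra_simps add_divide_distrib)
    also have "A + B = 2 * M" by (simp add: M_def)
    also have "2 + s * (2 * M / M - 2) = 2" using M by simp
    finally have "M powr s * ((A / M) powr s + (B / M) powr s) < M powr s * 2" using M by simp
    thus ?thesis using M AB by (simp add: distrib_left powr_mult[symmetric] M_def[symmetric] mult.commute)
  qed
  thus "A \<noteq> B \<Longrightarrow> A powr s + B powr s < 2 * ((A + B) / 2) powr s" .
  show "A powr s + B powr s \<le> 2 * ((A + B) / 2) powr s"
    using strict by (cases "A = B") auto
qed

text \<open>Divided by z, the three expressions are 2 Re z + 1, 2 Re z - 1 and 2 Re z - i, so the
  claim is (2x + 1)^2 + (2x - 1)^2 = 2 (4 x^2 + 1).\<close>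

lemma cmod_rotation_average:
  assumes "cmod z = 1"
  shows "(cmod (1 + z + z\<^sup>2))\<^sup>2 + (cmod (1 - z + z\<^sup>2))\<^sup>2 = 2 * (cmod (1 - \<i> * z + z\<^sup>2))\<^sup>2"
proof -
  have n: "(Re z)\<^sup>2 + (Im z)\<^sup>2 = 1" using assms cmod_power2[of z] by simp
  have "(cmod (1 + z + z\<^sup>2))\<^sup>2 + (cmod (1 - z + z\<^sup>2))\<^sup>2 - 2 * (cmod (1 - \<i> * z + z\<^sup>2))\<^sup>2
      = 4 * Im z * ((Re z)\<^sup>2 + (Im z)\<^sup>2 - 1)"
    unfolding cmod_power2 by (simp add: power2_eq_square algebra_simps)
  thus ?thesis unfolding n by simp
qed

lemma integral_line_zero_less:
  fixes s :: real
  assumes s: "0 < s" "s < 1"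
  shows "(LINT x:{0..<1}|lborel. (cmod (line 0 1 x))\<^sup>2 powr s) < (LINT x:{0..<1}|lborel. (cmod (line 0 (-1) x))\<^sup>2 powr s)"
proof -
  define y where "y \<sigma> x = (cmod (line 0 \<sigma> x))\<^sup>2" for \<sigma> x
  define P where "P \<sigma> x = y \<sigma> x powr s" for \<sigma> x
  have line: "line 0 \<sigma> x = 1 + \<sigma> * e x + \<sigma> * (e x)\<^sup>2" for \<sigma> x
    by (simp add: line_def e_power)
  have cis: "e x = cis (2 * pi * x)" for x
    by (simp add: e_def cis_conv_exp mult_ac)
  have e_half: "e (1 / 2) = - 1" and e_quarter: "e (1 / 4) = \<i>" by (simp_all add: cis complex_eq_iff)
  \<comment> \<open>A quarter turn replaces z by i z, and 1 - i z - (i z)^2 is 1 - i z +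
    z^2.\<close>
  have y_avg: "y (-1) (1 / 4 + x) = (y 1 x + y 1 (1 / 2 + x)) / 2" for x
    using cmod_rotation_average[of "e x"]
    by (simp add: y_def line e_add e_half e_quarter power_mult_distrib)
  have cont: "continuous_on UNIV (P \<sigma>)" for \<sigma>
    unfolding P_def y_def by (intro continuous_on_powr' continuous_intros) (use s in auto)
  have per: "P \<sigma> (x + 1) = P \<sigma> x" for \<sigma> x
    using e_of_int[of 1] by (simp add: P_def y_def line e_add)
  have contc: "continuous_on T (\<lambda>x. P \<sigma> (c + x))" for \<sigma> c T
    by (rule continuous_on_compose2[OF cont]) (auto intro!: continuous_intros)
  have int: "(\<lambda>x. P \<sigma> (c + x)) integrable_on {0..1}" for \<sigma> c
    by (intro integrable_continuous_real contc)
  have shift: "integral {0..1} (\<lambda>x. P \<sigma> (c + x)) = integral {0..1} (P \<sigma>)" if "0 \<le> c" "c \<le> 1" for \<sigma> c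
    by (rule integral_shift_periodic[OF cont per that])
  define d where "d x = 2 * P (-1) (1 / 4 + x) - (P 1 (0 + x) + P 1 (1 / 2 + x))" for x
  have d_cont: "continuous_on {0..1} d" unfolding d_def by (intro continuous_intros contc)
  have d_nonneg: "0 \<le> d x" for x
    using powr_midpoint(1)[OF s, of "y 1 x" "y 1 (1 / 2 + x)"] by (simp add: d_def P_def y_avg) (simp add: y_def)
  \<comment> \<open>One point with unequal values makes the concavity strict there; continuity
    carries the strictness to the integral.\<close>
  have "y 1 0 = 9" "y 1 (1 / 2) = 1" by (simp_all add: y_def line e_half)
  hence "0 < d 0"
    using powr_midpoint(2)[OF s, of "y 1 0" "y 1 (1 / 2)"] y_avg[of 0] by (simp add: d_def P_def)
  hence "integral {0..1} d \<noteq> 0"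
    using integral_eq_0_iff[OF d_cont] d_nonneg by force
  moreover have "0 \<le> integral {0..1} d"
    using d_nonneg d_cont by (intro Henstock_Kurzweil_Integration.integral_nonneg integrable_continuous_real) auto
  moreover have "integral {0..1} d = 2 * integral {0..1} (\<lambda>x. P (-1) (1 / 4 + x))
      - (integral {0..1} (\<lambda>x. P 1 (0 + x)) + integral {0..1} (\<lambda>x. P 1 (1 / 2 + x)))"
    unfolding d_def using int
    by (simp add: Henstock_Kurzweil_Integration.integral_diff Henstock_Kurzweil_Integration.integral_add
        integrable_add integrable_on_mult_right del: add_0)
  ultimately have "integral {0..1} (P 1) < integral {0..1} (P (-1))"
    by (simp add: shift del: add_0)
  thus ?thesis
    using set_integral_Ico_continuous[OF cont[of 1]] set_integral_Ico_continuous[OF cont[of "-1"]]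
    by (simp add: P_def y_def)
qed

lemma integral_line_less:
  assumes "real k < s" "s < real k + 1"
  shows "(LINT x:{0..<1}|lborel. (cmod (line k 1 x))\<^sup>2 powr s) < (LINT x:{0..<1}|lborel. (cmod (line k (-1) x))\<^sup>2 powr s)"
proof (cases "k = 0")
  case True
  thus ?thesis using integral_line_zero_less[of s] assms by simp
next
  case False
  define \<gamma> where "\<gamma> = real k + 1 - s"
  have \<gamma>: "0 < \<gamma>" "\<gamma> < 1" and s: "real k + 1 - \<gamma> = s" using assms by (auto simp: \<gamma>_def)
  have "0 < Beta (1 - \<gamma>) (real k + 1)"
    unfolding Beta_def by (intro divide_pos_pos mult_pos_pos Gamma_real_pos) (use \<gamma> in auto)
  hence B: "0 < pi\<^sup>2 / 4 * Beta (1 - \<gamma>) (real k + 1) ^ 2" by simp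
  have "pi\<^sup>2 / 4 * Beta (1 - \<gamma>) (real k + 1) ^ 2 *
      ((LINT x:{0..<1}|lborel. (cmod (line k 1 x))\<^sup>2 powr s) - (LINT x:{0..<1}|lborel. (cmod (line k (-1) x))\<^sup>2 powr s)) < 0"
    using integral_ww_kern_kap_neg[OF \<gamma>, of k] integral_ww_kern_kap[OF \<gamma>, of k] False by (simp add: s)
  thus ?thesis using B by (simp add: mult_less_0_iff)
qed

theorem corollary1p2:
  fixes k :: nat and p :: real
  assumes "2 * real k < p" and "p < 2 * real k + 2"
  shows "Lp_norm_circle p (\<lambda>x. 1 + e x - e (real (k + 2) * x))
       > Lp_norm_circle p (\<lambda>x. 1 + e x + e (real (k + 2) * x))"
proof -
  have p: "0 < p" using assms(1) by (rule le_less_trans[rotated]) simp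
  have "cmod w powr p = (cmod w)\<^sup>2 powr (p / 2)" for w
    by (cases "w = 0") (simp_all add: powr_powr flip: powr_numeral)
  hence eq: "cmod (1 + e x + e (real (k + 2) * x)) powr p = (cmod (line k 1 x))\<^sup>2 powr (p / 2)"
    "cmod (1 + e x - e (real (k + 2) * x)) powr p = (cmod (line k (-1) x))\<^sup>2 powr (p / 2)" for x
    by (simp_all add: cmod_line)
  show ?thesis
    unfolding Lp_norm_circle_def eq
  proof (rule powr_less_mono2)
    show "(LINT x:{0..<1}|lborel. (cmod (line k 1 x))\<^sup>2 powr (p / 2)) < (LINT x:{0..<1}|lborel. (cmod (line k (-1) x))\<^sup>2 powr (p / 2))"
      by (rule integral_line_less) (use assms in auto)
    show "0 \<le> (LINT x:{0..<1}|lborel. (cmod (line k 1 x))\<^sup>2 powr (p / 2))"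
      unfolding set_lebesgue_integral_def by (intro integral_nonneg_AE AE_I2) simp
  qed (use p in simp)
qed

end
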